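(* Consider the six modes of convergence $$\mathrm{o},\quad \mathrm{uo},\quad \widehat\tau_{\mathcal{L}_{\mathrm{ob}}(E)},\quad \mathrm{SO},\quad \mathrm{SUO},\quad \mathrm{S}\widehat\tau_E$$ for nets in $\mathcal{L}_{\mathrm{ob}}(E)$, where $E$ is a Dedekind complete vector lattice. For an ordered pair $(c_1,c_2)$ of these six modes, let $P(c_1,c_2)$ be the statement: "for every Dedekind complete vector lattice $E$ (admitting a Hausdorff uo-Lebesgue topology in case $c_1$ or $c_2$ is one of $\widehat\tau_{\mathcal{L}_{\mathrm{ob}}(E)}$, $\mathrm{S}\widehat\tau_E$), every net $(T_\alpha)$ in $\mathcal{L}_{\mathrm{ob}}(E)$ and every $T\in\mathcal{L}_{\mathrm{ob}}(E)$: if $T_\alpha\to T$ in the sense of $c_1$, then $T_\alpha\to T$ in the sense of $c_2$." Then $P(c_1,c_2)$ is true exactly for the following pairs: - $c_1=\mathrm{o}$ and $c_2$ any of the six modes; - $c_1=\mathrm{uo}$ and $c_2\in\{\mathrm{uo},\widehat\tau_{\mathcal{L}_{\mathrm{ob}}(E)}\}$; - $c_1=\widehat\tau_{\mathcal{L}_{\mathrm{ob}}(E)}$ and $c_2=\widehat\tau_{\mathcal{L}_{\mathrm{ob}}(E)}$; - $c_1=\mathrm{SO}$ and $c_2\in\{\mathrm{SO},\mathrm{SUO},\mathrm{S}\widehat\tau_E\}$; - $c_1=\mathrm{SUO}$ and $c_2\in\{\mathrm{SUO},\mathrm{S}\widehat\tau_E\}$; - $c_1=\mathrm{S}\widehat\tau_E$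 and $c_2=\mathrm{S}\widehat\tau_E$. For each of the remaining pairs $(c_1,c_2)$ the statement $P(c_1,c_2)$ is false, i.e. there exist such an $E$, a net and a limit for which the implication fails.
   Context: All vector lattices are real and Archimedean. $\mathcal{L}_{\mathrm{ob}}(E)$ is the space of order bounded linear operators $E\to E$, which is a Dedekind complete vector lattice (ordered by: $S\le T$ iff $T-S$ maps positive elements to positive elements) when $E$ is Dedekind complete. In a vector lattice $G$, a net $(x_\alpha)_{\alpha\in A}$ is order convergent to $x$ (mode o; $x_\alpha\xrightarrow{\mathrm{o}}x$) if there is a net $(y_\beta)_{\beta\in B}$ in $G$ with $y_\beta\downarrow 0$ such that for every $\beta_0\in B$ there is $\alpha_0\in A$ with $|x-x_\alpha|\le y_{\beta_0}$ for all $\alpha\ge\alpha_0$. It is unbounded order convergent to $x$ (mode uo; $x_\alpha\xrightarrow{\mathrm{uo}}x$) if $|x_\alpha-x|\wedge y\xrightarrow{\mathrm{o}}0$ for all $y\in G^+$. A uo-Lebesgue topology on $G$ is a locally solid linear topology $\tau$ on $G$ such that $x_\alpha\xrightarrow{\mathrm{uo}}0$ implies $x_\alpha\xrightarrow{\tau}0$ for every net. A vector lattice $G$ admits at most one Hausdorff uo-Lebesgue topology, denoted $\widehat\tau_G$ if it exists. For Dedekind complete $E$, $\mathcal{L}_{\mathrm{ob}}(E)$ admits one if and only if $E$ does. For nets in $\mathcal{L}_{\mathrm{ob}}(E)$, the modes o, uo and $\widehat\tau_{\mathcal{L}_{\mathrm{ob}}(E)}$ are taken in the vector lattice $\mathcal{L}_{\mathrm{ob}}(E)$.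 The strong modes are pointwise: $T_\alpha\to T$ in the sense of SO (resp. SUO, resp. $\mathrm{S}\widehat\tau_E$) means that $T_\alpha x\to Tx$ in order (resp. in unbounded order, resp. in $\widehat\tau_E$) in $E$ for every $x\in E$. *)

theory Defs
  imports "HOL-Analysis.Analysis" "HOL-Library.Function_Algebras"
begin

section \<open>Pointwise real vector space of functions\<close>

instantiation "fun" :: (type, real_vector) real_vector
begin

definition scaleR_fun_def: "c *\<^sub>R f = (\<lambda>x. c *\<^sub>R f x)"

instance
  by standard (simp_all add: scaleR_fun_def fun_eq_iff scaleR_add_right scaleR_add_left)

end

lemma scaleR_fun_apply [simp]: "(c *\<^sub>R f) x = c *\<^sub>R f x"
  by (simp add: scaleR_fun_def)


section \<open>Nets\<close>

text \<open>A directed index set is a relation \<open>r\<close>, where \<open>(a, b) \<in> r\<close> reads \<open>a \<le> b\<close>; since \<open>r\<close> is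
  reflexive, the index set is \<open>Field r\<close>.  As usual for nets, \<open>\<le>\<close> is only a preorder.\<close>

definition directed :: "'i rel \<Rightarrow> bool" where
  "directed r \<longleftrightarrow> preorder_on (Field r) r \<and> Field r \<noteq> {} \<and>
     (\<forall>a\<in>Field r. \<forall>b\<in>Field r. \<exists>c\<in>Field r. (a, c) \<in> r \<and> (b, c) \<in> r)"

definition net_filter :: "'i rel \<Rightarrow> 'i filter" where
  "net_filter r = (INF a\<in>Field r. principal (r `` {a}))"

lemma eventually_net_filter:
  assumes "directed r"
  shows "eventually P (net_filter r) \<longleftrightarrow> (\<exists>a\<in>Field r. \<forall>b. (a, b) \<in> r \<longrightarrow> P b)"
proof -
  have tr: "trans r" and ne: "Field r \<noteq> {}"
    and dir: "\<And>a b. a \<in> Field r \<Longrightarrow> b \<in> Field r \<Longrightarrow> \<exists>c\<in>Field r. (a, c) \<in> r \<and> (b, c) \<in> r"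
    using assms by (auto simp: directed_def preorder_on_def)
  have "eventually P (net_filter r) \<longleftrightarrow> (\<exists>a\<in>Field r. eventually P (principal (r `` {a})))"
    unfolding net_filter_def
  proof (rule eventually_INF_base[OF ne])
    fix a b assume "a \<in> Field r" "b \<in> Field r"
    then obtain c where c: "c \<in> Field r" "(a, c) \<in> r" "(b, c) \<in> r" using dir by blast
    then have "r `` {c} \<subseteq> r `` {a} \<inter> r `` {b}" using tr by (auto dest: transD)
    then show "\<exists>x\<in>Field r. principal (r `` {x}) \<le> inf (principal (r `` {a})) (principal (r `` {b}))"
      using c by (auto intro!: bexI[of _ c])
  qed
  then show ?thesis by (auto simp: eventually_principal)
qed


section \<open>Vector lattices\<close>

text \<open>The underlying real vector space is a linear subspace of an ambient type of class
  \<open>real_vector\<close>; the order only matters on the carrier.\<close>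

record 'a vlat =
  vcarrier :: "'a set"
  vle :: "'a \<Rightarrow> 'a \<Rightarrow> bool"

definition is_lub :: "'a vlat \<Rightarrow> 'a set \<Rightarrow> 'a \<Rightarrow> bool" where
  "is_lub G S s \<longleftrightarrow> s \<in> vcarrier G \<and> (\<forall>x\<in>S. vle G x s) \<and>
     (\<forall>u\<in>vcarrier G. (\<forall>x\<in>S. vle G x u) \<longrightarrow> vle G s u)"

definition is_glb :: "'a vlat \<Rightarrow> 'a set \<Rightarrow> 'a \<Rightarrow> bool" where
  "is_glb G S s \<longleftrightarrow> s \<in> vcarrier G \<and> (\<forall>x\<in>S. vle G s x) \<and>
     (\<forall>u\<in>vcarrier G. (\<forall>x\<in>S. vle G u x) \<longrightarrow> vle G u s)"

definition vjoin :: "'a vlat \<Rightarrow> 'a \<Rightarrow> 'a \<Rightarrow> 'a" where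
  "vjoin G x y = (THE s. is_lub G {x, y} s)"

definition vmeet :: "'a vlat \<Rightarrow> 'a \<Rightarrow> 'a \<Rightarrow> 'a" where
  "vmeet G x y = (THE s. is_glb G {x, y} s)"

definition vabs :: "'a::real_vector vlat \<Rightarrow> 'a \<Rightarrow> 'a" where
  "vabs G x = vjoin G x (- x)"

definition vector_lattice :: "'a::real_vector vlat \<Rightarrow> bool" where
  "vector_lattice G \<longleftrightarrow>
     subspace (vcarrier G) \<and>
     (\<forall>x\<in>vcarrier G. vle G x x) \<and>
     (\<forall>x\<in>vcarrier G. \<forall>y\<in>vcarrier G. vle G x y \<longrightarrow> vle G y x \<longrightarrow> x = y) \<and>
     (\<forall>x\<in>vcarrier G. \<forall>y\<in>vcarrier G. \<forall>z\<in>vcarrier G. vle G x y \<longrightarrow> vle G y z \<longrightarrow> vle G x z) \<and>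
     (\<forall>x\<in>vcarrier G. \<forall>y\<in>vcarrier G. \<forall>z\<in>vcarrier G. vle G x y \<longrightarrow> vle G (x + z) (y + z)) \<and>
     (\<forall>x\<in>vcarrier G. \<forall>c::real. 0 \<le> c \<longrightarrow> vle G 0 x \<longrightarrow> vle G 0 (c *\<^sub>R x)) \<and>
     (\<forall>x\<in>vcarrier G. \<forall>y\<in>vcarrier G. (\<exists>s. is_lub G {x, y} s) \<and> (\<exists>s. is_glb G {x, y} s))"

definition archimedean :: "'a::real_vector vlat \<Rightarrow> bool" where
  "archimedean G \<longleftrightarrow>
     (\<forall>x\<in>vcarrier G. \<forall>y\<in>vcarrier G. (\<forall>n::nat. vle G (real n *\<^sub>R x) y) \<longrightarrow> vle G x 0)"

definition dedekind_complete :: "'a::real_vector vlat \<Rightarrow> bool" where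
  "dedekind_complete G \<longleftrightarrow> vector_lattice G \<and> archimedean G \<and>
     (\<forall>S. S \<subseteq> vcarrier G \<and> S \<noteq> {} \<and> (\<exists>u\<in>vcarrier G. \<forall>x\<in>S. vle G x u)
        \<longrightarrow> (\<exists>s. is_lub G S s))"


section \<open>Order bounded operators\<close>

text \<open>An operator on \<open>E\<close> is represented by the function on the ambient type that agrees with it on the
  carrier and is \<open>0\<close> elsewhere, so that the representation is unique and these functions form a
  linear subspace of the function space.\<close>

definition order_bounded_operator :: "'a::real_vector vlat \<Rightarrow> ('a \<Rightarrow> 'a) \<Rightarrow> bool" where
  "order_bounded_operator E T \<longleftrightarrow>
     (\<forall>x\<in>vcarrier E. T x \<in> vcarrier E) \<and>
     (\<forall>x\<in>vcarrier E. \<forall>y\<in>vcarrier E. T (x + y) = T x + T y) \<and>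
     (\<forall>x\<in>vcarrier E. \<forall>c::real. T (c *\<^sub>R x) = c *\<^sub>R T x) \<and>
     (\<forall>a\<in>vcarrier E. \<forall>b\<in>vcarrier E. \<exists>c\<in>vcarrier E. \<exists>d\<in>vcarrier E. \<forall>x\<in>vcarrier E.
        vle E a x \<and> vle E x b \<longrightarrow> vle E c (T x) \<and> vle E (T x) d)"

definition L_ob :: "'a::real_vector vlat \<Rightarrow> ('a \<Rightarrow> 'a) vlat" where
  "L_ob E = \<lparr>vcarrier = {T. order_bounded_operator E T \<and> (\<forall>x. x \<notin> vcarrier E \<longrightarrow> T x = 0)},
             vle = (\<lambda>S T. \<forall>x\<in>vcarrier E. vle E 0 x \<longrightarrow> vle E 0 ((T - S) x))\<rparr>"


section \<open>Order convergence and unbounded order convergence\<close>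

text \<open>The net \<open>y\<close> decreasing to \<open>0\<close> is indexed by a subset of the type of \<open>G\<close> itself.  This is no
  restriction, see \<open>o_convI\<close> below.\<close>

definition decreases_to_0 :: "'a::real_vector vlat \<Rightarrow> 'b rel \<Rightarrow> ('b \<Rightarrow> 'a) \<Rightarrow> bool" where
  "decreases_to_0 G s y \<longleftrightarrow> directed s \<and> (\<forall>b\<in>Field s. y b \<in> vcarrier G) \<and>
     (\<forall>b c. (b, c) \<in> s \<longrightarrow> vle G (y c) (y b)) \<and> is_glb G (y ` Field s) 0"

definition o_conv :: "'a::real_vector vlat \<Rightarrow> 'i rel \<Rightarrow> ('i \<Rightarrow> 'a) \<Rightarrow> 'a \<Rightarrow> bool" where
  "o_conv G r x l \<longleftrightarrow> (\<exists>(s :: 'a rel) y. decreases_to_0 G s y \<and>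
     (\<forall>b\<in>Field s. \<exists>a\<in>Field r. \<forall>a'. (a, a') \<in> r \<longrightarrow> vle G (vabs G (l - x a')) (y b)))"

definition uo_conv :: "'a::real_vector vlat \<Rightarrow> 'i rel \<Rightarrow> ('i \<Rightarrow> 'a) \<Rightarrow> 'a \<Rightarrow> bool" where
  "uo_conv G r x l \<longleftrightarrow>
     (\<forall>u\<in>vcarrier G. vle G 0 u \<longrightarrow> o_conv G r (\<lambda>a. vmeet G (vabs G (x a - l)) u) 0)"

lemma o_convI:
  fixes s :: "'b rel"
  assumes G: "vector_lattice G"
    and y: "decreases_to_0 G s y"
    and ev: "\<And>b. b \<in> Field s \<Longrightarrow> \<exists>a\<in>Field r. \<forall>a'. (a, a') \<in> r \<longrightarrow> vle G (vabs G (l - x a')) (y b)"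
  shows "o_conv G r x l"
proof -
  define t where "t = {(u, v). u \<in> y ` Field s \<and> v \<in> y ` Field s \<and> vle G v u}"
  have yc: "\<And>b. b \<in> Field s \<Longrightarrow> y b \<in> vcarrier G"
    and ds: "directed s" and mono: "\<And>b c. (b, c) \<in> s \<Longrightarrow> vle G (y c) (y b)"
    and glb: "is_glb G (y ` Field s) 0"
    using y by (auto simp: decreases_to_0_def)
  have refl: "\<And>u. u \<in> vcarrier G \<Longrightarrow> vle G u u"
    and trans: "\<And>u v w. u \<in> vcarrier G \<Longrightarrow> v \<in> vcarrier G \<Longrightarrow> w \<in> vcarrier G \<Longrightarrow>
       vle G u v \<Longrightarrow> vle G v w \<Longrightarrow> vle G u w"
    using G unfolding vector_lattice_def by blast+
  have F: "Field t = y ` Field s"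
  proof
    show "Field t \<subseteq> y ` Field s" unfolding Field_def t_def by auto
    show "y ` Field s \<subseteq> Field t"
    proof
      fix u assume "u \<in> y ` Field s"
      then have "(u, u) \<in> t" using refl yc by (auto simp: t_def)
      then show "u \<in> Field t" by (auto simp: Field_def)
    qed
  qed
  have "preorder_on (Field t) t"
    unfolding preorder_on_def F
    by (auto simp: t_def refl_on_def trans_def intro: refl yc)
       (meson trans yc)
  moreover have "Field t \<noteq> {}" using ds F by (auto simp: directed_def)
  moreover have "\<exists>w\<in>Field t. (u, w) \<in> t \<and> (v, w) \<in> t" if uv: "u \<in> Field t" "v \<in> Field t" for u v
  proof -
    obtain b c where bc: "b \<in> Field s" "c \<in> Field s" "u = y b" "v = y c"
      using uv unfolding F by blast
    then obtain d where "d \<in> Field s" "(b, d) \<in> s" "(c, d) \<in> s"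
      using ds by (auto simp: directed_def)
    then show ?thesis using bc mono F by (intro bexI[of _ "y d"]) (auto simp: t_def)
  qed
  ultimately have "directed t" by (auto simp: directed_def)
  then have "decreases_to_0 G t (\<lambda>u. u)"
    using F yc glb by (auto simp: decreases_to_0_def t_def)
  then show ?thesis
    unfolding o_conv_def using ev F by (intro exI[of _ t] exI[of _ "\<lambda>u. u"]) auto
qed


section \<open>Unbounded order Lebesgue topologies\<close>

definition linear_topology :: "'a::real_vector vlat \<Rightarrow> 'a topology \<Rightarrow> bool" where
  "linear_topology G \<tau> \<longleftrightarrow> topspace \<tau> = vcarrier G \<and>
     continuous_map (prod_topology \<tau> \<tau>) \<tau> (\<lambda>(x, y). x + y) \<and>
     continuous_map (prod_topology euclideanreal \<tau>) \<tau> (\<lambda>(c, x). c *\<^sub>R x)"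

definition solid :: "'a::real_vector vlat \<Rightarrow> 'a set \<Rightarrow> bool" where
  "solid G S \<longleftrightarrow> S \<subseteq> vcarrier G \<and>
     (\<forall>x\<in>vcarrier G. \<forall>y\<in>S. vle G (vabs G x) (vabs G y) \<longrightarrow> x \<in> S)"

definition locally_solid :: "'a::real_vector vlat \<Rightarrow> 'a topology \<Rightarrow> bool" where
  "locally_solid G \<tau> \<longleftrightarrow> (\<forall>U. openin \<tau> U \<and> 0 \<in> U \<longrightarrow>
     (\<exists>V S. openin \<tau> V \<and> 0 \<in> V \<and> V \<subseteq> S \<and> solid G S \<and> S \<subseteq> U))"

text \<open>The index type \<open>'a set \<times> 'a\<close> is large enough to capture arbitrary nets in \<open>G\<close>, see
  \<open>uo_Lebesgue_net\<close> below.\<close>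

definition uo_Lebesgue :: "'a::real_vector vlat \<Rightarrow> 'a topology \<Rightarrow> bool" where
  "uo_Lebesgue G \<tau> \<longleftrightarrow> linear_topology G \<tau> \<and> locally_solid G \<tau> \<and>
     (\<forall>(r :: ('a set \<times> 'a) rel) x. directed r \<and> (\<forall>a\<in>Field r. x a \<in> vcarrier G) \<and> uo_conv G r x 0
        \<longrightarrow> limitin \<tau> x 0 (net_filter r))"

lemma uo_Lebesgue_net:
  fixes r :: "'i rel"
  assumes uoL: "uo_Lebesgue G \<tau>"
    and r: "directed r" and x: "\<And>a. a \<in> Field r \<Longrightarrow> x a \<in> vcarrier G"
    and uo: "uo_conv G r x 0"
  shows "limitin \<tau> x 0 (net_filter r)"
proof -
  define tl where "tl a = x ` (r `` {a})" for a
  define I where "I = {(V, v). (\<exists>a\<in>Field r. V = tl a) \<and> v \<in> V}"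
  define t where "t = {(p, q). p \<in> I \<and> q \<in> I \<and> fst q \<subseteq> fst p}"
  have refl: "\<And>a. a \<in> Field r \<Longrightarrow> (a, a) \<in> r" and trans: "trans r" and ne: "Field r \<noteq> {}"
    and dir: "\<And>a b. a \<in> Field r \<Longrightarrow> b \<in> Field r \<Longrightarrow> \<exists>c\<in>Field r. (a, c) \<in> r \<and> (b, c) \<in> r"
    using r by (auto simp: directed_def preorder_on_def refl_on_def)
  have rF: "\<And>a b. (a, b) \<in> r \<Longrightarrow> a \<in> Field r \<and> b \<in> Field r" by (auto simp: Field_def)
  have F: "Field t = I" unfolding Field_def t_def by auto
  have memI: "(tl a, x b) \<in> I" if "(a, b) \<in> r" for a b
    using that rF by (auto simp: I_def tl_def)
  have mono: "tl b \<subseteq> tl a" if "(a, b) \<in> r" for a b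
    using that trans by (auto simp: tl_def dest: transD)
  have "\<exists>w\<in>I. (u, w) \<in> t \<and> (v, w) \<in> t" if "u \<in> I" "v \<in> I" for u v
  proof -
    obtain a b where ab: "a \<in> Field r" "b \<in> Field r" "fst u = tl a" "fst v = tl b"
      using \<open>u \<in> I\<close> \<open>v \<in> I\<close> by (auto simp: I_def)
    then obtain c where "c \<in> Field r" "(a, c) \<in> r" "(b, c) \<in> r" using dir by blast
    then show ?thesis
      using ab that mono memI[OF refl] by (intro bexI[of _ "(tl c, x c)"]) (auto simp: t_def)
  qed
  moreover have "I \<noteq> {}" using ne memI refl by blast
  moreover have "preorder_on I t" by (auto simp: preorder_on_def t_def refl_on_def trans_def)
  ultimately have t: "directed t" unfolding directed_def F by blast
  have tail: "(\<exists>p\<in>Field t. \<forall>q. (p, q) \<in> t \<longrightarrow> P (snd q)) \<longleftrightarrow> (\<exists>a\<in>Field r. \<forall>b. (a, b) \<in> r \<longrightarrow> P (x b))"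
    for P
  proof
    assume "\<exists>p\<in>Field t. \<forall>q. (p, q) \<in> t \<longrightarrow> P (snd q)"
    then obtain p where p: "p \<in> I" "\<And>q. (p, q) \<in> t \<Longrightarrow> P (snd q)" unfolding F by blast
    then obtain a where a: "a \<in> Field r" "fst p = tl a" by (auto simp: I_def)
    have "P (x b)" if "(a, b) \<in> r" for b
      using p(2)[of "(tl a, x b)"] p(1) a memI[OF that] by (auto simp: t_def)
    then show "\<exists>a\<in>Field r. \<forall>b. (a, b) \<in> r \<longrightarrow> P (x b)" using a by blast
  next
    assume "\<exists>a\<in>Field r. \<forall>b. (a, b) \<in> r \<longrightarrow> P (x b)"
    then obtain a where a: "a \<in> Field r" "\<And>b. (a, b) \<in> r \<Longrightarrow> P (x b)" by blast
    have "P (snd q)" if "((tl a, x a), q) \<in> t" for q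
    proof -
      have "snd q \<in> fst q" "fst q \<subseteq> tl a" using that by (auto simp: t_def I_def)
      then show ?thesis using a(2) by (auto simp: tl_def)
    qed
    then show "\<exists>p\<in>Field t. \<forall>q. (p, q) \<in> t \<longrightarrow> P (snd q)"
      unfolding F using memI[OF refl[OF a(1)]] by blast
  qed
  have "uo_conv G t snd 0"
    using uo unfolding uo_conv_def o_conv_def tail
    by (simp add: tail[of "\<lambda>v. vle G (vabs G (0 - vmeet G (vabs G (v - 0)) u)) w" for u w, simplified])
  moreover have "\<forall>p\<in>Field t. snd p \<in> vcarrier G"
    unfolding F using x rF by (auto simp: I_def tl_def)
  ultimately have "limitin \<tau> snd 0 (net_filter t)"
    using uoL t unfolding uo_Lebesgue_def by blast
  then show ?thesis
    unfolding limitin_def eventually_net_filter[OF t] eventually_net_filter[OF r]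
    using tail[of "\<lambda>v. v \<in> U" for U] by simp
qed

definition Hausdorff_uo_Lebesgue :: "'a::real_vector vlat \<Rightarrow> 'a topology \<Rightarrow> bool" where
  "Hausdorff_uo_Lebesgue G \<tau> \<longleftrightarrow> uo_Lebesgue G \<tau> \<and> Hausdorff_space \<tau>"

text \<open>A vector lattice admits at most one Hausdorff uo-Lebesgue topology, so the choice below is
  the unique one whenever there is one.\<close>

definition tau_hat :: "'a::real_vector vlat \<Rightarrow> 'a topology" where
  "tau_hat G = (SOME \<tau>. Hausdorff_uo_Lebesgue G \<tau>)"

definition tau_conv :: "'a::real_vector vlat \<Rightarrow> 'i rel \<Rightarrow> ('i \<Rightarrow> 'a) \<Rightarrow> 'a \<Rightarrow> bool" where
  "tau_conv G r x l \<longleftrightarrow> limitin (tau_hat G) x l (net_filter r)"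


section \<open>The six modes of convergence\<close>

datatype conv_mode = Mode_o | Mode_uo | Mode_tau | Mode_SO | Mode_SUO | Mode_Stau

primrec converges ::
  "conv_mode \<Rightarrow> 'a::real_vector vlat \<Rightarrow> 'i rel \<Rightarrow> ('i \<Rightarrow> 'a \<Rightarrow> 'a) \<Rightarrow> ('a \<Rightarrow> 'a) \<Rightarrow> bool" where
  "converges Mode_o E r T L \<longleftrightarrow> o_conv (L_ob E) r T L"
| "converges Mode_uo E r T L \<longleftrightarrow> uo_conv (L_ob E) r T L"
| "converges Mode_tau E r T L \<longleftrightarrow> tau_conv (L_ob E) r T L"
| "converges Mode_SO E r T L \<longleftrightarrow> (\<forall>x\<in>vcarrier E. o_conv E r (\<lambda>a. T a x) (L x))"
| "converges Mode_SUO E r T L \<longleftrightarrow> (\<forall>x\<in>vcarrier E. uo_conv E r (\<lambda>a. T a x) (L x))"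
| "converges Mode_Stau E r T L \<longleftrightarrow> (\<forall>x\<in>vcarrier E. tau_conv E r (\<lambda>a. T a x) (L x))"

text \<open>HOL cannot quantify over types, so the statement \<open>P(c\<^sub>1, c\<^sub>2)\<close> is relative to the ambient type
  \<open>'a\<close> of the vector lattices and the type \<open>'i\<close> of the indices of the nets.\<close>

definition implies_mode :: "'a::real_vector itself \<Rightarrow> 'i itself \<Rightarrow> conv_mode \<Rightarrow> conv_mode \<Rightarrow> bool" where
  "implies_mode _ _ c1 c2 \<longleftrightarrow>
     (\<forall>(E :: 'a vlat) (r :: 'i rel) T L.
        dedekind_complete E \<and>
        ({c1, c2} \<inter> {Mode_tau, Mode_Stau} \<noteq> {} \<longrightarrow> (\<exists>\<tau>. Hausdorff_uo_Lebesgue E \<tau>)) \<and>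
        directed r \<and> (\<forall>a\<in>Field r. T a \<in> vcarrier (L_ob E)) \<and> L \<in> vcarrier (L_ob E) \<and>
        converges c1 E r T L
        \<longrightarrow> converges c2 E r T L)"

definition valid_pairs :: "(conv_mode \<times> conv_mode) set" where
  "valid_pairs =
     {Mode_o} \<times> {Mode_o, Mode_uo, Mode_tau, Mode_SO, Mode_SUO, Mode_Stau} \<union>
     {Mode_uo} \<times> {Mode_uo, Mode_tau} \<union>
     {Mode_tau} \<times> {Mode_tau} \<union>
     {Mode_SO} \<times> {Mode_SO, Mode_SUO, Mode_Stau} \<union>
     {Mode_SUO} \<times> {Mode_SUO, Mode_Stau} \<union>
     {Mode_Stau} \<times> {Mode_Stau}"

end

theory Submission
  imports Defs
begin

text \<open>Write \<open>\<psi> \<otimes> f\<close> for the operator \<open>x \<mapsto> \<psi> x f\<close> of rank one.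

  The valid implications all reduce to three facts.  Order convergence implies uo-convergence in every
  vector lattice, and uo-convergence implies convergence in a uo-Lebesgue topology, by definition for
  limit \<open>0\<close> and by translation in general.  A downward directed set of operators with infimum \<open>0\<close> has
  infimum \<open>0\<close> pointwise on the positive cone (\<open>down_to_0_pointwise\<close>), since the pointwise infimum is
  additive by directedness and hence extends to an operator; so order convergence of operators implies
  order convergence at every point.  Finally, the topology on the operators exists: from \<open>\<tau>\<close> on \<open>E\<close> one
  obtains a Hausdorff uo-Lebesgue topology with the basic neighbourhoods
  \<open>{T. (\<bar>T\<bar> \<sqinter> S) x \<in> U}\<close> of \<open>0\<close> (\<open>Hausdorff_uo_Lebesgue_L\<close>).  Every argument below about
  topological convergence uses only the uo-Lebesgue property, solidity of neighbourhoods and the Hausdorff property.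

  All counterexamples live on one space, the bounded harmonic functions on the infinite binary tree:
  real functions \<open>m\<close> on the nodes \<open>k \<ge> 1\<close> with \<open>m k = (m (2 k) + m (2 k + 1)) / 2\<close>, ordered pointwise.  These are
  the bounded dyadic martingales, that is, a copy of \<open>L\<^sub>\<infinity>\<close> of the Cantor space, but suprema are elementary: a
  bounded function below its own mean has a least harmonic majorant (\<open>harmonic_hull\<close>), and
  infima of directed sets are pointwise (\<open>down_to_0_harmonicD\<close>).  Evaluation at the root is the integral.  Four
  sequences of operators, separating five pairs of modes at the limit \<open>0\<close>, suffice; here \<open>1\<close> is the constant function and \<open>f\<^sub>k\<close> is the indicator of the subtree at
  node \<open>k\<close>.

  \<^item> uo but not S\<open>\<tau>\<close>: \<open>\<phi>\<^sub>n \<otimes> 1\<close>, where \<open>\<phi>\<^sub>n\<close> evaluates at the node \<open>2\<^bsup>n+1\<^esup> + 1\<close>.  The subtrees are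
  disjoint, so the operators are disjoint, and disjoint sequences are uo-null; but all of them fix \<open>1\<close>.

  \<^item> SUO but not SO: \<open>\<psi> \<otimes> (n f\<^sub>k)\<close> with \<open>\<psi>\<close> the evaluation at the root and \<open>k = 2\<^bsup>n+1\<^esup> + 1\<close>; the values at \<open>1\<close> are disjoint and not
  order bounded.

  \<^item> \<open>\<tau>\<close> but not uo, and S\<open>\<tau>\<close> but not SUO: \<open>\<psi> \<otimes> f\<^sub>n\<close>, \<open>n \<ge> 1\<close>, the typewriter sequence.  Every subsequence
  has an order null subsequence, but the \<open>f\<^sub>k\<close> of each level sum to \<open>1\<close>.

  \<^item> SO but not \<open>\<tau>\<close>: \<open>r\<^sub>n \<otimes> 1\<close>, where \<open>r\<^sub>n\<close> integrates against the Rademacher function of level \<open>n\<close>.  Bessel's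
  inequality gives \<open>r\<^sub>n m \<longlonglongrightarrow> 0\<close>, but \<open>\<bar>r\<^sub>n \<otimes> 1\<bar>\<close> dominates \<open>\<psi> \<otimes> 1\<close> for all \<open>n\<close>.

  Composing these with the valid implications refutes every remaining pair.\<close>

section \<open>Vector lattices on a carrier\<close>

locale vlat =
  fixes G :: "'a::real_vector vlat"
  assumes VL: "vector_lattice G"
begin

abbreviation C :: "'a set" where "C \<equiv> vcarrier G"
abbreviation le (infix "\<preceq>" 50) where "x \<preceq> y \<equiv> vle G x y"
abbreviation join (infixl "\<squnion>" 65) where "x \<squnion> y \<equiv> vjoin G x y"
abbreviation meet (infixl "\<sqinter>" 70) where "x \<sqinter> y \<equiv> vmeet G x y"
abbreviation absl ("\<bar>_\<bar>\<^sub>G") where "\<bar>x\<bar>\<^sub>G \<equiv> vabs G x"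

lemma subspace_C: "subspace C"
  using VL by (simp add: vector_lattice_def)

lemma zero_in [simp, intro]: "0 \<in> C"
  and add_in [simp, intro]: "x \<in> C \<Longrightarrow> y \<in> C \<Longrightarrow> x + y \<in> C"
  and diff_in [simp, intro]: "x \<in> C \<Longrightarrow> y \<in> C \<Longrightarrow> x - y \<in> C"
  and neg_in [simp, intro]: "x \<in> C \<Longrightarrow> - x \<in> C"
  and scale_in [simp, intro]: "x \<in> C \<Longrightarrow> c *\<^sub>R x \<in> C"
  using subspace_C by (auto intro: subspace_0 subspace_add subspace_diff subspace_neg subspace_scale)

lemma le_refl [simp, intro]: "x \<in> C \<Longrightarrow> x \<preceq> x"
  and le_antisym: "x \<preceq> y \<Longrightarrow> y \<preceq> x \<Longrightarrow> x \<in> C \<Longrightarrow> y \<in> C \<Longrightarrow> x = y"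
  and le_trans: "x \<preceq> y \<Longrightarrow> y \<preceq> z \<Longrightarrow> x \<in> C \<Longrightarrow> y \<in> C \<Longrightarrow> z \<in> C \<Longrightarrow> x \<preceq> z"
  and add_right_mono: "x \<preceq> y \<Longrightarrow> x \<in> C \<Longrightarrow> y \<in> C \<Longrightarrow> z \<in> C \<Longrightarrow> x + z \<preceq> y + z"
  and scale_nonneg: "0 \<preceq> x \<Longrightarrow> x \<in> C \<Longrightarrow> 0 \<le> c \<Longrightarrow> 0 \<preceq> c *\<^sub>R x"
  and ex_join: "x \<in> C \<Longrightarrow> y \<in> C \<Longrightarrow> \<exists>s. is_lub G {x, y} s"
  and ex_meet: "x \<in> C \<Longrightarrow> y \<in> C \<Longrightarrow> \<exists>s. is_glb G {x, y} s"
  using VL unfolding vector_lattice_def by blast+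

lemma le_iff_diff: "x \<in> C \<Longrightarrow> y \<in> C \<Longrightarrow> x \<preceq> y \<longleftrightarrow> 0 \<preceq> y - x"
  using add_right_mono[of x y "- x"] add_right_mono[of 0 "y - x" x] by auto

lemma add_mono:
  assumes "a \<preceq> b" "c \<preceq> d" "a \<in> C" "b \<in> C" "c \<in> C" "d \<in> C"
  shows "a + c \<preceq> b + d"
  using add_right_mono[of a b c] add_right_mono[of c d b] le_trans[of "a + c" "b + c" "b + d"] assms
  by (simp add: add.commute)

lemma add_nonneg: "0 \<preceq> a \<Longrightarrow> 0 \<preceq> b \<Longrightarrow> a \<in> C \<Longrightarrow> b \<in> C \<Longrightarrow> 0 \<preceq> a + b"
  using add_mono[of 0 a 0 b] by simp

lemma scale_mono:
  assumes "a \<preceq> b" "a \<in> C" "b \<in> C" "0 \<le> c"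
  shows "c *\<^sub>R a \<preceq> c *\<^sub>R b"
  using scale_nonneg[of "b - a" c] assms by (simp add: le_iff_diff[of a] le_iff_diff[of "c *\<^sub>R a"] scaleR_diff_right)

lemma scale_left_mono:
  assumes "0 \<preceq> a" "a \<in> C" "c \<le> d"
  shows "c *\<^sub>R a \<preceq> d *\<^sub>R a"
  using scale_nonneg[of a "d - c"] assms by (simp add: le_iff_diff[of "c *\<^sub>R a"] scaleR_diff_left)

lemma neg_le: "a \<in> C \<Longrightarrow> b \<in> C \<Longrightarrow> - a \<preceq> b \<longleftrightarrow> - b \<preceq> a"
  by (simp add: le_iff_diff[of "- a"] le_iff_diff[of "- b"] add.commute)

lemma diff_le: "a \<in> C \<Longrightarrow> b \<in> C \<Longrightarrow> c \<in> C \<Longrightarrow> a - b \<preceq> c \<longleftrightarrow> a \<preceq> c + b"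
  by (simp add: le_iff_diff[of "a - b"] le_iff_diff[of a] algebra_simps)

lemma le_diff: "a \<in> C \<Longrightarrow> b \<in> C \<Longrightarrow> c \<in> C \<Longrightarrow> c \<preceq> a - b \<longleftrightarrow> c + b \<preceq> a"
  using le_iff_diff[of c "a - b"] le_iff_diff[of "c + b" a] by (simp add: diff_diff_eq add.commute)

lemma lub_unique: "is_lub G S s \<Longrightarrow> is_lub G S t \<Longrightarrow> s = t"
  by (meson is_lub_def le_antisym)

lemma glb_unique: "is_glb G S s \<Longrightarrow> is_glb G S t \<Longrightarrow> s = t"
  by (meson is_glb_def le_antisym)

lemma is_lub_join: "x \<in> C \<Longrightarrow> y \<in> C \<Longrightarrow> is_lub G {x, y} (x \<squnion> y)"
  unfolding vjoin_def by (rule theI') (use ex_join lub_unique in blast)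

lemma is_glb_meet: "x \<in> C \<Longrightarrow> y \<in> C \<Longrightarrow> is_glb G {x, y} (x \<sqinter> y)"
  unfolding vmeet_def by (rule theI') (use ex_meet glb_unique in blast)

lemma join_in [simp, intro]: "x \<in> C \<Longrightarrow> y \<in> C \<Longrightarrow> x \<squnion> y \<in> C"
  and join_ub1: "x \<in> C \<Longrightarrow> y \<in> C \<Longrightarrow> x \<preceq> x \<squnion> y"
  and join_ub2: "x \<in> C \<Longrightarrow> y \<in> C \<Longrightarrow> y \<preceq> x \<squnion> y"
  and join_least: "x \<preceq> z \<Longrightarrow> y \<preceq> z \<Longrightarrow> x \<in> C \<Longrightarrow> y \<in> C \<Longrightarrow> z \<in> C \<Longrightarrow> x \<squnion> y \<preceq> z"
  using is_lub_join by (auto simp: is_lub_def)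

lemma meet_in [simp, intro]: "x \<in> C \<Longrightarrow> y \<in> C \<Longrightarrow> x \<sqinter> y \<in> C"
  and meet_lb1: "x \<in> C \<Longrightarrow> y \<in> C \<Longrightarrow> x \<sqinter> y \<preceq> x"
  and meet_lb2: "x \<in> C \<Longrightarrow> y \<in> C \<Longrightarrow> x \<sqinter> y \<preceq> y"
  and meet_greatest: "z \<preceq> x \<Longrightarrow> z \<preceq> y \<Longrightarrow> x \<in> C \<Longrightarrow> y \<in> C \<Longrightarrow> z \<in> C \<Longrightarrow> z \<preceq> x \<sqinter> y"
  using is_glb_meet by (auto simp: is_glb_def)

lemma abs_in [simp, intro]: "x \<in> C \<Longrightarrow> \<bar>x\<bar>\<^sub>G \<in> C"
  and abs_ge: "x \<in> C \<Longrightarrow> x \<preceq> \<bar>x\<bar>\<^sub>G"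
  and abs_ge_minus: "x \<in> C \<Longrightarrow> - x \<preceq> \<bar>x\<bar>\<^sub>G"
  and abs_least: "x \<preceq> z \<Longrightarrow> - x \<preceq> z \<Longrightarrow> x \<in> C \<Longrightarrow> z \<in> C \<Longrightarrow> \<bar>x\<bar>\<^sub>G \<preceq> z"
  by (auto simp: vabs_def join_ub1 join_ub2 join_least)

lemma abs_nonneg [simp]: 
  assumes "x \<in> C" shows "0 \<preceq> \<bar>x\<bar>\<^sub>G"
  using scale_nonneg[of "\<bar>x\<bar>\<^sub>G + \<bar>x\<bar>\<^sub>G" "1/2"] 
    add_mono[OF abs_ge[OF assms] abs_ge_minus[OF assms]] assms
  by (simp flip: scaleR_add_right add: scaleR_half_double)

lemma abs_of_nonneg: "0 \<preceq> x \<Longrightarrow> x \<in> C \<Longrightarrow> \<bar>x\<bar>\<^sub>G = x"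
  using le_trans[of "- x" 0 x] neg_le[of 0 x] neg_le[of x 0]
  by (intro le_antisym abs_least abs_ge) auto

lemma abs_minus [simp]: "x \<in> C \<Longrightarrow> \<bar>- x\<bar>\<^sub>G = \<bar>x\<bar>\<^sub>G"
  using abs_ge_minus[of "- x"] abs_ge[of "- x"]
  by (intro le_antisym abs_least) (auto simp: abs_ge abs_ge_minus)

lemma abs_diff_commute: "x \<in> C \<Longrightarrow> y \<in> C \<Longrightarrow> \<bar>x - y\<bar>\<^sub>G = \<bar>y - x\<bar>\<^sub>G"
  using abs_minus[of "x - y"] by simp

lemma abs_triangle: "x \<in> C \<Longrightarrow> y \<in> C \<Longrightarrow> \<bar>x + y\<bar>\<^sub>G \<preceq> \<bar>x\<bar>\<^sub>G + \<bar>y\<bar>\<^sub>G"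
  using add_mono[OF abs_ge_minus[of x] abs_ge_minus[of y]]
  by (intro abs_least) (auto intro: add_mono abs_ge)

lemma abs_scale_le:
  assumes "x \<in> C" shows "\<bar>c *\<^sub>R x\<bar>\<^sub>G \<preceq> \<bar>c\<bar> *\<^sub>R \<bar>x\<bar>\<^sub>G"
proof (cases "c \<ge> 0")
  case True
  then show ?thesis
    using scale_mono[OF abs_ge[OF assms], of c] scale_mono[OF abs_ge_minus[OF assms], of c] assms
    by (intro abs_least) auto
next
  case False
  then show ?thesis
    using scale_mono[OF abs_ge[OF assms], of "- c"] scale_mono[OF abs_ge_minus[OF assms], of "- c"] assms
    by (intro abs_least) auto
qed

lemma abs_eq_0: 
  assumes "\<bar>x\<bar>\<^sub>G = 0" "x \<in> C" shows "x = 0"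
  using abs_ge[of x] abs_ge_minus[of x] neg_le[of x 0] assms by (intro le_antisym) auto

text \<open>The positive and negative parts in the form \<open>(\<bar>x\<bar> \<plusminus> x) / 2\<close>: the identities \<open>x = p - q\<close> and
  \<open>\<bar>x\<bar> = p + q\<close> are then pure algebra.\<close>

lemma half_parts:
  assumes "x \<in> C"
  shows "0 \<preceq> (1/2) *\<^sub>R (\<bar>x\<bar>\<^sub>G + x)" "0 \<preceq> (1/2) *\<^sub>R (\<bar>x\<bar>\<^sub>G - x)"
    "x = (1/2) *\<^sub>R (\<bar>x\<bar>\<^sub>G + x) - (1/2) *\<^sub>R (\<bar>x\<bar>\<^sub>G - x)"
    "\<bar>x\<bar>\<^sub>G = (1/2) *\<^sub>R (\<bar>x\<bar>\<^sub>G + x) + (1/2) *\<^sub>R (\<bar>x\<bar>\<^sub>G - x)"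
proof -
  show "0 \<preceq> (1/2) *\<^sub>R (\<bar>x\<bar>\<^sub>G + x)"
    using abs_ge_minus[OF assms] assms by (intro scale_nonneg) (auto simp: le_iff_diff[of "- x"])
  show "0 \<preceq> (1/2) *\<^sub>R (\<bar>x\<bar>\<^sub>G - x)"
    using abs_ge[OF assms] assms by (intro scale_nonneg) (auto simp: le_iff_diff[of "x"])
  have half: "(1/2) *\<^sub>R (y + y) = y" for y :: 'a by (rule scaleR_half_double)
  have "(1/2) *\<^sub>R (\<bar>x\<bar>\<^sub>G + x) - (1/2) *\<^sub>R (\<bar>x\<bar>\<^sub>G - x) = (1/2) *\<^sub>R ((\<bar>x\<bar>\<^sub>G + x) - (\<bar>x\<bar>\<^sub>G - x))"
    by (rule scaleR_diff_right[symmetric])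
  also have "(\<bar>x\<bar>\<^sub>G + x) - (\<bar>x\<bar>\<^sub>G - x) = x + x" by (simp add: algebra_simps)
  finally show "x = (1/2) *\<^sub>R (\<bar>x\<bar>\<^sub>G + x) - (1/2) *\<^sub>R (\<bar>x\<bar>\<^sub>G - x)" unfolding half by (rule sym)
  have "(1/2) *\<^sub>R (\<bar>x\<bar>\<^sub>G + x) + (1/2) *\<^sub>R (\<bar>x\<bar>\<^sub>G - x) = (1/2) *\<^sub>R ((\<bar>x\<bar>\<^sub>G + x) + (\<bar>x\<bar>\<^sub>G - x))"
    by (rule scaleR_add_right[symmetric])
  also have "(\<bar>x\<bar>\<^sub>G + x) + (\<bar>x\<bar>\<^sub>G - x) = \<bar>x\<bar>\<^sub>G + \<bar>x\<bar>\<^sub>G" by (simp add: algebra_simps)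
  finally show "\<bar>x\<bar>\<^sub>G = (1/2) *\<^sub>R (\<bar>x\<bar>\<^sub>G + x) + (1/2) *\<^sub>R (\<bar>x\<bar>\<^sub>G - x)" unfolding half by (rule sym)
qed

lemma meet_nonneg: "0 \<preceq> x \<Longrightarrow> 0 \<preceq> y \<Longrightarrow> x \<in> C \<Longrightarrow> y \<in> C \<Longrightarrow> 0 \<preceq> x \<sqinter> y"
  by (rule meet_greatest) auto

lemma meet_mono:
  assumes "x \<preceq> x'" "y \<preceq> y'" "x \<in> C" "y \<in> C" "x' \<in> C" "y' \<in> C"
  shows "x \<sqinter> y \<preceq> x' \<sqinter> y'"
  using le_trans[OF meet_lb1[of x y] assms(1)] le_trans[OF meet_lb2[of x y] assms(2)] assms
  by (intro meet_greatest) auto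

lemma meet_absorb: "x \<preceq> y \<Longrightarrow> x \<in> C \<Longrightarrow> y \<in> C \<Longrightarrow> x \<sqinter> y = x"
  by (intro le_antisym meet_lb1 meet_greatest) auto

text \<open>Subadditivity of truncation: it makes the sets \<open>{x. \<bar>x\<bar> \<sqinter> u \<in> W}\<close> compatible with addition.\<close>

lemma meet_add_le:
  assumes "0 \<preceq> a" "0 \<preceq> b" "0 \<preceq> u" "a \<in> C" "b \<in> C" "u \<in> C"
  shows "(a + b) \<sqinter> u \<preceq> a \<sqinter> u + b \<sqinter> u"
proof -
  let ?d = "(a + b) \<sqinter> u"
  have d: "?d \<preceq> a + b" "?d \<preceq> u" using assms by (auto intro: meet_lb1 meet_lb2)
  have n: "0 \<preceq> a \<sqinter> u" using assms by (simp add: meet_nonneg)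
  have sub: "?d - b \<preceq> u"
    using le_trans[OF d(2), of "u + b"] add_mono[of u u 0 b] assms by (simp add: diff_le)
  have "?d - b \<preceq> a \<sqinter> u" using d sub assms by (intro meet_greatest) (auto simp: diff_le)
  then have "?d - a \<sqinter> u \<preceq> b" using assms by (simp add: diff_le add.commute)
  moreover have "?d - a \<sqinter> u \<preceq> u"
    using le_trans[OF d(2), of "u + a \<sqinter> u"] add_mono[of u u 0 "a \<sqinter> u"] n assms
    by (simp add: diff_le)
  ultimately have "?d - a \<sqinter> u \<preceq> b \<sqinter> u" using assms by (intro meet_greatest) auto
  then show ?thesis using assms by (simp add: diff_le add.commute)
qed

text \<open>For disjoint elements the sum is the supremum, because \<open>a + b - y\<close> lies below both \<open>a\<close> and \<open>b\<close>.\<close>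

lemma add_le_of_disjoint:
  assumes "a \<preceq> y" "b \<preceq> y" "\<And>R. R \<in> C \<Longrightarrow> R \<preceq> a \<Longrightarrow> R \<preceq> b \<Longrightarrow> R \<preceq> 0"
    and "a \<in> C" "b \<in> C" "y \<in> C"
  shows "a + b \<preceq> y"
proof -
  have "a + b - y \<preceq> 0" using assms(1,2,4-)
      add_right_mono[of b y a] add_right_mono[of a y b]
    by (intro assms(3)) (auto simp: diff_le add.commute)
  then show ?thesis using assms by (simp add: diff_le)
qed

lemma riesz_decomposition:
  assumes "0 \<preceq> y" "y \<preceq> a + b" "0 \<preceq> a" "0 \<preceq> b" "y \<in> C" "a \<in> C" "b \<in> C"
  obtains y1 y2 where "y = y1 + y2" "y1 \<in> C" "y2 \<in> C"
    "0 \<preceq> y1" "y1 \<preceq> a" "0 \<preceq> y2" "y2 \<preceq> b"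
proof
  show "y = y \<sqinter> a + (y - y \<sqinter> a)" by simp
  show "y \<sqinter> a \<in> C" "y - y \<sqinter> a \<in> C" using assms by auto
  show "0 \<preceq> y \<sqinter> a" "y \<sqinter> a \<preceq> a" using assms by (auto intro: meet_nonneg meet_lb2)
  show "0 \<preceq> y - y \<sqinter> a" using assms meet_lb1[of y a] by (simp flip: le_iff_diff)
  have "y - b \<preceq> y \<sqinter> a" 
    using assms add_mono[of y y 0 b] by (intro meet_greatest) (auto simp: diff_le)
  then show "y - y \<sqinter> a \<preceq> b" using assms by (simp add: diff_le add.commute)
qed

end

section \<open>Order convergence through downward directed sets\<close>

text \<open>The values of a net \<open>y\<^sub>\<beta> \<down> 0\<close> form such a set, and such a set is a net indexed by itself in
  the reversed order.  Working with sets removes the index relation from all arguments about \<open>\<down> 0\<close>.\<close>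

definition down_to_0 :: "'a::real_vector vlat \<Rightarrow> 'a set \<Rightarrow> bool" where
  "down_to_0 G Y \<longleftrightarrow> Y \<subseteq> vcarrier G \<and> Y \<noteq> {} \<and>
     (\<forall>y\<in>Y. \<forall>z\<in>Y. \<exists>w\<in>Y. vle G w y \<and> vle G w z) \<and> is_glb G Y 0"

context vlat begin

lemma down_to_0_nonneg: "down_to_0 G Y \<Longrightarrow> y \<in> Y \<Longrightarrow> 0 \<preceq> y \<and> y \<in> C"
  by (auto simp: down_to_0_def is_glb_def)

lemma o_conv_iff:
  "o_conv G r x l \<longleftrightarrow> (\<exists>Y. down_to_0 G Y \<and>
     (\<forall>y\<in>Y. \<exists>a\<in>Field r. \<forall>a'. (a, a') \<in> r \<longrightarrow> \<bar>l - x a'\<bar>\<^sub>G \<preceq> y))"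
proof
  assume "o_conv G r x l"
  then obtain s :: "'a rel" and y where y: "decreases_to_0 G s y"
    and ev: "\<forall>b\<in>Field s. \<exists>a\<in>Field r. \<forall>a'. (a, a') \<in> r \<longrightarrow> \<bar>l - x a'\<bar>\<^sub>G \<preceq> y b"
    unfolding o_conv_def by (elim exE conjE) (rule that)
  have in_C: "\<forall>b\<in>Field s. y b \<in> C" and mono: "\<And>b c. (b, c) \<in> s \<Longrightarrow> y c \<preceq> y b"
    and glb: "is_glb G (y ` Field s) 0" and ne: "Field s \<noteq> {}"
    and dir: "\<forall>b\<in>Field s. \<forall>c\<in>Field s. \<exists>d\<in>Field s. (b, d) \<in> s \<and> (c, d) \<in> s"
    using y by (simp_all add: decreases_to_0_def directed_def)
  have "\<exists>w\<in>y ` Field s. w \<preceq> y b \<and> w \<preceq> y c" if bc: "b \<in> Field s" "c \<in> Field s" for b c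
  proof -
    obtain d where "d \<in> Field s" "(b, d) \<in> s" "(c, d) \<in> s"
      using dir bc by meson
    then show ?thesis using mono by (intro bexI[of _ "y d"]) auto
  qed
  then have "down_to_0 G (y ` Field s)"
    using in_C ne glb by (auto simp: down_to_0_def)
  then show "\<exists>Y. down_to_0 G Y \<and>
     (\<forall>y\<in>Y. \<exists>a\<in>Field r. \<forall>a'. (a, a') \<in> r \<longrightarrow> \<bar>l - x a'\<bar>\<^sub>G \<preceq> y)" using ev by blast
next
  assume "\<exists>Y. down_to_0 G Y \<and>
     (\<forall>y\<in>Y. \<exists>a\<in>Field r. \<forall>a'. (a, a') \<in> r \<longrightarrow> \<bar>l - x a'\<bar>\<^sub>G \<preceq> y)"
  then obtain Y where Y: "down_to_0 G Y"
    and ev: "\<And>y. y \<in> Y \<Longrightarrow> \<exists>a\<in>Field r. \<forall>a'. (a, a') \<in> r \<longrightarrow> \<bar>l - x a'\<bar>\<^sub>G \<preceq> y" by blast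
  define t where "t = {(u, v). u \<in> Y \<and> v \<in> Y \<and> v \<preceq> u}"
  have YC: "Y \<subseteq> C" using Y by (simp add: down_to_0_def)
  have F: "Field t = Y"
    using YC unfolding Field_def t_def by auto
  have "preorder_on Y t"
    using YC unfolding preorder_on_def refl_on_def trans_def t_def by (auto intro: le_trans)
  then have "directed t"
    using Y unfolding directed_def F by (fastforce simp: down_to_0_def t_def)
  then have "decreases_to_0 G t (\<lambda>u. u)"
    using Y F by (auto simp: decreases_to_0_def down_to_0_def t_def)
  then show "o_conv G r x l"
    unfolding o_conv_def using ev F by (intro exI[of _ t] exI[of _ "\<lambda>u. u"]) auto
qed

lemma o_convI_set:
  assumes "down_to_0 G Y"
    "\<And>y. y \<in> Y \<Longrightarrow> \<exists>a\<in>Field r. \<forall>a'. (a, a') \<in> r \<longrightarrow> \<bar>l - x a'\<bar>\<^sub>G \<preceq> y"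
  shows "o_conv G r x l"
  using assms unfolding o_conv_iff by blast

lemma o_convE_set:
  assumes "o_conv G r x l"
  obtains Y where "down_to_0 G Y"
    "\<forall>y\<in>Y. \<exists>a\<in>Field r. \<forall>a'. (a, a') \<in> r \<longrightarrow> \<bar>l - x a'\<bar>\<^sub>G \<preceq> y"
  using assms unfolding o_conv_iff by blast

lemma o_conv_dominated:
  assumes "o_conv G r x l" "l \<in> C" "l' \<in> C"
    and "\<And>a. a \<in> Field r \<Longrightarrow> x a \<in> C \<and> x' a \<in> C \<and> \<bar>l' - x' a\<bar>\<^sub>G \<preceq> \<bar>l - x a\<bar>\<^sub>G"
  shows "o_conv G r x' l'"
proof -
  obtain Y where Y: "down_to_0 G Y"
    "\<forall>y\<in>Y. \<exists>a\<in>Field r. \<forall>a'. (a, a') \<in> r \<longrightarrow> \<bar>l - x a'\<bar>\<^sub>G \<preceq> y"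
    using assms(1) by (rule o_convE_set)
  show ?thesis
  proof (rule o_convI_set[OF Y(1)])
    fix y assume y: "y \<in> Y"
    then obtain a where a: "a \<in> Field r" "\<And>a'. (a, a') \<in> r \<Longrightarrow> \<bar>l - x a'\<bar>\<^sub>G \<preceq> y" using Y(2) by blast
    have "\<bar>l' - x' a'\<bar>\<^sub>G \<preceq> y" if "(a, a') \<in> r" for a'
      using that a(2)[OF that] assms(2,3) assms(4)[of a'] down_to_0_nonneg[OF Y(1) y] FieldI2[OF that]
      by - (rule le_trans[of _ "\<bar>l - x a'\<bar>\<^sub>G" y], auto)
    then show "\<exists>a\<in>Field r. \<forall>a'. (a, a') \<in> r \<longrightarrow> \<bar>l' - x' a'\<bar>\<^sub>G \<preceq> y" using a(1) by blast
  qed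
qed

lemma o_conv_imp_uo_conv:
  assumes "o_conv G r x l" "l \<in> C" "\<And>a. a \<in> Field r \<Longrightarrow> x a \<in> C"
  shows "uo_conv G r x l"
  unfolding uo_conv_def
proof (intro ballI impI)
  fix u assume u: "u \<in> C" "0 \<preceq> u"
  show "o_conv G r (\<lambda>a. \<bar>x a - l\<bar>\<^sub>G \<sqinter> u) 0"
  proof (rule o_conv_dominated[OF assms(1,2) zero_in])
    fix a assume a: "a \<in> Field r"
    have "\<bar>\<bar>x a - l\<bar>\<^sub>G \<sqinter> u\<bar>\<^sub>G = \<bar>x a - l\<bar>\<^sub>G \<sqinter> u"
      using a assms u by (intro abs_of_nonneg) (auto intro: meet_nonneg)
    then show "x a \<in> C \<and> \<bar>x a - l\<bar>\<^sub>G \<sqinter> u \<in> C \<and> \<bar>0 - \<bar>x a - l\<bar>\<^sub>G \<sqinter> u\<bar>\<^sub>G \<preceq> \<bar>l - x a\<bar>\<^sub>G"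
      using a assms u abs_diff_commute[of l "x a"] by (auto intro: meet_lb1)
  qed
qed

text \<open>On an order bounded net, truncation by the bound changes nothing.  This is how failure of
  order convergence is turned into failure of uo-convergence below.\<close>

lemma uo_conv_bounded_imp_o_conv:
  assumes "uo_conv G r x 0" "u \<in> C" "\<And>a. a \<in> Field r \<Longrightarrow> x a \<in> C \<and> 0 \<preceq> x a \<and> x a \<preceq> u"
    and "r \<noteq> {}"
  shows "o_conv G r x 0"
proof -
  obtain a where "a \<in> Field r" using assms(4) by (auto simp: Field_def)
  then have "0 \<preceq> u" using assms(2) assms(3)[of a] le_trans[of 0 "x a" u] by auto
  then have "o_conv G r (\<lambda>a. \<bar>x a - 0\<bar>\<^sub>G \<sqinter> u) 0" using assms(1,2) unfolding uo_conv_def by blast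
  then show ?thesis
    by (rule o_conv_dominated) (use assms(2,3) in \<open>auto simp: abs_of_nonneg meet_absorb\<close>)
qed

text \<open>The dominating set consists of the eventual upper bounds \<open>y\<close> of the truncated sequence \<open>s\<close>.
  If \<open>w\<close> lies below all these bounds and is disjoint from eventually all \<open>s k\<close>, then \<open>s k + w \<le> y\<close>, so \<open>y - w\<close> is again an eventual upper bound.  By
  iteration \<open>n w \<le> u\<close> for all \<open>n\<close>, whence \<open>w \<le> 0\<close>.\<close>

lemma disjoint_seq_uo_null:
  assumes arch: "archimedean G"
    and t: "\<And>n. t n \<in> C" "\<And>n. 0 \<preceq> t n"
    and disj: "\<And>n m R. n \<noteq> m \<Longrightarrow> R \<in> C \<Longrightarrow> R \<preceq> t n \<Longrightarrow> R \<preceq> t m \<Longrightarrow> R \<preceq> 0"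
  shows "uo_conv G {(a, b::nat). a \<le> b} t 0"
  unfolding uo_conv_def
proof (intro ballI impI)
  fix u assume u: "u \<in> C" "0 \<preceq> u"
  define s where "s n = \<bar>t n - 0\<bar>\<^sub>G \<sqinter> u" for n
  have s_eq: "s n = t n \<sqinter> u" for n using t by (simp add: s_def abs_of_nonneg)
  have s: "s n \<in> C" "0 \<preceq> s n" "s n \<preceq> t n" "s n \<preceq> u" for n
    using t u by (auto simp: s_eq meet_lb1 meet_lb2 meet_nonneg)
  define Y where "Y = {y \<in> C. \<exists>m. \<forall>k\<ge>m. s k \<preceq> y}"
  have uY: "u \<in> Y" using u s by (auto simp: Y_def)
  have dir: "\<exists>w\<in>Y. w \<preceq> y \<and> w \<preceq> z" if yz: "y \<in> Y" "z \<in> Y" for y z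
  proof -
    obtain m n where mn: "\<And>k. k \<ge> m \<Longrightarrow> s k \<preceq> y" "\<And>k. k \<ge> n \<Longrightarrow> s k \<preceq> z" "y \<in> C" "z \<in> C"
      using yz by (auto simp: Y_def)
    then have "y \<sqinter> z \<in> Y"
      using s by (auto simp: Y_def intro!: exI[of _ "max m n"] meet_greatest)
    then show ?thesis using mn by (auto intro: meet_lb1 meet_lb2)
  qed
  have shrink: "w \<preceq> 0"
    if R: "R \<in> C" "\<And>y. y \<in> Y \<Longrightarrow> R \<preceq> y" and w: "w \<in> C" "w \<preceq> R"
      and wd: "\<And>k Q. k \<ge> m \<Longrightarrow> Q \<in> C \<Longrightarrow> Q \<preceq> w \<Longrightarrow> Q \<preceq> s k \<Longrightarrow> Q \<preceq> 0" for R w m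
  proof -
    have step: "y - w \<in> Y" if y: "y \<in> Y" for y
    proof -
      obtain n where n: "\<And>k. k \<ge> n \<Longrightarrow> s k \<preceq> y" and yC: "y \<in> C" using y by (auto simp: Y_def)
      have "w \<preceq> y" using le_trans[OF w(2) R(2)[OF y]] w R yC by blast
      then have "s k + w \<preceq> y" if "k \<ge> max n m" for k
        using that n[of k] wd[of k] s[of k] w yC by (intro add_le_of_disjoint) auto
      then show ?thesis using s w yC by (auto simp: Y_def le_diff intro!: exI[of _ "max n m"])
    qed
    have "u - real n *\<^sub>R w \<in> Y" for n
    proof (induction n)
      case (Suc n)
      then show ?case using step[OF Suc] by (simp add: algebra_simps)
    qed (simp add: uY)
    then have "0 \<preceq> u - real n *\<^sub>R w" for n
      using s(1,2) by (fastforce simp: Y_def intro: le_trans)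
    then have "real n *\<^sub>R w \<preceq> u" for n using w u by (simp flip: le_iff_diff)
    then show ?thesis using arch w u unfolding archimedean_def by blast
  qed
  have "is_glb G Y 0"
    unfolding is_glb_def
  proof (intro conjI ballI impI)
    show "0 \<preceq> y" if "y \<in> Y" for y
      using that s(1,2) by (fastforce simp: Y_def intro: le_trans)
    fix R0 assume R0: "R0 \<in> C" "\<forall>y\<in>Y. R0 \<preceq> y"
    define R where "R = R0 \<squnion> 0"
    have RC: "R \<in> C" "0 \<preceq> R" using R0 by (auto simp: R_def join_ub2)
    have RY: "R \<preceq> y" if "y \<in> Y" for y
      using that R0 s(1,2) unfolding R_def 
      by (intro join_least) (fastforce simp: Y_def intro: le_trans)+
    \<comment> \<open>anything below \<open>R\<close> and \<open>s j\<close> is disjoint from the later \<open>s k\<close>; thus \<open>R\<close> is disjoint from every \<open>s j\<close>\<close>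
    have "Q \<preceq> 0" if Q: "Q \<in> C" "Q \<preceq> R" "Q \<preceq> s j" for j Q
    proof (rule shrink[OF RC(1) RY Q(1,2)])
      fix k Q' assume k: "k \<ge> Suc j" and Q': "Q' \<in> C" "Q' \<preceq> Q" "Q' \<preceq> s k"
      show "Q' \<preceq> 0"
      proof (rule disj[of j k])
        have "Q' \<preceq> s j" using le_trans[OF Q'(2) Q(3)] Q Q' s by blast
        then show "Q' \<preceq> t j" using le_trans[OF _ s(3)[of j]] Q' s t by blast
        show "Q' \<preceq> t k" using le_trans[OF Q'(3) s(3)] Q' s t by blast
      qed (use k Q' in auto)
    qed
    then have "R \<preceq> 0" using shrink[OF RC(1) RY RC(1), of 0] RC by blast
    then show "R0 \<preceq> 0"
      using le_trans[OF join_ub1[of R0 0, folded R_def]] R0 RC by blast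
  qed auto
  then have "down_to_0 G Y" using uY dir by (auto simp: down_to_0_def Y_def)
  then have "o_conv G {(a, b::nat). a \<le> b} s 0"
  proof (rule o_convI_set)
    fix y assume "y \<in> Y"
    then obtain n where "\<And>k. k \<ge> n \<Longrightarrow> s k \<preceq> y" by (auto simp: Y_def)
    then show "\<exists>a\<in>Field {(a, b::nat). a \<le> b}. \<forall>a'. (a, a') \<in> {(a, b). a \<le> b} \<longrightarrow> \<bar>0 - s a'\<bar>\<^sub>G \<preceq> y"
      using s by (intro bexI[of _ n]) (auto simp: abs_of_nonneg Field_def)
  qed
  then show "o_conv G {(a, b::nat). a \<le> b} (\<lambda>n. \<bar>t n - 0\<bar>\<^sub>G \<sqinter> u) 0" by (simp add: s_def[abs_def])
qed

end

section \<open>Locally solid topologies from solid neighbourhood bases\<close>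

text \<open>The axioms of a neighbourhood base at \<open>0\<close> for a locally solid linear topology.  Solid sets are
  balanced, which is why \<open>base_absorb\<close> asks for a single multiple only.\<close>

locale solid_base = vlat +
  fixes \<B> :: "'a set set"
  assumes base_ne: "\<B> \<noteq> {}"
    and base_solid: "B \<in> \<B> \<Longrightarrow> solid G B"
    and base_0: "B \<in> \<B> \<Longrightarrow> 0 \<in> B"
    and base_Int: "A \<in> \<B> \<Longrightarrow> B \<in> \<B> \<Longrightarrow> \<exists>D\<in>\<B>. D \<subseteq> A \<inter> B"
    and base_add: "B \<in> \<B> \<Longrightarrow> \<exists>D\<in>\<B>. \<forall>x\<in>D. \<forall>y\<in>D. x + y \<in> B"
    and base_absorb: "B \<in> \<B> \<Longrightarrow> x \<in> C \<Longrightarrow> \<exists>e>0. e *\<^sub>R x \<in> B"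
begin

definition base_topology :: "'a topology" where
  "base_topology = topology (\<lambda>U. U \<subseteq> C \<and> (\<forall>x\<in>U. \<exists>B\<in>\<B>. \<forall>b\<in>B. x + b \<in> U))"

text \<open>Base sets need not be open; this is their interior, and its translates provide the open
  neighbourhoods.\<close>

definition base_interior :: "'a set \<Rightarrow> 'a set" where
  "base_interior B = {x \<in> C. \<exists>D\<in>\<B>. \<forall>d\<in>D. x + d \<in> B}"

lemma base_subset: "B \<in> \<B> \<Longrightarrow> B \<subseteq> C"
  using base_solid by (auto simp: solid_def)

lemma base_scale:
  assumes B: "B \<in> \<B>" and x: "x \<in> B" and c: "\<bar>c\<bar> \<le> 1"
  shows "c *\<^sub>R x \<in> B"
proof -
  have xC: "x \<in> C" using base_subset B x by blast
  have "\<bar>c\<bar> *\<^sub>R \<bar>x\<bar>\<^sub>G \<preceq> 1 *\<^sub>R \<bar>x\<bar>\<^sub>G" using xC c by (intro scale_left_mono) auto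
  then have "\<bar>c *\<^sub>R x\<bar>\<^sub>G \<preceq> \<bar>x\<bar>\<^sub>G"
    using le_trans[OF abs_scale_le[OF xC, of c]] xC by simp
  then show ?thesis using base_solid[OF B] x xC by (auto simp: solid_def)
qed

lemma base_neg: "B \<in> \<B> \<Longrightarrow> x \<in> B \<Longrightarrow> - x \<in> B"
  using base_scale[of B x "- 1"] by simp

lemma openin_base: "openin base_topology U \<longleftrightarrow> U \<subseteq> C \<and> (\<forall>x\<in>U. \<exists>B\<in>\<B>. \<forall>b\<in>B. x + b \<in> U)"
proof -
  have "istopology (\<lambda>U. U \<subseteq> C \<and> (\<forall>x\<in>U. \<exists>B\<in>\<B>. \<forall>b\<in>B. x + b \<in> U))" (is "istopology ?P")
    unfolding istopology_def
  proof (intro conjI allI impI)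
    fix S T assume S: "?P S" and T: "?P T"
    have "\<exists>B\<in>\<B>. \<forall>b\<in>B. x + b \<in> S \<inter> T" if x: "x \<in> S \<inter> T" for x
    proof -
      obtain A where A: "A \<in> \<B>" "\<forall>b\<in>A. x + b \<in> S"
        using conjunct2[OF S, THEN bspec, of x] x by auto
      obtain B where B: "B \<in> \<B>" "\<forall>b\<in>B. x + b \<in> T"
        using conjunct2[OF T, THEN bspec, of x] x by auto
      obtain D where "D \<in> \<B>" "D \<subseteq> A \<inter> B" using base_Int A B by blast
      then show ?thesis using A B by (intro bexI[of _ D]) auto
    qed
    then show "\<forall>x\<in>S \<inter> T. \<exists>B\<in>\<B>. \<forall>b\<in>B. x + b \<in> S \<inter> T" by blast
    show "S \<inter> T \<subseteq> C" using S by blast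
  next
    fix K assume K: "\<forall>S\<in>K. ?P S"
    show "\<Union> K \<subseteq> C" using K by blast
    show "\<forall>x\<in>\<Union> K. \<exists>B\<in>\<B>. \<forall>b\<in>B. x + b \<in> \<Union> K"
    proof
      fix x assume "x \<in> \<Union> K"
      then obtain S where "S \<in> K" "x \<in> S" by blast
      then obtain B where "B \<in> \<B>" "\<forall>b\<in>B. x + b \<in> S"
        using conjunct2[OF K[THEN bspec, of S], THEN bspec, of x] by auto
      then show "\<exists>B\<in>\<B>. \<forall>b\<in>B. x + b \<in> \<Union> K" using \<open>S \<in> K\<close> by (intro bexI[of _ B]) auto
    qed
  qed
  then show ?thesis by (simp add: base_topology_def)
qed

lemma topspace_base [simp]: "topspace base_topology = C"
proof
  show "topspace base_topology \<subseteq> C" by (metis openin_base openin_topspace)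
  have "openin base_topology C" using base_ne base_subset by (fastforce simp: openin_base)
  then show "C \<subseteq> topspace base_topology" by (rule openin_subset)
qed

lemma base_interior:
  assumes B: "B \<in> \<B>" and x: "x \<in> C"
  shows "openin base_topology {z \<in> C. z - x \<in> base_interior B}"
    and "x \<in> {z \<in> C. z - x \<in> base_interior B}"
    and "z - x \<in> base_interior B \<Longrightarrow> z - x \<in> B"
proof -
  show "openin base_topology {z \<in> C. z - x \<in> base_interior B}"
    unfolding openin_base
  proof (intro conjI ballI)
    fix z assume "z \<in> {z \<in> C. z - x \<in> base_interior B}"
    then obtain D where zC: "z \<in> C" and D: "D \<in> \<B>" "\<forall>d\<in>D. z - x + d \<in> B" by (auto simp: base_interior_def)
    obtain F where F: "F \<in> \<B>" "\<forall>a\<in>F. \<forall>b\<in>F. a + b \<in> D" using base_add[OF D(1)] by blast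
    have "z + f \<in> {z \<in> C. z - x \<in> base_interior B}" if f: "f \<in> F" for f
    proof -
      have fC: "f \<in> C" using base_subset F f by blast
      have "z + f - x + d \<in> B" if "d \<in> F" for d
      proof -
        have "z - x + (f + d) \<in> B" using D F f that by blast
        then show ?thesis by (simp add: algebra_simps)
      qed
      then show ?thesis using F zC x fC by (auto simp: base_interior_def)
    qed
    then show "\<exists>B'\<in>\<B>. \<forall>b\<in>B'. z + b \<in> {z \<in> C. z - x \<in> base_interior B}" using F by blast
  qed auto
  show "x \<in> {z \<in> C. z - x \<in> base_interior B}" using B x by (auto simp: base_interior_def)
  show "z - x \<in> B" if "z - x \<in> base_interior B"
    using that base_0 by (fastforce simp: base_interior_def)
qed

lemma base_scale_bounded:
  assumes B: "B \<in> \<B>"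
  shows "\<exists>D\<in>\<B>. \<forall>z\<in>D. \<forall>c. \<bar>c\<bar> \<le> 2 ^ n \<longrightarrow> c *\<^sub>R z \<in> B"
proof (induction n)
  case 0
  then show ?case using B base_scale[OF B] by (intro bexI[of _ B]) auto
next
  case (Suc n)
  then obtain D where D: "D \<in> \<B>" "\<And>z c. z \<in> D \<Longrightarrow> \<bar>c\<bar> \<le> 2 ^ n \<Longrightarrow> c *\<^sub>R z \<in> B" by blast
  obtain F where F: "F \<in> \<B>" "\<forall>a\<in>F. \<forall>b\<in>F. a + b \<in> D" using base_add[OF D(1)] by blast
  have "c *\<^sub>R z \<in> B" if z: "z \<in> F" and c: "\<bar>c\<bar> \<le> 2 ^ Suc n" for z c
  proof -
    have "(c / 2) *\<^sub>R (z + z) \<in> B" using D F z c by (intro D(2)) (auto simp: abs_if split: if_splits)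
    moreover have "(c / 2) *\<^sub>R (z + z) = c *\<^sub>R z"
      by (simp add: scaleR_add_right flip: scaleR_left_distrib)
    ultimately show ?thesis by simp
  qed
  then show ?case using F by blast
qed

lemma base_absorb_small:
  assumes B: "B \<in> \<B>" and x: "x \<in> C"
  shows "\<exists>e>0. \<forall>c. \<bar>c\<bar> \<le> e \<longrightarrow> c *\<^sub>R x \<in> B"
proof -
  obtain e where e: "e > 0" "e *\<^sub>R x \<in> B" using base_absorb[OF B x] by blast
  have "c *\<^sub>R x \<in> B" if "\<bar>c\<bar> \<le> e" for c
    using base_scale[OF B e(2), of "c / e"] that e(1) by (simp add: field_simps)
  then show ?thesis using e by blast
qed

lemma linear_base: "linear_topology G base_topology"
  unfolding linear_topology_def
proof (intro conjI)
  show "continuous_map (prod_topology base_topology base_topology) base_topology (\<lambda>(x, y). x + y)"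
    unfolding continuous_map_def openin_prod_topology_alt
  proof (intro conjI allI impI)
    fix U x y assume U: "openin base_topology U"
      and xy: "(x, y) \<in> {p \<in> topspace (prod_topology base_topology base_topology). (case p of (x, y) \<Rightarrow> x + y) \<in> U}" (is "_ \<in> ?Q")
    then have C: "x \<in> C" "y \<in> C" "x + y \<in> U" by auto
    then obtain B where B: "B \<in> \<B>" "\<forall>b\<in>B. x + y + b \<in> U" using U by (auto simp: openin_base)
    obtain D where D: "D \<in> \<B>" "\<forall>a\<in>D. \<forall>b\<in>D. a + b \<in> B" using base_add[OF B(1)] by blast
    let ?O = "\<lambda>x. {z \<in> C. z - x \<in> base_interior D}"
    have "x' + y' \<in> U" if "x' \<in> ?O x" "y' \<in> ?O y" for x' y'
    proof -
      have "(x' - x) + (y' - y) \<in> B" using that D base_interior(3)[OF D(1)] C by blast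
      then have "x + y + ((x' - x) + (y' - y)) \<in> U" using B by blast
      then show ?thesis by (simp add: algebra_simps)
    qed
    then show "\<exists>V W. openin base_topology V \<and> openin base_topology W \<and> x \<in> V \<and> y \<in> W \<and>
      V \<times> W \<subseteq> ?Q"
      using base_interior(1,2)[OF D(1)] C by (intro exI[of _ "?O x"] exI[of _ "?O y"]) auto
  qed auto
  show "continuous_map (prod_topology euclideanreal base_topology) base_topology (\<lambda>(c, x). c *\<^sub>R x)"
    unfolding continuous_map_def openin_prod_topology_alt
  proof (intro conjI allI impI)
    fix U c x assume U: "openin base_topology U"
      and cx: "(c, x) \<in> {p \<in> topspace (prod_topology euclideanreal base_topology). (case p of (c, x) \<Rightarrow> c *\<^sub>R x) \<in> U}" (is "_ \<in> ?Q")
    then have C: "x \<in> C" "c *\<^sub>R x \<in> U" by auto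
    then obtain B where B: "B \<in> \<B>" "\<forall>b\<in>B. c *\<^sub>R x + b \<in> U" using U by (auto simp: openin_base)
    obtain D where D: "D \<in> \<B>" "\<forall>a\<in>D. \<forall>b\<in>D. a + b \<in> B" using base_add[OF B(1)] by blast
    obtain e where e: "e > 0" "\<And>d. \<bar>d\<bar> \<le> e \<Longrightarrow> d *\<^sub>R x \<in> D" using base_absorb_small[OF D(1) C(1)] by blast
    obtain n where n: "\<bar>c\<bar> + 1 < 2 ^ n" using real_arch_pow[of 2 "\<bar>c\<bar> + 1"] by auto
    obtain F where F: "F \<in> \<B>" "\<And>z d. z \<in> F \<Longrightarrow> \<bar>d\<bar> \<le> 2 ^ n \<Longrightarrow> d *\<^sub>R z \<in> D"
      using base_scale_bounded[OF D(1), of n] by blast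
    let ?O = "{z \<in> C. z - x \<in> base_interior F}" and ?I = "ball c (min e 1)"
    have "c' *\<^sub>R x' \<in> U" if "c' \<in> ?I" "x' \<in> ?O" for c' x'
    proof -
      have c': "\<bar>c' - c\<bar> \<le> e" "\<bar>c'\<bar> \<le> 2 ^ n" using that(1) n by (auto simp: dist_real_def)
      have "(c' - c) *\<^sub>R x + c' *\<^sub>R (x' - x) \<in> B"
        using that(2) D F(2)[OF base_interior(3)[OF F(1) C(1)] c'(2)] e(2)[OF c'(1)] by blast
      then have "c *\<^sub>R x + ((c' - c) *\<^sub>R x + c' *\<^sub>R (x' - x)) \<in> U" using B by blast
      then show ?thesis by (simp add: algebra_simps)
    qed
    then show "\<exists>V W. openin euclideanreal V \<and> openin base_topology W \<and> c \<in> V \<and> x \<in> W \<and>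
      V \<times> W \<subseteq> ?Q"
      using base_interior(1,2)[OF F(1)] C e(1) by (intro exI[of _ "?I"] exI[of _ "?O"]) auto
  qed auto
qed simp

lemma locally_solid_base: "locally_solid G base_topology"
  unfolding locally_solid_def
proof (intro allI impI)
  fix U assume U: "openin base_topology U \<and> 0 \<in> U"
  then obtain B where B: "B \<in> \<B>" "B \<subseteq> U" by (force simp: openin_base)
  show "\<exists>V S. openin base_topology V \<and> 0 \<in> V \<and> V \<subseteq> S \<and> solid G S \<and> S \<subseteq> U"
    using base_interior[OF B(1) zero_in] B base_solid
    by (intro exI[of _ "{z \<in> C. z - 0 \<in> base_interior B}"] exI[of _ B]) force
qed

lemma limitin_base_0:
  assumes "\<And>B. B \<in> \<B> \<Longrightarrow> eventually (\<lambda>a. x a \<in> B) F"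
  shows "limitin base_topology x 0 F"
  unfolding limitin_def
proof (intro conjI allI impI)
  fix U assume U: "openin base_topology U \<and> 0 \<in> U"
  then obtain B where B: "B \<in> \<B>" "B \<subseteq> U" by (force simp: openin_base)
  show "eventually (\<lambda>a. x a \<in> U) F" 
    by (rule eventually_mono[OF assms[OF B(1)]]) (use B(2) in blast)
qed simp

lemma Hausdorff_base:
  assumes sep: "\<And>x. x \<in> C \<Longrightarrow> x \<noteq> 0 \<Longrightarrow> \<exists>B\<in>\<B>. x \<notin> B"
  shows "Hausdorff_space base_topology"
  unfolding Hausdorff_space_def
proof (intro allI impI)
  fix x y assume xy: "x \<in> topspace base_topology \<and> y \<in> topspace base_topology \<and> x \<noteq> y"
  then have C: "x \<in> C" "y \<in> C" by auto
  obtain B where B: "B \<in> \<B>" "x - y \<notin> B" using sep[of "x - y"] xy by auto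
  obtain D where D: "D \<in> \<B>" "\<forall>a\<in>D. \<forall>b\<in>D. a + b \<in> B" using base_add[OF B(1)] by blast
  let ?O = "\<lambda>x. {z \<in> C. z - x \<in> base_interior D}"
  have False if "z \<in> ?O x" "z \<in> ?O y" for z
  proof -
    have "- (z - x) + (z - y) \<in> B"
      using that D base_neg[OF D(1)] base_interior(3)[OF D(1)] C by blast
    then show False using B(2) by simp
  qed
  then show "\<exists>U V. openin base_topology U \<and> openin base_topology V \<and> x \<in> U \<and> y \<in> V \<and> disjnt U V"
    using base_interior(1,2)[OF D(1)] C
    by (intro exI[of _ "?O x"] exI[of _ "?O y"]) (auto simp: disjnt_def)
qed

end

section \<open>Unbounded topologies and the uo-Lebesgue property\<close>

text \<open>The unbounded topology generated by a family \<open>\<W>\<close> of downward closed sets of positive elements: \<open>x\<close> is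
  small if all truncations \<open>\<bar>x\<bar> \<sqinter> u\<close> are small in the sense of \<open>\<W>\<close>.  The truncation is exactly what
  uo-convergence controls, so the only link to order convergence is \<open>W_down_0\<close>, the order continuity of \<open>\<W>\<close>.\<close>

lemma (in vlat) unbounded_topology:
  assumes ne: "\<W> \<noteq> {}"
    and W_pos: "\<And>W x. W \<in> \<W> \<Longrightarrow> x \<in> W \<Longrightarrow> x \<in> C \<and> 0 \<preceq> x"
    and W_down: "\<And>W x y. W \<in> \<W> \<Longrightarrow> y \<in> W \<Longrightarrow> x \<in> C \<Longrightarrow> 0 \<preceq> x \<Longrightarrow> x \<preceq> y \<Longrightarrow> x \<in> W"
    and W_Int: "\<And>V W. V \<in> \<W> \<Longrightarrow> W \<in> \<W> \<Longrightarrow> \<exists>Z\<in>\<W>. Z \<subseteq> V \<inter> W"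
    and W_add: "\<And>W. W \<in> \<W> \<Longrightarrow> \<exists>V\<in>\<W>. \<forall>x\<in>V. \<forall>y\<in>V. x + y \<in> W"
    and W_absorb: "\<And>W x. W \<in> \<W> \<Longrightarrow> x \<in> C \<Longrightarrow> 0 \<preceq> x \<Longrightarrow> \<exists>e>0. e *\<^sub>R x \<in> W"
    and W_sep: "\<And>x. x \<in> C \<Longrightarrow> 0 \<preceq> x \<Longrightarrow> x \<noteq> 0 \<Longrightarrow> \<exists>W\<in>\<W>. x \<notin> W"
    and W_down_0: "\<And>W Y. W \<in> \<W> \<Longrightarrow> down_to_0 G Y \<Longrightarrow> \<exists>y\<in>Y. y \<in> W"
  shows "\<exists>\<tau>. Hausdorff_uo_Lebesgue G \<tau>"
proof -
  define N where "N W u = {x \<in> C. \<bar>x\<bar>\<^sub>G \<sqinter> u \<in> W}" for W u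
  define \<B> where "\<B> = {N W u | W u. W \<in> \<W> \<and> u \<in> C \<and> 0 \<preceq> u}"
  have W_0: "0 \<in> W" if "W \<in> \<W>" for W
    using W_absorb[OF that zero_in] by auto
  have BE: "\<exists>W u. B = N W u \<and> W \<in> \<W> \<and> u \<in> C \<and> 0 \<preceq> u" if "B \<in> \<B>" for B using that by (auto simp: \<B>_def)
  interpret solid_base G \<B>
  proof
    show "\<B> \<noteq> {}" using ne zero_in le_refl[OF zero_in] unfolding \<B>_def by blast
  next
    fix B assume "B \<in> \<B>"
    then obtain W u where B: "B = N W u" and W: "W \<in> \<W>" and u: "u \<in> C" "0 \<preceq> u" using BE by blast
    show "solid G B"
      unfolding solid_def
    proof (intro conjI ballI impI)
      fix x y assume x: "x \<in> C" and y: "y \<in> B" and xy: "\<bar>x\<bar>\<^sub>G \<preceq> \<bar>y\<bar>\<^sub>G"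
      have yC: "y \<in> C" "\<bar>y\<bar>\<^sub>G \<sqinter> u \<in> W" using y by (auto simp: B N_def)
      have "\<bar>x\<bar>\<^sub>G \<sqinter> u \<in> W"
        using x yC(1) xy u by (intro W_down[OF W yC(2)]) (auto intro!: meet_nonneg meet_mono)
      then show "x \<in> B" using x by (simp add: B N_def)
    qed (auto simp: B N_def)
    show "0 \<in> B" using W_0[OF W] u meet_absorb[of 0 u] abs_of_nonneg[of 0] by (simp add: B N_def)
    show "\<exists>D\<in>\<B>. \<forall>x\<in>D. \<forall>y\<in>D. x + y \<in> B"
    proof -
      obtain V where V: "V \<in> \<W>" "\<forall>x\<in>V. \<forall>y\<in>V. x + y \<in> W" using W_add[OF W] by blast
      have "x + y \<in> N W u" if "x \<in> N V u" "y \<in> N V u" for x y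
      proof -
        have xy: "x \<in> C" "y \<in> C" "\<bar>x\<bar>\<^sub>G \<sqinter> u + \<bar>y\<bar>\<^sub>G \<sqinter> u \<in> W" using that V by (auto simp: N_def)
        have "\<bar>x + y\<bar>\<^sub>G \<sqinter> u \<preceq> (\<bar>x\<bar>\<^sub>G + \<bar>y\<bar>\<^sub>G) \<sqinter> u"
          using xy u by (intro meet_mono abs_triangle) auto
        then have "\<bar>x + y\<bar>\<^sub>G \<sqinter> u \<preceq> \<bar>x\<bar>\<^sub>G \<sqinter> u + \<bar>y\<bar>\<^sub>G \<sqinter> u"
          using xy u by - (erule le_trans, auto intro!: meet_add_le)
        then show ?thesis using W_down[OF W xy(3)] xy u by (auto simp: N_def meet_nonneg)
      qed
      then show ?thesis using V u unfolding B by (intro bexI[of _ "N V u"]) (auto simp: \<B>_def)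
    qed
    show "\<exists>e>0. e *\<^sub>R x \<in> B" if x: "x \<in> C" for x
    proof -
      obtain e where e: "e > 0" "e *\<^sub>R \<bar>x\<bar>\<^sub>G \<in> W" using W_absorb[OF W, of "\<bar>x\<bar>\<^sub>G"] x by auto
      have "\<bar>e *\<^sub>R x\<bar>\<^sub>G \<sqinter> u \<preceq> e *\<^sub>R \<bar>x\<bar>\<^sub>G"
        using abs_scale_le[OF x, of e] e x u le_trans[OF meet_lb1[of "\<bar>e *\<^sub>R x\<bar>\<^sub>G" u]] by simp
      then have "e *\<^sub>R x \<in> B"
        using W_down[OF W e(2), of "\<bar>e *\<^sub>R x\<bar>\<^sub>G \<sqinter> u"] x u by (simp add: B N_def meet_nonneg)
      then show ?thesis using e(1) by blast
    qed
  next
    fix A B assume "A \<in> \<B>" "B \<in> \<B>"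
    then obtain V u W v where A: "A = N V u" "V \<in> \<W>" "u \<in> C" "0 \<preceq> u"
      and B: "B = N W v" "W \<in> \<W>" "v \<in> C" "0 \<preceq> v" using BE by metis
    obtain Z where Z: "Z \<in> \<W>" "Z \<subseteq> V \<inter> W" using W_Int A B by blast
    have uv: "u \<preceq> u + v" "v \<preceq> u + v" using add_mono[of u u 0 v] add_mono[of v v 0 u] A B
      by (auto simp: add.commute)
    have "x \<in> A \<inter> B" if "x \<in> N Z (u + v)" for x
    proof -
      have x: "x \<in> C" "\<bar>x\<bar>\<^sub>G \<sqinter> (u + v) \<in> V" "\<bar>x\<bar>\<^sub>G \<sqinter> (u + v) \<in> W" using that Z by (auto simp: N_def)
      have "\<bar>x\<bar>\<^sub>G \<sqinter> u \<in> V" "\<bar>x\<bar>\<^sub>G \<sqinter> v \<in> W"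
        using W_down[OF A(2) x(2)] W_down[OF B(2) x(3)] x A B uv by (simp_all add: meet_nonneg meet_mono)
      then show ?thesis using x A B by (simp add: N_def)
    qed
    then show "\<exists>D\<in>\<B>. D \<subseteq> A \<inter> B"
      using Z A B add_nonneg[of u v] unfolding \<B>_def
      by (intro bexI[of _ "N Z (u + v)"] CollectI exI[of _ Z] exI[of _ "u + v"]) auto
  qed
  have "\<exists>B\<in>\<B>. x \<notin> B" if x: "x \<in> C" "x \<noteq> 0" for x
  proof -
    obtain W where W: "W \<in> \<W>" "\<bar>x\<bar>\<^sub>G \<notin> W" using W_sep[of "\<bar>x\<bar>\<^sub>G"] x abs_eq_0 by auto
    then have "x \<notin> N W \<bar>x\<bar>\<^sub>G" using x meet_absorb[of "\<bar>x\<bar>\<^sub>G" "\<bar>x\<bar>\<^sub>G"] by (simp add: N_def)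
    then show ?thesis using W(1) abs_in[OF x(1)] abs_nonneg[OF x(1)] unfolding \<B>_def by blast
  qed
  then have H: "Hausdorff_space base_topology" by (rule Hausdorff_base)
  have L: "limitin base_topology x 0 (net_filter r)"
    if r: "directed r" and x: "\<forall>a\<in>Field r. x a \<in> C" and uo: "uo_conv G r x 0"
    for r :: "('a set \<times> 'a) rel" and x
  proof (rule limitin_base_0)
    fix B assume "B \<in> \<B>"
    then obtain W u where B: "B = N W u" and W: "W \<in> \<W>" and u: "u \<in> C" "0 \<preceq> u" using BE by blast
    have "o_conv G r (\<lambda>a. \<bar>x a - 0\<bar>\<^sub>G \<sqinter> u) 0" using uo u by (auto simp: uo_conv_def)
    then obtain Y where Y: "down_to_0 G Y"
      "\<forall>y\<in>Y. \<exists>a\<in>Field r. \<forall>a'. (a, a') \<in> r \<longrightarrow> \<bar>0 - \<bar>x a' - 0\<bar>\<^sub>G \<sqinter> u\<bar>\<^sub>G \<preceq> y" by (rule o_convE_set)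
    obtain y where y: "y \<in> Y" "y \<in> W" using W_down_0[OF W Y(1)] by blast
    then obtain a where a: "a \<in> Field r" "\<forall>a'. (a, a') \<in> r \<longrightarrow> \<bar>0 - \<bar>x a' - 0\<bar>\<^sub>G \<sqinter> u\<bar>\<^sub>G \<preceq> y"
      using Y(2) by blast
    have "x a' \<in> B" if "(a, a') \<in> r" for a'
    proof -
      have xC: "x a' \<in> C" using x FieldI2[OF that] by blast
      have "\<bar>0 - \<bar>x a' - 0\<bar>\<^sub>G \<sqinter> u\<bar>\<^sub>G = \<bar>x a'\<bar>\<^sub>G \<sqinter> u" using xC u by (simp add: abs_of_nonneg meet_nonneg)
      then have "\<bar>x a'\<bar>\<^sub>G \<sqinter> u \<preceq> y" using a(2) that by metis
      then have "\<bar>x a'\<bar>\<^sub>G \<sqinter> u \<in> W" using xC u by (intro W_down[OF W y(2)]) (auto intro: meet_nonneg)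
      then show ?thesis using xC by (simp add: B N_def)
    qed
    then show "eventually (\<lambda>a. x a \<in> B) (net_filter r)"
      unfolding eventually_net_filter[OF r] using a(1) by blast
  qed
  show ?thesis
    unfolding Hausdorff_uo_Lebesgue_def uo_Lebesgue_def
    using H L linear_base locally_solid_base by blast
qed

lemma tau_hat_Hausdorff_uo_Lebesgue:
  "\<exists>\<tau>. Hausdorff_uo_Lebesgue G \<tau> \<Longrightarrow> Hausdorff_uo_Lebesgue G (tau_hat G)"
  unfolding tau_hat_def by (rule someI_ex)

lemma net_filter_nontrivial: "directed r \<Longrightarrow> net_filter r \<noteq> bot"
  unfolding trivial_limit_def eventually_net_filter
  by (auto simp: directed_def preorder_on_def refl_on_def)

lemma (in vlat) limitin_translate:
  assumes "linear_topology G \<tau>" "limitin \<tau> (\<lambda>a. x a - l) 0 F" "l \<in> C"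
  shows "limitin \<tau> x l F"
proof -
  have top: "topspace \<tau> = C" and "continuous_map (prod_topology \<tau> \<tau>) \<tau> (\<lambda>(x, y). x + y)"
    using assms(1) by (auto simp: linear_topology_def)
  then have "continuous_map \<tau> \<tau> ((\<lambda>(x, y). x + y) \<circ> (\<lambda>z. (z, l)))"
    using assms(3) by (intro continuous_map_compose) (auto simp: continuous_map_pairwise o_def)
  then have cont: "continuous_map \<tau> \<tau> (\<lambda>z. z + l)" by (simp add: o_def)
  show ?thesis
    unfolding limitin_def
  proof (intro conjI allI impI)
    show "l \<in> topspace \<tau>" using assms top by simp
    fix U assume U: "openin \<tau> U \<and> l \<in> U"
    then have "openin \<tau> {z \<in> topspace \<tau>. z + l \<in> U}" using cont by (auto simp: continuous_map_def)
    then have "eventually (\<lambda>a. x a - l \<in> {z \<in> topspace \<tau>. z + l \<in> U}) F"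
      by (rule limitinD[OF assms(2)]) (use U top in auto)
    then show "eventually (\<lambda>a. x a \<in> U) F" by (rule eventually_mono) simp
  qed
qed

lemma (in vlat) uo_conv_imp_limitin:
  assumes "uo_Lebesgue G \<tau>" "directed r" "\<And>a. a \<in> Field r \<Longrightarrow> x a \<in> C" "l \<in> C" "uo_conv G r x l"
  shows "limitin \<tau> x l (net_filter r)"
proof (rule limitin_translate)
  show "linear_topology G \<tau>" using assms(1) by (simp add: uo_Lebesgue_def)
  show "limitin \<tau> (\<lambda>a. x a - l) 0 (net_filter r)"
    using assms by (intro uo_Lebesgue_net[OF assms(1,2)]) (auto simp: uo_conv_def)
qed fact

section \<open>Order bounded operators form a vector lattice\<close>

locale dc_vlat = vlat +
  assumes DC: "dedekind_complete G"
begin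

abbreviation L where "L \<equiv> L_ob G"
abbreviation opC where "opC \<equiv> vcarrier (L_ob G)"

lemma arch: "archimedean G"
  using DC by (simp add: dedekind_complete_def)

lemma ex_lub: "S \<subseteq> C \<Longrightarrow> S \<noteq> {} \<Longrightarrow> u \<in> C \<Longrightarrow> (\<And>x. x \<in> S \<Longrightarrow> x \<preceq> u) \<Longrightarrow> \<exists>s. is_lub G S s"
  using DC unfolding dedekind_complete_def by blast

lemma neg_le_neg: "a \<in> C \<Longrightarrow> b \<in> C \<Longrightarrow> - a \<preceq> - b \<longleftrightarrow> b \<preceq> a"
  using neg_le[of a "- b"] by simp

lemma le_neg: "a \<in> C \<Longrightarrow> b \<in> C \<Longrightarrow> a \<preceq> - b \<longleftrightarrow> b \<preceq> - a"
  using neg_le_neg[of "- a" b] by simp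

lemma ex_glb:
  assumes "S \<subseteq> C" "S \<noteq> {}" "u \<in> C" "\<And>x. x \<in> S \<Longrightarrow> u \<preceq> x"
  shows "\<exists>s. is_glb G S s"
proof -
  have "\<exists>s. is_lub G (uminus ` S) s"
    using assms by (intro ex_lub[of _ "- u"]) (auto simp: neg_le_neg subset_iff)
  then obtain s where s: "s \<in> C" "\<And>x. x \<in> S \<Longrightarrow> - x \<preceq> s"
    "\<And>v. v \<in> C \<Longrightarrow> (\<forall>x\<in>S. - x \<preceq> v) \<Longrightarrow> s \<preceq> v" unfolding is_lub_def by auto
  have "is_glb G S (- s)"
    unfolding is_glb_def
  proof (intro conjI ballI impI)
    show "- s \<preceq> x" if "x \<in> S" for x using s that assms(1) neg_le[of s x] by auto
    show "v \<preceq> - s" if "v \<in> C" "\<forall>x\<in>S. v \<preceq> x" for v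
    proof -
      have "s \<preceq> - v" using that assms(1) by (intro s(3)) (auto simp: neg_le_neg subset_iff)
      then show ?thesis using le_neg s(1) that(1) by blast
    qed
  qed (use s in auto)
  then show ?thesis by blast
qed

lemma op_iff: "T \<in> opC \<longleftrightarrow> order_bounded_operator G T \<and> (\<forall>x. x \<notin> C \<longrightarrow> T x = 0)"
  by (simp add: L_ob_def)

lemma op_in: "T \<in> opC \<Longrightarrow> x \<in> C \<Longrightarrow> T x \<in> C"
  and op_add: "T \<in> opC \<Longrightarrow> x \<in> C \<Longrightarrow> y \<in> C \<Longrightarrow> T (x + y) = T x + T y"
  and op_scale: "T \<in> opC \<Longrightarrow> x \<in> C \<Longrightarrow> T (c *\<^sub>R x) = c *\<^sub>R T x"
  and op_outside: "T \<in> opC \<Longrightarrow> x \<notin> C \<Longrightarrow> T x = 0"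
  by (auto simp: op_iff order_bounded_operator_def)

lemma op_zero [simp]: "T \<in> opC \<Longrightarrow> T 0 = 0"
  using op_scale[of T 0 0] by simp

lemma op_diff: "T \<in> opC \<Longrightarrow> x \<in> C \<Longrightarrow> y \<in> C \<Longrightarrow> T (x - y) = T x - T y"
  using op_add[of T "x - y" y] by (simp add: algebra_simps)

lemma op_le_iff:
  "S \<in> opC \<Longrightarrow> T \<in> opC \<Longrightarrow> vle L S T \<longleftrightarrow> (\<forall>x\<in>C. 0 \<preceq> x \<longrightarrow> S x \<preceq> T x)"
  by (auto simp: L_ob_def op_iff order_bounded_operator_def le_iff_diff[of "S _"])

lemma op_pos_iff: "vle L 0 T \<longleftrightarrow> (\<forall>x\<in>C. 0 \<preceq> x \<longrightarrow> 0 \<preceq> T x)"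
  by (auto simp: L_ob_def)

text \<open>Order intervals can be translated to start at \<open>0\<close>, by linearity.\<close>

lemma op_boundedI:
  assumes T: "\<And>x. x \<in> C \<Longrightarrow> T x \<in> C" "\<And>x y. x \<in> C \<Longrightarrow> y \<in> C \<Longrightarrow> T (x + y) = T x + T y"
    "\<And>x c. x \<in> C \<Longrightarrow> T (c *\<^sub>R x) = c *\<^sub>R T x" "\<And>x. x \<notin> C \<Longrightarrow> T x = 0"
    and bd: "\<And>b. b \<in> C \<Longrightarrow> 0 \<preceq> b \<Longrightarrow> \<exists>d\<in>C. \<forall>x\<in>C. 0 \<preceq> x \<and> x \<preceq> b \<longrightarrow> \<bar>T x\<bar>\<^sub>G \<preceq> d"
  shows "T \<in> opC"
proof -
  have "\<exists>c\<in>C. \<exists>d\<in>C. \<forall>x\<in>C. a \<preceq> x \<and> x \<preceq> b \<longrightarrow> c \<preceq> T x \<and> T x \<preceq> d" if ab: "a \<in> C" "b \<in> C" for a b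
  proof (cases "a \<preceq> b")
    case True
    then obtain d where d: "d \<in> C" "\<And>x. x \<in> C \<Longrightarrow> 0 \<preceq> x \<Longrightarrow> x \<preceq> b - a \<Longrightarrow> \<bar>T x\<bar>\<^sub>G \<preceq> d"
      using bd[of "b - a"] ab le_iff_diff[of a b] by auto
    have "T a - d \<preceq> T x \<and> T x \<preceq> T a + d" if x: "x \<in> C" "a \<preceq> x" "x \<preceq> b" for x
    proof -
      have Tx: "T x = T a + T (x - a)" using T(2)[of a "x - a"] x ab by simp
      have n: "\<bar>T (x - a)\<bar>\<^sub>G \<preceq> d"
        using x ab le_iff_diff[of a x] add_right_mono[of x b "- a"] by (intro d(2)) auto
      have TC: "T (x - a) \<in> C" using T(1) x ab by simp
      have "T (x - a) \<preceq> d" using le_trans[OF abs_ge n] TC d(1) by simp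
      moreover have "- T (x - a) \<preceq> d" using le_trans[OF abs_ge_minus n] TC d(1) by simp
      then have "- d \<preceq> T (x - a)" using neg_le TC d(1) by blast
      ultimately show ?thesis
        using add_right_mono[of "T (x - a)" d "T a"] add_right_mono[of "- d" "T (x - a)" "T a"] TC d(1) T(1)[OF ab(1)]
        unfolding Tx by (simp add: add.commute)
    qed
    then show ?thesis using T(1)[OF ab(1)] d(1) by (intro bexI[of _ "T a - d"] bexI[of _ "T a + d"]) auto
  next
    case False
    then show ?thesis using le_trans[of a _ b] ab by (intro bexI[of _ 0]) auto
  qed
  then show ?thesis using T unfolding op_iff order_bounded_operator_def by simp
qed

lemma op_bounded:
  assumes T: "T \<in> opC" and b: "b \<in> C" "0 \<preceq> b"
  shows "\<exists>d\<in>C. \<forall>x\<in>C. 0 \<preceq> x \<and> x \<preceq> b \<longrightarrow> \<bar>T x\<bar>\<^sub>G \<preceq> d"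
proof -
  note op_in[OF T, simp]
  have "\<forall>a\<in>C. \<forall>b\<in>C. \<exists>c\<in>C. \<exists>d\<in>C. \<forall>x\<in>C. a \<preceq> x \<and> x \<preceq> b \<longrightarrow> c \<preceq> T x \<and> T x \<preceq> d"
    using T unfolding op_iff order_bounded_operator_def by (elim conjE)
  then have "\<exists>c\<in>C. \<exists>d\<in>C. \<forall>x\<in>C. 0 \<preceq> x \<and> x \<preceq> b \<longrightarrow> c \<preceq> T x \<and> T x \<preceq> d"
    using b(1) zero_in by blast
  then obtain c d where cd: "c \<in> C" "d \<in> C" "\<And>x. x \<in> C \<Longrightarrow> 0 \<preceq> x \<Longrightarrow> x \<preceq> b \<Longrightarrow> c \<preceq> T x \<and> T x \<preceq> d"
    by blast
  have "\<bar>T x\<bar>\<^sub>G \<preceq> \<bar>c\<bar>\<^sub>G + \<bar>d\<bar>\<^sub>G" if x: "x \<in> C" "0 \<preceq> x" "x \<preceq> b" for x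
  proof (rule abs_least)
    have TC: "T x \<in> C" using T x by simp
    have d: "d \<preceq> \<bar>c\<bar>\<^sub>G + \<bar>d\<bar>\<^sub>G" using add_mono[of 0 "\<bar>c\<bar>\<^sub>G" d "\<bar>d\<bar>\<^sub>G"] cd by (simp add: abs_ge)
    show "T x \<preceq> \<bar>c\<bar>\<^sub>G + \<bar>d\<bar>\<^sub>G" using le_trans[OF _ d] cd TC x by simp
    have c: "- c \<preceq> \<bar>c\<bar>\<^sub>G + \<bar>d\<bar>\<^sub>G" using add_mono[of "- c" "\<bar>c\<bar>\<^sub>G" 0 "\<bar>d\<bar>\<^sub>G"] cd by (simp add: abs_ge_minus)
    have "- T x \<preceq> - c" using cd TC x by (simp add: neg_le_neg)
    then show "- T x \<preceq> \<bar>c\<bar>\<^sub>G + \<bar>d\<bar>\<^sub>G" using le_trans[OF _ c] cd TC x by simp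
  qed (use T x cd in auto)
  then show ?thesis using cd by (intro bexI[of _ "\<bar>c\<bar>\<^sub>G + \<bar>d\<bar>\<^sub>G"]) auto
qed

lemma subspace_op: "subspace opC"
proof (rule subspaceI)
  show "0 \<in> opC" by (rule op_boundedI) (auto simp: abs_of_nonneg intro!: bexI[of _ 0])
next
  fix S T assume S: "S \<in> opC" and T: "T \<in> opC"
  note op_in[OF S, simp] op_in[OF T, simp]
  show "S + T \<in> opC"
  proof (rule op_boundedI)
    fix b assume b: "b \<in> C" "0 \<preceq> b"
    obtain d e where d: "d \<in> C" "\<And>x. x \<in> C \<Longrightarrow> 0 \<preceq> x \<Longrightarrow> x \<preceq> b \<Longrightarrow> \<bar>S x\<bar>\<^sub>G \<preceq> d"
      and e: "e \<in> C" "\<And>x. x \<in> C \<Longrightarrow> 0 \<preceq> x \<Longrightarrow> x \<preceq> b \<Longrightarrow> \<bar>T x\<bar>\<^sub>G \<preceq> e"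
      using op_bounded[OF S b] op_bounded[OF T b] by blast
    have "\<bar>(S + T) x\<bar>\<^sub>G \<preceq> d + e" if x: "x \<in> C" "0 \<preceq> x" "x \<preceq> b" for x
      using le_trans[OF abs_triangle[of "S x" "T x"] add_mono[OF d(2)[OF x] e(2)[OF x]]] S T x d(1) e(1) by simp
    then show "\<exists>d\<in>C. \<forall>x\<in>C. 0 \<preceq> x \<and> x \<preceq> b \<longrightarrow> \<bar>(S + T) x\<bar>\<^sub>G \<preceq> d"
      using d e by (intro bexI[of _ "d + e"]) auto
  qed (use S T in \<open>auto simp: op_add op_scale op_outside scaleR_add_right\<close>)
next
  fix c T assume T: "T \<in> opC"
  note op_in[OF T, simp]
  show "c *\<^sub>R T \<in> opC"
  proof (rule op_boundedI)
    fix b assume b: "b \<in> C" "0 \<preceq> b"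
    obtain d where d: "d \<in> C" "\<And>x. x \<in> C \<Longrightarrow> 0 \<preceq> x \<Longrightarrow> x \<preceq> b \<Longrightarrow> \<bar>T x\<bar>\<^sub>G \<preceq> d"
      using op_bounded[OF T b] by blast
    have "\<bar>(c *\<^sub>R T) x\<bar>\<^sub>G \<preceq> \<bar>c\<bar> *\<^sub>R d" if x: "x \<in> C" "0 \<preceq> x" "x \<preceq> b" for x
      using le_trans[OF abs_scale_le[of "T x" c] scale_mono[OF d(2)[OF x]]] T x d(1) by simp
    then show "\<exists>d\<in>C. \<forall>x\<in>C. 0 \<preceq> x \<and> x \<preceq> b \<longrightarrow> \<bar>(c *\<^sub>R T) x\<bar>\<^sub>G \<preceq> d"
      using d by (intro bexI[of _ "\<bar>c\<bar> *\<^sub>R d"]) auto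
  qed (use T in \<open>auto simp: op_add op_scale op_outside scaleR_add_right\<close>)
qed

lemmas op_plus_in [simp, intro] = subspace_add[OF subspace_op]
lemmas op_minus_in [simp, intro] = subspace_diff[OF subspace_op]
lemmas op_uminus_in [simp, intro] = subspace_neg[OF subspace_op]
lemmas op_scaleR_in [simp, intro] = subspace_scale[OF subspace_op]
lemmas op_0_in [simp, intro] = subspace_0[OF subspace_op]

lemma op_eqI:
  assumes "S \<in> opC" "T \<in> opC" "\<And>x. x \<in> C \<Longrightarrow> 0 \<preceq> x \<Longrightarrow> S x = T x"
  shows "S = T"
proof
  fix x show "S x = T x"
  proof (cases "x \<in> C")
    case True
    let ?p = "(1/2) *\<^sub>R (\<bar>x\<bar>\<^sub>G + x)" and ?q = "(1/2) *\<^sub>R (\<bar>x\<bar>\<^sub>G - x)"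
    have C: "?p \<in> C" "?q \<in> C" using True by auto
    have "S (?p - ?q) = T (?p - ?q)"
      unfolding op_diff[OF assms(1) C] op_diff[OF assms(2) C]
      using assms(3)[OF C(1)] assms(3)[OF C(2)] half_parts(1,2)[OF True] by simp
    then show ?thesis unfolding half_parts(3)[OF True, symmetric] .
  qed (use assms in \<open>simp add: op_outside\<close>)
qed

lemma op_mono:
  assumes "T \<in> opC" "vle L 0 T" "x \<preceq> y" "x \<in> C" "y \<in> C"
  shows "T x \<preceq> T y"
proof -
  note op_in[OF assms(1), simp]
  have "0 \<preceq> T (y - x)" using assms le_iff_diff[of x y] by (simp add: op_pos_iff)
  then show ?thesis using assms le_iff_diff[of "T x" "T y"] by (simp add: op_diff)
qed

text \<open>Kantorovich's extension lemma.  Superhomogeneity for positive scalars suffices: applied to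
  \<open>c\<close> and to \<open>1 / c\<close> it gives equality.\<close>

lemma extend_positive_cone:
  assumes f_in: "\<And>x. x \<in> C \<Longrightarrow> 0 \<preceq> x \<Longrightarrow> f x \<in> C"
    and f_add: "\<And>x y. x \<in> C \<Longrightarrow> 0 \<preceq> x \<Longrightarrow> y \<in> C \<Longrightarrow> 0 \<preceq> y \<Longrightarrow> f (x + y) = f x + f y"
    and f_scale: "\<And>x c. x \<in> C \<Longrightarrow> 0 \<preceq> x \<Longrightarrow> 0 < c \<Longrightarrow> c *\<^sub>R f x \<preceq> f (c *\<^sub>R x)"
    and f_pos: "\<And>x. x \<in> C \<Longrightarrow> 0 \<preceq> x \<Longrightarrow> 0 \<preceq> f x"
  shows "\<exists>T\<in>opC. \<forall>x\<in>C. 0 \<preceq> x \<longrightarrow> T x = f x"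
proof -
  define p where "p x = (1/2) *\<^sub>R (\<bar>x\<bar>\<^sub>G + x)" for x
  define q where "q x = (1/2) *\<^sub>R (\<bar>x\<bar>\<^sub>G - x)" for x
  have pq: "p x \<in> C" "q x \<in> C" "0 \<preceq> p x" "0 \<preceq> q x" "p x - q x = x" if "x \<in> C" for x
    using half_parts(1,2)[OF that] half_parts(3)[OF that, symmetric] that by (auto simp: p_def q_def)
  define T where "T x = (if x \<in> C then f (p x) - f (q x) else 0)" for x
  have T_eq: "T x = f a - f b" if "x = a - b" "a \<in> C" "b \<in> C" "0 \<preceq> a" "0 \<preceq> b" for x a b
  proof -
    have x: "x \<in> C" using that by auto
    have "p x - q x = a - b" using pq(5)[OF x] that(1) by (rule trans)
    then have "p x + b = a + q x" by (simp add: algebra_simps)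
    then have "f (p x) + f b = f a + f (q x)"
      using f_add[of "p x" b] f_add[of a "q x"] pq(1-4)[OF x] that(2-) by simp
    then show ?thesis using x by (simp add: T_def algebra_simps)
  qed
  have f_0: "f 0 = 0" using f_add[of 0 0] by simp
  have f_scale_eq: "f (c *\<^sub>R x) = c *\<^sub>R f x" if "x \<in> C" "0 \<preceq> x" "0 \<le> c" for x c
  proof (cases "c = 0")
    case False
    then have c: "c > 0" using that by simp
    have cx: "c *\<^sub>R x \<in> C" "0 \<preceq> c *\<^sub>R x" using that by (auto intro: scale_nonneg)
    have "(1/c) *\<^sub>R f (c *\<^sub>R x) \<preceq> f x" using f_scale[OF cx, of "1/c"] c by simp
    then have "c *\<^sub>R ((1/c) *\<^sub>R f (c *\<^sub>R x)) \<preceq> c *\<^sub>R f x"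
      using c cx that f_in by (intro scale_mono) auto
    then show ?thesis using f_scale[OF that(1,2) c] c cx that f_in by (intro le_antisym) auto
  qed (simp add: f_0)
  have T_f: "T x = f x" if "x \<in> C" "0 \<preceq> x" for x
    using T_eq[of x x 0] that by (simp add: f_0)
  have f_mono: "f x \<preceq> f y" if "x \<in> C" "0 \<preceq> x" "x \<preceq> y" "y \<in> C" for x y
  proof -
    have "0 \<preceq> y" using le_trans[OF that(2,3)] that by simp
    moreover have "f y = f x + f (y - x)" using f_add[of x "y - x"] that by (simp add: le_iff_diff[of x])
    moreover have "0 \<preceq> f (y - x)" using that by (intro f_pos) (auto simp: le_iff_diff[of x])
    ultimately show ?thesis using that f_in[of x] f_in[of y] by (simp add: le_iff_diff[of "f x"])
  qed
  have "T \<in> opC"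
  proof (rule op_boundedI)
    show "T x \<in> C" if "x \<in> C" for x using pq[OF that] that f_in by (simp add: T_def)
    show "T (x + y) = T x + T y" if "x \<in> C" "y \<in> C" for x y
    proof -
      have "T (x + y) = f (p x + p y) - f (q x + q y)"
      proof (rule T_eq)
        have "p x - q x + (p y - q y) = p x + p y - (q x + q y)" by (simp add: algebra_simps)
        then show "x + y = p x + p y - (q x + q y)" using pq(5) that by simp
      qed (use pq that in \<open>auto intro!: add_nonneg\<close>)
      then show ?thesis using pq that f_add by (simp add: T_def algebra_simps)
    qed
    show "T (c *\<^sub>R x) = c *\<^sub>R T x" if x: "x \<in> C" for x c
    proof (cases "0 \<le> c")
      case True
      have "T (c *\<^sub>R x) = f (c *\<^sub>R p x) - f (c *\<^sub>R q x)"
        using pq[OF x] True by (intro T_eq) (auto simp flip: scaleR_diff_right intro: scale_nonneg)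
      then show ?thesis using f_scale_eq pq[OF x] x True by (simp add: T_def scaleR_diff_right)
    next
      case False
      then have c: "0 \<le> - c" by simp
      have e: "(- c) *\<^sub>R q x - (- c) *\<^sub>R p x = c *\<^sub>R (p x - q x)" by (simp add: algebra_simps)
      have "T (c *\<^sub>R x) = f ((- c) *\<^sub>R q x) - f ((- c) *\<^sub>R p x)"
      proof (rule T_eq)
        show "c *\<^sub>R x = (- c) *\<^sub>R q x - (- c) *\<^sub>R p x" unfolding e pq(5)[OF x] ..
      qed (use pq[OF x] scale_nonneg[OF _ _ c] in auto)
      also have "\<dots> = (- c) *\<^sub>R f (q x) - (- c) *\<^sub>R f (p x)" using f_scale_eq[OF _ _ c] pq[OF x] by metis
      finally show ?thesis using x by (simp add: T_def scaleR_diff_right)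
    qed
    show "\<exists>d\<in>C. \<forall>x\<in>C. 0 \<preceq> x \<and> x \<preceq> b \<longrightarrow> \<bar>T x\<bar>\<^sub>G \<preceq> d" if b: "b \<in> C" "0 \<preceq> b" for b
      using f_in[OF b] f_mono b f_in f_pos by (intro bexI[of _ "f b"]) (auto simp: T_f abs_of_nonneg)
  qed (simp add: T_def)
  then show ?thesis using T_f by blast
qed

text \<open>The Riesz--Kantorovich formula: the positive part of \<open>T\<close> maps \<open>x \<ge> 0\<close> to the supremum of \<open>T y\<close> over
  \<open>0 \<le> y \<le> x\<close>.  Additivity is the Riesz decomposition property of the order intervals.\<close>

lemma ex_op_pos_part:
  assumes T: "T \<in> opC"
  shows "\<exists>P. is_lub L {T, 0} P"
proof -
  note op_in[OF T, simp]
  define A where "A x = {T y | y. y \<in> C \<and> 0 \<preceq> y \<and> y \<preceq> x}" for x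
  have "\<exists>s. is_lub G (A x) s" if x: "x \<in> C" "0 \<preceq> x" for x
  proof -
    obtain d where d: "d \<in> C" "\<And>y. y \<in> C \<Longrightarrow> 0 \<preceq> y \<Longrightarrow> y \<preceq> x \<Longrightarrow> \<bar>T y\<bar>\<^sub>G \<preceq> d"
      using op_bounded[OF T x] by blast
    show ?thesis
    proof (rule ex_lub[of _ d])
      show "A x \<subseteq> C" using T by (auto simp: A_def)
      show "A x \<noteq> {}" using x by (auto simp: A_def)
      fix z assume "z \<in> A x"
      then obtain y where y: "z = T y" "y \<in> C" "0 \<preceq> y" "y \<preceq> x" by (auto simp: A_def)
      then show "z \<preceq> d" using le_trans[OF abs_ge d(2)[OF y(2-4)]] T d(1) by simp
    qed (rule d)
  qed
  then obtain f where f: "\<And>x. x \<in> C \<Longrightarrow> 0 \<preceq> x \<Longrightarrow> is_lub G (A x) (f x)" by metis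
  have fC: "f x \<in> C" if "x \<in> C" "0 \<preceq> x" for x using f[OF that] by (simp add: is_lub_def)
  have f_ub: "T y \<preceq> f x" if "x \<in> C" "0 \<preceq> x" "y \<in> C" "0 \<preceq> y" "y \<preceq> x" for x y
    using f[OF that(1,2)] that by (auto simp: is_lub_def A_def)
  have f_least: "f x \<preceq> u" if "x \<in> C" "0 \<preceq> x" "u \<in> C" "\<And>y. y \<in> C \<Longrightarrow> 0 \<preceq> y \<Longrightarrow> y \<preceq> x \<Longrightarrow> T y \<preceq> u" for x u
    using f[OF that(1,2)] that unfolding is_lub_def A_def by blast
  have "\<exists>P\<in>opC. \<forall>x\<in>C. 0 \<preceq> x \<longrightarrow> P x = f x"
  proof (rule extend_positive_cone)
    fix x y assume x: "x \<in> C" "0 \<preceq> x" and y: "y \<in> C" "0 \<preceq> y"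
    have xy: "x + y \<in> C" "0 \<preceq> x + y" using x y by (auto intro: add_nonneg)
    show "f (x + y) = f x + f y"
    proof (rule le_antisym)
      show "f (x + y) \<preceq> f x + f y"
      proof (rule f_least[OF xy])
        fix w assume w: "w \<in> C" "0 \<preceq> w" "w \<preceq> x + y"
        obtain w1 w2 where w12: "w = w1 + w2" "w1 \<in> C" "w2 \<in> C" "0 \<preceq> w1" "w1 \<preceq> x" "0 \<preceq> w2" "w2 \<preceq> y"
          using riesz_decomposition[OF w(2,3) x(2) y(2) w(1) x(1) y(1)] by blast
        show "T w \<preceq> f x + f y"
          using f_ub[OF x w12(2,4,5)] f_ub[OF y w12(3,6,7)] fC[OF x] fC[OF y] T w12
          by (simp add: op_add add_mono)
      qed (use fC x y in auto)
      have "T v \<preceq> f (x + y) - f x" if v: "v \<in> C" "0 \<preceq> v" "v \<preceq> y" for v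
      proof -
        have "f x \<preceq> f (x + y) - T v"
        proof (rule f_least[OF x])
          fix u assume u: "u \<in> C" "0 \<preceq> u" "u \<preceq> x"
          have "T (u + v) \<preceq> f (x + y)"
            using u v x y xy by (intro f_ub add_nonneg add_mono) auto
          then show "T u \<preceq> f (x + y) - T v" using T u v fC[OF xy] by (simp add: op_add le_diff)
        qed (use fC[OF xy] T v in auto)
        then show ?thesis using fC[OF xy] fC[OF x] T v by (simp add: le_diff add.commute)
      qed
      then have "f y \<preceq> f (x + y) - f x" using fC[OF xy] fC[OF x] by (intro f_least[OF y]) auto
      then show "f x + f y \<preceq> f (x + y)" using fC[OF xy] fC[OF x] fC[OF y] by (simp add: le_diff add.commute)
    qed (use fC x y xy in auto)
  next
    fix x :: 'a and c :: real assume x: "x \<in> C" "0 \<preceq> x" and c: "0 < c"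
    have cx: "c *\<^sub>R x \<in> C" "0 \<preceq> c *\<^sub>R x" using x c by (auto intro: scale_nonneg)
    have "f x \<preceq> (1/c) *\<^sub>R f (c *\<^sub>R x)"
    proof (rule f_least[OF x])
      fix y assume y: "y \<in> C" "0 \<preceq> y" "y \<preceq> x"
      have "T (c *\<^sub>R y) \<preceq> f (c *\<^sub>R x)"
        using y x c cx by (intro f_ub) (auto intro: scale_nonneg scale_mono)
      then have "(1/c) *\<^sub>R (c *\<^sub>R T y) \<preceq> (1/c) *\<^sub>R f (c *\<^sub>R x)"
        using T y c fC[OF cx] by (intro scale_mono) (auto simp: op_scale)
      then show "T y \<preceq> (1/c) *\<^sub>R f (c *\<^sub>R x)" using c by simp
    qed (use fC[OF cx] in auto)
    then have "c *\<^sub>R f x \<preceq> c *\<^sub>R ((1/c) *\<^sub>R f (c *\<^sub>R x))"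
      using c fC[OF cx] fC[OF x] by (intro scale_mono) auto
    then show "c *\<^sub>R f x \<preceq> f (c *\<^sub>R x)" using c by simp
  next
    fix x assume "x \<in> C" "0 \<preceq> x"
    then show "0 \<preceq> f x" using f_ub[of x 0] T by simp
  qed (rule fC)
  then obtain P where P: "P \<in> opC" "\<And>x. x \<in> C \<Longrightarrow> 0 \<preceq> x \<Longrightarrow> P x = f x" by blast
  note op_in[OF P(1), simp]
  have "is_lub L {T, 0} P"
    unfolding is_lub_def
  proof (intro conjI ballI impI)
    fix S assume "S \<in> {T, 0}"
    then show "vle L S P" using P f_ub T f_ub[of _ 0] by (auto simp: op_le_iff)
  next
    fix U assume U: "U \<in> opC" "\<forall>S\<in>{T, 0}. vle L S U"
    then have TU: "vle L T U" "vle L 0 U" by auto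
    note op_in[OF U(1), simp]
    have "f x \<preceq> U x" if x: "x \<in> C" "0 \<preceq> x" for x
    proof (rule f_least[OF x])
      fix y assume y: "y \<in> C" "0 \<preceq> y" "y \<preceq> x"
      have "T y \<preceq> U y" using TU(1) T U(1) y by (simp add: op_le_iff)
      then show "T y \<preceq> U x" using le_trans[OF _ op_mono[OF U(1) TU(2) y(3,1) x(1)]] T U(1) y x by simp
    qed (use U x in auto)
    then show "vle L P U" using P U(1) by (simp add: op_le_iff)
  qed (rule P)
  then show ?thesis by blast
qed

text \<open>Positive parts yield all binary joins, \<open>S \<squnion> T = S + (T - S)\<^sup>+\<close>, and negation turns joins into meets.\<close>

lemma vector_lattice_L: "vector_lattice L"
proof -
  have lub: "\<exists>s. is_lub L {S, T} s" if S: "S \<in> opC" and T: "T \<in> opC" for S T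
  proof -
    obtain P where "is_lub L {T - S, 0} P" using ex_op_pos_part[OF op_minus_in[OF T S]] by blast
    then have P: "P \<in> opC" "vle L (T - S) P" "vle L 0 P"
      "\<And>U. U \<in> opC \<Longrightarrow> vle L (T - S) U \<Longrightarrow> vle L 0 U \<Longrightarrow> vle L P U"
      by (simp_all add: is_lub_def)
    note op_in[OF S, simp] op_in[OF T, simp] op_in[OF P(1), simp]
    have "is_lub L {S, T} (S + P)"
      unfolding is_lub_def
    proof (intro conjI ballI impI)
      fix R assume "R \<in> {S, T}"
      then show "vle L R (S + P)" using P(1-3) S T
        by (auto simp: op_le_iff diff_le add.commute le_iff_diff[of "S _"])
    next
      fix U assume U: "U \<in> opC" "\<forall>R\<in>{S, T}. vle L R U"
      then have le: "vle L S U" "vle L T U" by auto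
      note op_in[OF U(1), simp]
      from le have "vle L (T - S) (U - S)" "vle L 0 (U - S)" using S T U(1)
        by (auto simp: op_le_iff le_diff)
      then have "vle L P (U - S)" using P(4) U(1) S by blast
      then show "vle L (S + P) U" using S P(1) U(1) by (auto simp: op_le_iff le_diff add.commute)
    qed (use S P in auto)
    then show ?thesis by blast
  qed
  have glb: "\<exists>s. is_glb L {S, T} s" if S: "S \<in> opC" and T: "T \<in> opC" for S T
  proof -
    obtain s where "is_lub L {- S, - T} s" using lub[OF op_uminus_in[OF S] op_uminus_in[OF T]] by blast
    then have s: "s \<in> opC" "vle L (- S) s" "vle L (- T) s"
      "\<And>U. U \<in> opC \<Longrightarrow> vle L (- S) U \<Longrightarrow> vle L (- T) U \<Longrightarrow> vle L s U"
      by (simp_all add: is_lub_def)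
    note op_in[OF S, simp] op_in[OF T, simp] op_in[OF s(1), simp]
    have "is_glb L {S, T} (- s)"
      unfolding is_glb_def
    proof (intro conjI ballI impI)
      fix R assume "R \<in> {S, T}"
      then show "vle L (- s) R" using s(1-3) S T neg_le by (auto simp: op_le_iff)
    next
      fix U assume U: "U \<in> opC" "\<forall>R\<in>{S, T}. vle L U R"
      then have le: "vle L U S" "vle L U T" by auto
      note op_in[OF U(1), simp]
      from le have "vle L (- S) (- U)" "vle L (- T) (- U)" using S T U(1)
        by (auto simp: op_le_iff neg_le_neg)
      then have "vle L s (- U)" using s(4) U(1) by blast
      then show "vle L U (- s)" using s(1) U(1) le_neg by (auto simp: op_le_iff)
    qed (use s in auto)
    then show ?thesis by blast
  qed
  show ?thesis
    unfolding vector_lattice_def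
  proof (intro conjI ballI allI impI lub glb subspace_op)
    fix S T U assume S: "S \<in> opC" and T: "T \<in> opC" and U: "U \<in> opC"
    note op_in[OF S, simp] op_in[OF T, simp] op_in[OF U, simp]
    show "vle L S S" using S by (simp add: op_le_iff)
    show "S = T" if "vle L S T" "vle L T S"
      using that S T by (intro op_eqI le_antisym) (auto simp: op_le_iff)
    show "vle L S U" if "vle L S T" "vle L T U"
      using that S T U le_trans[of "S _" "T _" "U _"] by (auto simp: op_le_iff)
    show "vle L (S + U) (T + U)" if "vle L S T" using that S T U by (auto simp: op_le_iff add_right_mono)
  next
    fix T :: "'a \<Rightarrow> 'a" and c :: real assume T: "T \<in> opC" and c: "0 \<le> c" and "vle L 0 T"
    then show "vle L 0 (c *\<^sub>R T)" using op_in[OF T] by (simp add: op_pos_iff scale_nonneg)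
  qed
qed

lemma archimedean_L: "archimedean L"
  unfolding archimedean_def
proof (intro ballI impI)
  fix S T assume S: "S \<in> opC" and T: "T \<in> opC" and le: "\<forall>n. vle L (real n *\<^sub>R S) T"
  note op_in[OF S, simp] op_in[OF T, simp]
  have "S x \<preceq> 0" if x: "x \<in> C" "0 \<preceq> x" for x
  proof -
    have "(real n *\<^sub>R S) x \<preceq> T x" for n
      using le op_le_iff[OF op_scaleR_in[OF S, of "real n"] T] x by blast
    then have "\<forall>n. real n *\<^sub>R S x \<preceq> T x" by simp
    then show ?thesis using arch[unfolded archimedean_def, rule_format, of "S x" "T x"] x by simp
  qed
  then show "vle L S 0" using S by (simp add: op_le_iff)
qed

lemma vlat_L: "vlat L"
  by unfold_locales (rule vector_lattice_L)

lemmas L_down_to_0_nonneg = vlat.down_to_0_nonneg[OF vlat_L]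
lemmas L_abs_in [simp, intro] = vlat.abs_in[OF vlat_L]
lemmas L_abs_ge = vlat.abs_ge[OF vlat_L]
lemmas L_abs_ge_minus = vlat.abs_ge_minus[OF vlat_L]
lemmas L_abs_least = vlat.abs_least[OF vlat_L]
lemmas L_abs_of_nonneg = vlat.abs_of_nonneg[OF vlat_L]
lemmas L_le_refl = vlat.le_refl[OF vlat_L]
lemmas L_le_trans = vlat.le_trans[OF vlat_L]

text \<open>The pointwise infimum \<open>f\<close> of the set is additive on the positive cone: given \<open>S\<close> and \<open>T\<close> in it, a common
  lower bound \<open>R\<close> in it gives \<open>f (x + y) \<le> R x + R y \<le> T x + S y\<close>.  So \<open>f\<close> extends to an operator below
  the whole set, which must be \<open>\<le> 0\<close>.\<close>

lemma down_to_0_pointwise: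
  assumes Y: "down_to_0 L Y" and x: "x \<in> C" "0 \<preceq> x"
  shows "down_to_0 G ((\<lambda>T. T x) ` Y)"
proof -
  have Y_op: "T \<in> opC" "vle L 0 T" if "T \<in> Y" for T using L_down_to_0_nonneg[OF Y that] by auto
  have Y_in [simp]: "T x \<in> C" if "T \<in> Y" "x \<in> C" for T x using op_in Y_op(1) that by blast
  have Y_dir: "\<exists>R\<in>Y. vle L R S \<and> vle L R T" if "S \<in> Y" "T \<in> Y" for S T
    using Y that by (simp add: down_to_0_def)
  have pos: "0 \<preceq> T x" if "T \<in> Y" "x \<in> C" "0 \<preceq> x" for T x
    using Y_op[OF that(1)] that by (simp add: op_pos_iff)
  obtain T0 where T0: "T0 \<in> Y" using Y by (auto simp: down_to_0_def)
  have "\<exists>s. is_glb G ((\<lambda>T. T x) ` Y) s" if "x \<in> C" "0 \<preceq> x" for x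
    using that T0 Y_op pos by (intro ex_glb[of _ 0]) auto
  then obtain f where f: "\<And>x. x \<in> C \<Longrightarrow> 0 \<preceq> x \<Longrightarrow> is_glb G ((\<lambda>T. T x) ` Y) (f x)" by metis
  have fC: "f x \<in> C" if "x \<in> C" "0 \<preceq> x" for x using f[OF that] by (simp add: is_glb_def)
  have f_lb: "f x \<preceq> T x" if "x \<in> C" "0 \<preceq> x" "T \<in> Y" for x T
    using f[OF that(1,2)] that by (auto simp: is_glb_def)
  have f_greatest: "u \<preceq> f x" if "x \<in> C" "0 \<preceq> x" "u \<in> C" "\<And>T. T \<in> Y \<Longrightarrow> u \<preceq> T x" for x u
    using f[OF that(1,2)] that by (auto simp: is_glb_def)
  have "\<exists>P\<in>opC. \<forall>x\<in>C. 0 \<preceq> x \<longrightarrow> P x = f x"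
  proof (rule extend_positive_cone)
    fix x y assume x: "x \<in> C" "0 \<preceq> x" and y: "y \<in> C" "0 \<preceq> y"
    have xy: "x + y \<in> C" "0 \<preceq> x + y" using x y by (auto intro: add_nonneg)
    show "f (x + y) = f x + f y"
    proof (rule le_antisym)
      show "f x + f y \<preceq> f (x + y)"
      proof (rule f_greatest[OF xy])
        fix T assume T: "T \<in> Y"
        show "f x + f y \<preceq> T (x + y)"
          using f_lb[OF x T] f_lb[OF y T] fC[OF x] fC[OF y] Y_op[OF T] T x y by (simp add: op_add add_mono)
      qed (use fC x y in auto)
      have "f (x + y) - f x \<preceq> S y" if S: "S \<in> Y" for S
      proof -
        have "f (x + y) - S y \<preceq> f x"
        proof (rule f_greatest[OF x])
          fix T assume T: "T \<in> Y"
          obtain R where R: "R \<in> Y" "vle L R S" "vle L R T" using Y_dir[OF S T] by blast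
          note op = Y_op(1)[OF S] Y_op(1)[OF T] Y_op(1)[OF R(1)]
          have "f (x + y) \<preceq> R x + R y" using f_lb[OF xy R(1)] op x y by (simp add: op_add)
          moreover have "R x + R y \<preceq> T x + S y" using R S T op x y by (intro add_mono) (auto simp: op_le_iff)
          ultimately have "f (x + y) \<preceq> T x + S y" using fC[OF xy] S T R(1) x y le_trans[of "f (x + y)" "R x + R y" "T x + S y"] by simp
          then show "f (x + y) - S y \<preceq> T x" using fC[OF xy] S T x y by (simp add: diff_le)
        qed (use fC[OF xy] S y in auto)
        then show ?thesis using fC[OF xy] fC[OF x] S y by (simp add: diff_le add.commute)
      qed
      then have "f (x + y) - f x \<preceq> f y" using fC[OF xy] fC[OF x] by (intro f_greatest[OF y]) auto
      then show "f (x + y) \<preceq> f x + f y" using fC[OF xy] fC[OF x] fC[OF y] by (simp add: diff_le add.commute)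
    qed (use fC x y xy in auto)
  next
    fix x :: 'a and c :: real assume x: "x \<in> C" "0 \<preceq> x" and c: "0 < c"
    have cx: "c *\<^sub>R x \<in> C" "0 \<preceq> c *\<^sub>R x" using x c by (auto intro: scale_nonneg)
    show "c *\<^sub>R f x \<preceq> f (c *\<^sub>R x)"
    proof (rule f_greatest[OF cx])
      fix T assume T: "T \<in> Y"
      show "c *\<^sub>R f x \<preceq> T (c *\<^sub>R x)"
        using scale_mono[OF f_lb[OF x T], of c] fC[OF x] Y_op[OF T] T x c by (simp add: op_scale)
    qed (use fC[OF x] in auto)
  next
    fix x assume x: "x \<in> C" "0 \<preceq> x"
    show "0 \<preceq> f x" by (rule f_greatest[OF x]) (use pos x in auto)
  qed (rule fC)
  then obtain P where P: "P \<in> opC" "\<And>x. x \<in> C \<Longrightarrow> 0 \<preceq> x \<Longrightarrow> P x = f x" by blast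
  note op_in[OF P(1), simp]
  have "vle L P T" if "T \<in> Y" for T using P Y_op[OF that] f_lb that by (auto simp: op_le_iff)
  then have "vle L P 0" using Y P(1) by (auto simp: down_to_0_def is_glb_def)
  then have "f x \<preceq> 0" using P x by (auto simp: op_le_iff)
  moreover have "0 \<preceq> f x" by (rule f_greatest[OF x]) (use pos x in auto)
  ultimately have "f x = 0" using fC[OF x] by (intro le_antisym) auto
  then have glb: "is_glb G ((\<lambda>T. T x) ` Y) 0" using f[OF x] by simp
  have "\<exists>w\<in>(\<lambda>T. T x) ` Y. w \<preceq> S x \<and> w \<preceq> T x" if "S \<in> Y" "T \<in> Y" for S T
  proof -
    obtain R where R: "R \<in> Y" "vle L R S" "vle L R T" using Y_dir[OF \<open>S \<in> Y\<close> \<open>T \<in> Y\<close>] by blast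
    then have "R x \<preceq> S x" "R x \<preceq> T x" using Y_op(1) \<open>S \<in> Y\<close> \<open>T \<in> Y\<close> x by (auto simp: op_le_iff)
    then show ?thesis using R(1) by blast
  qed
  then show ?thesis using glb T0 Y_op(1) x by (auto simp: down_to_0_def)
qed

lemma op_abs_bound:
  assumes T: "T \<in> opC" and x: "x \<in> C"
  shows "\<bar>T x\<bar>\<^sub>G \<preceq> (vabs L T) \<bar>x\<bar>\<^sub>G"
proof -
  let ?p = "(1/2) *\<^sub>R (\<bar>x\<bar>\<^sub>G + x)" and ?q = "(1/2) *\<^sub>R (\<bar>x\<bar>\<^sub>G - x)" and ?A = "vabs L T"
  have A: "?A \<in> opC" "vle L T ?A" "vle L (- T) ?A" using T by (auto simp: L_abs_ge L_abs_ge_minus)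
  note op_in[OF T, simp] op_in[OF A(1), simp]
  have pq: "?p \<in> C" "?q \<in> C" "0 \<preceq> ?p" "0 \<preceq> ?q" using x half_parts[OF x] by auto
  have le: "T z \<preceq> ?A z" "- T z \<preceq> ?A z" if "z \<in> C" "0 \<preceq> z" for z
    using A T that by (auto simp: op_le_iff)
  have Tx: "T x = T ?p - T ?q"
    unfolding op_diff[OF T pq(1,2), symmetric] half_parts(3)[OF x, symmetric] ..
  have Ax: "?A \<bar>x\<bar>\<^sub>G = ?A ?p + ?A ?q"
    unfolding op_add[OF A(1) pq(1,2), symmetric] half_parts(4)[OF x, symmetric] ..
  have "T ?p + - T ?q \<preceq> ?A ?p + ?A ?q" "- T ?p + T ?q \<preceq> ?A ?p + ?A ?q"
    using A(1) T pq by (intro add_mono le; simp)+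
  then show ?thesis
    using A(1) T pq x unfolding Ax Tx by (intro abs_least) auto
qed

section \<open>The Hausdorff uo-Lebesgue topology on the operators\<close>

text \<open>Smallness of a positive operator means that its value at a fixed \<open>x \<ge> 0\<close> lies in a solid neighbourhood
  of \<open>0\<close> in \<open>G\<close>.  Order continuity of this family is \<open>down_to_0_pointwise\<close> followed by the uo-Lebesgue
  property of \<open>\<tau>\<close>.\<close>

lemma Hausdorff_uo_Lebesgue_L:
  assumes "Hausdorff_uo_Lebesgue G \<tau>"
  shows "\<exists>\<sigma>. Hausdorff_uo_Lebesgue L \<sigma>"
proof -
  have uo: "uo_Lebesgue G \<tau>" and H: "Hausdorff_space \<tau>" using assms by (auto simp: Hausdorff_uo_Lebesgue_def)
  have lin: "linear_topology G \<tau>" and ls: "locally_solid G \<tau>" using uo by (auto simp: uo_Lebesgue_def)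
  have top: "topspace \<tau> = C" using lin by (simp add: linear_topology_def)
  define nb where "nb S \<longleftrightarrow> solid G S \<and> (\<exists>V. openin \<tau> V \<and> 0 \<in> V \<and> V \<subseteq> S)" for S
  have nb_ex: "\<exists>S. nb S \<and> S \<subseteq> U" if "openin \<tau> U" "0 \<in> U" for U
    using ls that unfolding locally_solid_def nb_def by blast
  have nb_Int: "nb (S \<inter> S')" if S: "nb S" "nb S'" for S S'
  proof -
    obtain V V' where "openin \<tau> V" "0 \<in> V" "V \<subseteq> S" "openin \<tau> V'" "0 \<in> V'" "V' \<subseteq> S'"
      using S by (auto simp: nb_def)
    then have "openin \<tau> (V \<inter> V') \<and> 0 \<in> V \<inter> V' \<and> V \<inter> V' \<subseteq> S \<inter> S'" by auto
    moreover have "solid G (S \<inter> S')" using S unfolding nb_def solid_def by blast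
    ultimately show ?thesis unfolding nb_def by blast
  qed
  have nb_add: "\<exists>S'. nb S' \<and> (\<forall>x\<in>S'. \<forall>y\<in>S'. x + y \<in> S)" if S: "nb S" for S
  proof -
    obtain V where V: "openin \<tau> V" "0 \<in> V" "V \<subseteq> S" using S by (auto simp: nb_def)
    let ?Q = "{p \<in> topspace (prod_topology \<tau> \<tau>). (case p of (x, y) \<Rightarrow> x + y) \<in> V}"
    have "openin (prod_topology \<tau> \<tau>) ?Q"
      using lin V(1) by (auto simp: linear_topology_def continuous_map_def)
    moreover have "(0, 0) \<in> ?Q"
      using V(2) top by auto
    ultimately obtain A B where AB: "openin \<tau> A" "openin \<tau> B" "0 \<in> A" "0 \<in> B"
      "A \<times> B \<subseteq> ?Q"
      unfolding openin_prod_topology_alt by meson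
    then obtain S' where S': "nb S'" "S' \<subseteq> A \<inter> B" using nb_ex[of "A \<inter> B"] by auto
    have "x + y \<in> S" if "x \<in> S'" "y \<in> S'" for x y
    proof -
      have "(x, y) \<in> A \<times> B" using S' that by auto
      then show ?thesis using AB(5) V(3) by auto
    qed
    then show ?thesis using S' by blast
  qed
  have nb_absorb: "\<exists>e>0. e *\<^sub>R x \<in> S" if S: "nb S" and x: "x \<in> C" for S x
  proof -
    obtain V where V: "openin \<tau> V" "0 \<in> V" "V \<subseteq> S" using S by (auto simp: nb_def)
    let ?Q = "{p \<in> topspace (prod_topology euclideanreal \<tau>). (case p of (c, x) \<Rightarrow> c *\<^sub>R x) \<in> V}"
    have "openin (prod_topology euclideanreal \<tau>) ?Q"
      using lin V(1) by (auto simp: linear_topology_def continuous_map_def)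
    moreover have "(0, x) \<in> ?Q"
      using V(2) top x by auto
    ultimately obtain A B where AB: "openin euclideanreal A" "openin \<tau> B" "0 \<in> A" "x \<in> B"
      "A \<times> B \<subseteq> ?Q"
      unfolding openin_prod_topology_alt by meson
    then obtain e where e: "e > 0" "ball 0 e \<subseteq> A" using open_contains_ball[of A] by auto
    have "e / 2 \<in> A" using e by (intro subsetD[OF e(2)]) auto
    then have "(e / 2, x) \<in> A \<times> B" using AB by auto
    then have "(e / 2) *\<^sub>R x \<in> S" using AB(5) V(3) by auto
    then show ?thesis using e(1) by (intro exI[of _ "e / 2"]) auto
  qed
  define N where "N S x = {T \<in> opC. vle L 0 T \<and> T x \<in> S}" for S x
  define \<W> where "\<W> = {N S x | S x. nb S \<and> x \<in> C \<and> 0 \<preceq> x}"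
  have WE: "\<exists>S x. W = N S x \<and> nb S \<and> x \<in> C \<and> 0 \<preceq> x" if "W \<in> \<W>" for W using that by (auto simp: \<W>_def)
  have WI: "N S x \<in> \<W>" if "nb S" "x \<in> C" "0 \<preceq> x" for S x using that by (auto simp: \<W>_def)
  have nb_solid: "y \<in> S" if "nb S" "z \<in> S" "0 \<preceq> y" "y \<preceq> z" "y \<in> C" for y z S
  proof -
    have sol: "\<And>x y. x \<in> C \<Longrightarrow> y \<in> S \<Longrightarrow> \<bar>x\<bar>\<^sub>G \<preceq> \<bar>y\<bar>\<^sub>G \<Longrightarrow> x \<in> S" and "S \<subseteq> C"
      using that(1) unfolding nb_def solid_def by auto
    then have "z \<in> C" "0 \<preceq> z" using that le_trans[of 0 y z] by auto
    then show ?thesis using sol[OF that(5,2)] that by (simp add: abs_of_nonneg)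
  qed
  show ?thesis
  proof (rule vlat.unbounded_topology[OF vlat_L, of \<W>])
    obtain S where "nb S" using nb_ex[of "topspace \<tau>"] top zero_in openin_topspace[of \<tau>] by metis
    then show "\<W> \<noteq> {}" using WI[of S 0] by auto
  next
    fix W T assume "W \<in> \<W>" "T \<in> W"
    then show "T \<in> opC \<and> vle L 0 T" using WE by (auto simp: N_def)
  next
    fix W S T assume W: "W \<in> \<W>" and T: "T \<in> W" and S: "S \<in> opC" "vle L 0 S" "vle L S T"
    obtain A x where A: "W = N A x" "nb A" "x \<in> C" "0 \<preceq> x" using WE[OF W] by blast
    have T': "T \<in> opC" "T x \<in> A" using T A by (auto simp: N_def)
    have "S x \<in> A"
      using S op_le_iff[OF S(1) T'(1)] A(3,4) op_in[OF S(1) A(3)]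
      by (intro nb_solid[OF A(2) T'(2)]) (auto simp: op_pos_iff)
    then show "S \<in> W" using A S by (simp add: N_def)
  next
    fix V W assume V: "V \<in> \<W>" and W: "W \<in> \<W>"
    obtain A x where A: "V = N A x" "nb A" "x \<in> C" "0 \<preceq> x" using WE[OF V] by blast
    obtain B y where B: "W = N B y" "nb B" "y \<in> C" "0 \<preceq> y" using WE[OF W] by blast
    have "T \<in> V \<inter> W" if "T \<in> N (A \<inter> B) (x + y)" for T
    proof -
      have T: "T \<in> opC" "vle L 0 T" "T x + T y \<in> A" "T x + T y \<in> B" using that A B by (auto simp: N_def op_add)
      note op_in[OF T(1), simp]
      have p: "0 \<preceq> T x" "0 \<preceq> T y" using T A B by (auto simp: op_pos_iff)
      have "T x \<in> A"
        using add_mono[of "T x" "T x" 0 "T y"] p T A B by (intro nb_solid[OF A(2) T(3)]) auto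
      moreover have "T y \<in> B"
        using add_mono[of 0 "T x" "T y" "T y"] p T A B by (intro nb_solid[OF B(2) T(4)]) auto
      ultimately show ?thesis using T A B by (simp add: N_def)
    qed
    then show "\<exists>Z\<in>\<W>. Z \<subseteq> V \<inter> W" using WI[OF nb_Int[OF A(2) B(2)], of "x + y"] A B add_nonneg[of x y] by blast
  next
    fix W assume W: "W \<in> \<W>"
    obtain A x where A: "W = N A x" "nb A" "x \<in> C" "0 \<preceq> x" using WE[OF W] by blast
    obtain B where B: "nb B" "\<forall>x\<in>B. \<forall>y\<in>B. x + y \<in> A" using nb_add[OF A(2)] by blast
    then show "\<exists>V\<in>\<W>. \<forall>x\<in>V. \<forall>y\<in>V. x + y \<in> W"
      using WI[OF B(1) A(3,4)] A by (intro bexI[of _ "N B x"]) (auto simp: N_def op_pos_iff op_in intro!: add_nonneg)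
  next
    fix W T assume W: "W \<in> \<W>" and T: "T \<in> opC" "vle L 0 T"
    obtain A x where A: "W = N A x" "nb A" "x \<in> C" "0 \<preceq> x" using WE[OF W] by blast
    obtain e where e: "e > 0" "e *\<^sub>R T x \<in> A" using nb_absorb[OF A(2) op_in[OF T(1) A(3)]] by blast
    then have "e *\<^sub>R T \<in> W"
      using A T op_in[OF T(1)] by (simp add: N_def op_pos_iff scale_nonneg)
    then show "\<exists>e>0. e *\<^sub>R T \<in> W" using e(1) by blast
  next
    fix T assume T: "T \<in> opC" "vle L 0 T" "T \<noteq> 0"
    obtain x where x: "x \<in> C" "0 \<preceq> x" "T x \<noteq> 0" using op_eqI[OF T(1) op_0_in] T(3) by auto
    obtain U V where "openin \<tau> U" "0 \<in> U" "T x \<in> V" "disjnt U V"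
      using H x T(1) top unfolding Hausdorff_space_def by (metis op_in zero_in)
    then obtain A where A: "nb A" "T x \<notin> A" using nb_ex[of U] by (auto simp: disjnt_def)
    then show "\<exists>W\<in>\<W>. T \<notin> W" using WI[OF A(1) x(1,2)] by (intro bexI[of _ "N A x"]) (simp_all add: N_def)
  next
    fix W Y assume W: "W \<in> \<W>" and Y: "down_to_0 L Y"
    obtain A x where A: "W = N A x" "nb A" "x \<in> C" "0 \<preceq> x" using WE[OF W] by blast
    obtain V where V: "openin \<tau> V" "0 \<in> V" "V \<subseteq> A" using A(2) by (auto simp: nb_def)
    define r where "r = {(S, T). S \<in> Y \<and> T \<in> Y \<and> vle L T S}"
    have Y_op: "T \<in> opC" "vle L 0 T" if "T \<in> Y" for T using L_down_to_0_nonneg[OF Y that] by auto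
    have Y_in [simp]: "T x \<in> C" if "T \<in> Y" "x \<in> C" for T x using op_in Y_op(1) that by blast
    have F: "Field r = Y" using Y_op L_le_refl by (auto simp: Field_def r_def)
    have "preorder_on Y r"
      using Y_op(1) L_le_refl unfolding preorder_on_def refl_on_def trans_def r_def
      by (auto intro: L_le_trans)
    then have r: "directed r" using Y unfolding directed_def F by (fastforce simp: down_to_0_def r_def)
    have Yx: "down_to_0 G ((\<lambda>T. T x) ` Y)" using down_to_0_pointwise[OF Y A(3,4)] .
    have o: "o_conv G r (\<lambda>T. T x) 0"
    proof (rule o_convI_set[OF Yx])
      fix y assume "y \<in> (\<lambda>T. T x) ` Y"
      then obtain S where S: "S \<in> Y" "y = S x" by blast
      have "\<bar>0 - T x\<bar>\<^sub>G \<preceq> y" if "(S, T) \<in> r" for T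
        using that S Y_op A(3,4) by (auto simp: r_def op_le_iff abs_of_nonneg op_pos_iff)
      then show "\<exists>S\<in>Field r. \<forall>T. (S, T) \<in> r \<longrightarrow> \<bar>0 - T x\<bar>\<^sub>G \<preceq> y" using S F by blast
    qed
    have Tx: "T x \<in> C" if "T \<in> Field r" for T using that F Y_op A(3) by auto
    have "uo_conv G r (\<lambda>T. T x) 0"
      by (rule o_conv_imp_uo_conv[OF o]) (use Tx in auto)
    then have "limitin \<tau> (\<lambda>T. T x) 0 (net_filter r)"
      by (intro uo_Lebesgue_net[OF uo r]) (use Tx in auto)
    then have "eventually (\<lambda>T. T x \<in> V) (net_filter r)" using V by (auto simp: limitin_def)
    then obtain T where "T \<in> Y" "T x \<in> V"
      unfolding eventually_net_filter[OF r] F using Y_op L_le_refl by (fastforce simp: r_def)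
    then show "\<exists>T\<in>Y. T \<in> W" using A V Y_op by (auto simp: N_def)
  qed
qed

end

section \<open>The valid implications\<close>

context dc_vlat begin

lemma o_conv_imp_pointwise:
  assumes o: "o_conv L r T S" and T: "\<And>a. a \<in> Field r \<Longrightarrow> T a \<in> opC" and S: "S \<in> opC" and x: "x \<in> C"
  shows "o_conv G r (\<lambda>a. T a x) (S x)"
proof -
  obtain Y where Y: "down_to_0 L Y"
    "\<forall>R\<in>Y. \<exists>a\<in>Field r. \<forall>a'. (a, a') \<in> r \<longrightarrow> vle L (vabs L (S - T a')) R"
    using vlat.o_convE_set[OF vlat_L o] by blast
  have ax: "\<bar>x\<bar>\<^sub>G \<in> C" "0 \<preceq> \<bar>x\<bar>\<^sub>G" using x by auto
  show ?thesis
  proof (rule o_convI_set[OF down_to_0_pointwise[OF Y(1) ax]])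
    fix y assume "y \<in> (\<lambda>R. R \<bar>x\<bar>\<^sub>G) ` Y"
    then obtain R where R: "R \<in> Y" "y = R \<bar>x\<bar>\<^sub>G" by blast
    have R_op: "R \<in> opC" using L_down_to_0_nonneg[OF Y(1) R(1)] by simp
    obtain a where a: "a \<in> Field r" "\<forall>a'. (a, a') \<in> r \<longrightarrow> vle L (vabs L (S - T a')) R"
      using Y(2) R(1) by blast
    have "\<bar>S x - T a' x\<bar>\<^sub>G \<preceq> y" if aa: "(a, a') \<in> r" for a'
    proof -
      have D: "S - T a' \<in> opC" using S T[OF FieldI2[OF aa]] by (rule op_minus_in)
      have A: "vabs L (S - T a') \<in> opC" using D by (rule L_abs_in)
      have "\<bar>(S - T a') x\<bar>\<^sub>G \<preceq> vabs L (S - T a') \<bar>x\<bar>\<^sub>G" using op_abs_bound[OF D x] .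
      moreover have "vabs L (S - T a') \<bar>x\<bar>\<^sub>G \<preceq> R \<bar>x\<bar>\<^sub>G"
        using a(2) aa op_le_iff[OF A R_op] ax by blast
      ultimately have "\<bar>(S - T a') x\<bar>\<^sub>G \<preceq> R \<bar>x\<bar>\<^sub>G"
        using op_in[OF D x] op_in[OF A ax(1)] op_in[OF R_op ax(1)] by (auto elim: le_trans)
      then show ?thesis using R(2) by simp
    qed
    then show "\<exists>a\<in>Field r. \<forall>a'. (a, a') \<in> r \<longrightarrow> \<bar>S x - T a' x\<bar>\<^sub>G \<preceq> y" using a(1) by blast
  qed
qed

lemma valid_converges:
  assumes r: "directed r" and T: "\<And>a. a \<in> Field r \<Longrightarrow> T a \<in> opC" and S: "S \<in> opC"
  shows "converges Mode_o G r T S \<Longrightarrow> converges Mode_uo G r T S"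
    and "converges Mode_o G r T S \<Longrightarrow> converges Mode_SO G r T S"
    and "converges Mode_SO G r T S \<Longrightarrow> converges Mode_SUO G r T S"
    and "\<exists>\<tau>. Hausdorff_uo_Lebesgue G \<tau> \<Longrightarrow> converges Mode_uo G r T S \<Longrightarrow> converges Mode_tau G r T S"
    and "\<exists>\<tau>. Hausdorff_uo_Lebesgue G \<tau> \<Longrightarrow> converges Mode_SUO G r T S \<Longrightarrow> converges Mode_Stau G r T S"
proof -
  show "converges Mode_uo G r T S" if "converges Mode_o G r T S"
    using vlat.o_conv_imp_uo_conv[OF vlat_L, of r T S] that T S by simp
  show "converges Mode_SO G r T S" if "converges Mode_o G r T S"
    using o_conv_imp_pointwise[of r T S] that T S by simp
  show "converges Mode_SUO G r T S" if SO: "converges Mode_SO G r T S"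
    unfolding converges.simps
  proof
    fix x assume x: "x \<in> C"
    show "uo_conv G r (\<lambda>a. T a x) (S x)"
      using SO x op_in[OF S x] op_in[OF T x] by (intro o_conv_imp_uo_conv) auto
  qed
  assume "\<exists>\<tau>. Hausdorff_uo_Lebesgue G \<tau>"
  then have tau: "uo_Lebesgue G (tau_hat G)" "uo_Lebesgue L (tau_hat L)"
    using Hausdorff_uo_Lebesgue_L tau_hat_Hausdorff_uo_Lebesgue unfolding Hausdorff_uo_Lebesgue_def by blast+
  show "converges Mode_tau G r T S" if "converges Mode_uo G r T S"
    using vlat.uo_conv_imp_limitin[OF vlat_L tau(2) r T S] that by (simp add: tau_conv_def)
  show "converges Mode_Stau G r T S" if SUO: "converges Mode_SUO G r T S"
    unfolding converges.simps tau_conv_def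
  proof
    fix x assume x: "x \<in> C"
    show "limitin (tau_hat G) (\<lambda>a. T a x) (S x) (net_filter r)"
      using SUO x op_in[OF S x] op_in[OF T x] by (intro uo_conv_imp_limitin[OF tau(1) r]) auto
  qed
qed

end

lemma dc_vlatI: "dedekind_complete E \<Longrightarrow> dc_vlat E"
  by unfold_locales (auto simp: dedekind_complete_def)

lemma valid_implies:
  assumes "(c1, c2) \<in> valid_pairs"
  shows "implies_mode TYPE('a::real_vector) TYPE('i) c1 c2"
  unfolding implies_mode_def
proof (intro allI impI, elim conjE)
  fix E :: "'a vlat" and r :: "'i rel" and T S
  assume dc: "dedekind_complete E" and r: "directed r" and T: "\<forall>a\<in>Field r. T a \<in> vcarrier (L_ob E)"
    and S: "S \<in> vcarrier (L_ob E)" and c1: "converges c1 E r T S"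
    and tau: "{c1, c2} \<inter> {Mode_tau, Mode_Stau} \<noteq> {} \<longrightarrow> (\<exists>\<tau>. Hausdorff_uo_Lebesgue E \<tau>)"
  note imps = dc_vlat.valid_converges[OF dc_vlatI[OF dc] r bspec[OF T] S]
  show "converges c2 E r T S"
    using assms c1 tau imps unfolding valid_pairs_def by (cases c1; cases c2) (simp_all del: converges.simps)
qed

section \<open>Bounded harmonic functions on the binary tree\<close>

text \<open>Nodes are the positive integers, numbered as in a heap: the children of \<open>k\<close> are \<open>2 k\<close> and \<open>2 k + 1\<close>.  They are
  embedded in \<open>real\<close> since the ambient type is \<open>real \<Rightarrow> real\<close>; functions vanish off the nodes, which makes \<open>harmonic\<close>
  a space of functions on the tree.\<close>

definition nodes :: "real set" where
  "nodes = real ` {1..}"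

definition mean :: "(real \<Rightarrow> real) \<Rightarrow> real \<Rightarrow> real" where
  "mean g x = (if x \<in> nodes then g (2 * x) / 2 + g (2 * x + 1) / 2 else 0)"

definition harmonic :: "(real \<Rightarrow> real) set" where
  "harmonic = {m. mean m = m \<and> (\<exists>K. \<forall>x. \<bar>m x\<bar> \<le> K)}"

definition harmonic_lattice :: "(real \<Rightarrow> real) vlat" where
  "harmonic_lattice = \<lparr>vcarrier = harmonic, vle = (\<le>)\<rparr>"

lemma vcarrier_harmonic [simp]: "vcarrier harmonic_lattice = harmonic"
  and vle_harmonic [simp]: "vle harmonic_lattice = (\<le>)"
  by (simp_all add: harmonic_lattice_def)

abbreviation HL where "HL \<equiv> harmonic_lattice"

lemma nodes_children: "x \<in> nodes \<Longrightarrow> 2 * x \<in> nodes" "x \<in> nodes \<Longrightarrow> 2 * x + 1 \<in> nodes"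
proof -
  assume "x \<in> nodes"
  then obtain k :: nat where "k \<ge> 1" "x = real k" by (auto simp: nodes_def)
  then have "2 * x = real (2 * k)" "2 * x + 1 = real (2 * k + 1)" "2 * k \<in> {1..}" "2 * k + 1 \<in> {1..}" by auto
  then show "2 * x \<in> nodes" "2 * x + 1 \<in> nodes" unfolding nodes_def by blast+
qed

lemma real_in_nodes [simp]: "real k \<in> nodes \<longleftrightarrow> k \<ge> 1"
  by (auto simp: nodes_def)

lemma one_in_nodes [simp]: "1 \<in> nodes"
  using real_in_nodes[of 1] by simp

lemma mean_mono: "f \<le> g \<Longrightarrow> mean f \<le> mean g"
  by (auto simp: mean_def le_fun_def intro!: divide_right_mono add_mono)

lemma mean_add: "mean (f + g) = mean f + mean g"
  and mean_scale: "mean (c *\<^sub>R f) = c *\<^sub>R mean f"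
  and mean_zero: "mean 0 = 0"
  by (auto simp: mean_def fun_eq_iff field_simps)

lemma mean_bound:
  assumes "\<And>x. \<bar>f x\<bar> \<le> K"
  shows "\<bar>mean f x\<bar> \<le> K"
proof -
  have "\<bar>f (2 * x)\<bar> \<le> K" "\<bar>f (2 * x + 1)\<bar> \<le> K" using assms by blast+
  then have "\<bar>f (2 * x) / 2 + f (2 * x + 1) / 2\<bar> \<le> K" "0 \<le> K" by linarith+
  then show ?thesis by (simp add: mean_def)
qed

lemma harmonic_mean: "m \<in> harmonic \<Longrightarrow> mean m = m"
  by (simp add: harmonic_def)

lemma harmonic_bounded: "m \<in> harmonic \<Longrightarrow> \<exists>K. \<forall>x. \<bar>m x\<bar> \<le> K"
  by (simp add: harmonic_def)

lemma harmonic_outside: "m \<in> harmonic \<Longrightarrow> x \<notin> nodes \<Longrightarrow> m x = 0"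
  using fun_cong[OF harmonic_mean, of m x] by (simp add: mean_def)

lemma subspace_harmonic: "subspace harmonic"
proof (rule subspaceI)
  show "0 \<in> harmonic" by (auto simp: harmonic_def mean_zero)
  show "f + g \<in> harmonic" if f: "f \<in> harmonic" and g: "g \<in> harmonic" for f g
  proof -
    obtain K K' where "\<And>x. \<bar>f x\<bar> \<le> K" "\<And>x. \<bar>g x\<bar> \<le> K'" 
      using harmonic_bounded[OF f] harmonic_bounded[OF g] by blast
    then have "\<bar>(f + g) x\<bar> \<le> K + K'" for x
      unfolding plus_fun_apply by (meson abs_triangle_ineq add_mono order_trans)
    then show ?thesis using f g by (auto simp: harmonic_def mean_add)
  qed
  show "c *\<^sub>R f \<in> harmonic" if f: "f \<in> harmonic" for c f
  proof -
    obtain K where "\<And>x. \<bar>f x\<bar> \<le> K" using harmonic_bounded[OF f] by blast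
    then have "\<bar>(c *\<^sub>R f) x\<bar> \<le> \<bar>c\<bar> * K" for x by (simp add: abs_mult mult_left_mono)
    then show ?thesis using f by (auto simp: harmonic_def mean_scale)
  qed
qed

text \<open>The least harmonic majorant of a bounded subharmonic function is the increasing limit of its
  iterated means.  All suprema of the lattice and all projections onto subtrees come from it.\<close>

lemma harmonic_hull:
  assumes sub: "g \<le> mean g" and bd: "\<And>x. \<bar>g x\<bar> \<le> K"
  obtains h where "h \<in> harmonic" "g \<le> h" "\<And>f. mean f = f \<Longrightarrow> g \<le> f \<Longrightarrow> h \<le> f"
    "\<And>x. (\<lambda>n. (mean ^^ n) g x) \<longlonglongrightarrow> h x"
proof -
  define a where "a n = (mean ^^ n) g" for n
  have a_Suc: "a (Suc n) = mean (a n)" for n by (simp add: a_def)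
  have a_mono: "a n \<le> a (Suc n)" for n
  proof (induction n)
    case 0
    then show ?case using sub by (simp add: a_def)
  next
    case (Suc n)
    then show ?case unfolding a_Suc[of "Suc n"] a_Suc[of n] by (rule mean_mono)
  qed
  have a_bd: "\<bar>a n x\<bar> \<le> K" for n x
  proof (induction n arbitrary: x)
    case 0
    then show ?case using bd by (simp add: a_def)
  next
    case (Suc n)
    then show ?case unfolding a_Suc by (rule mean_bound)
  qed
  have inc: "incseq (\<lambda>n. a n x)" for x
    using a_mono by (auto simp: incseq_Suc_iff le_fun_def)
  have "\<exists>l. (\<lambda>n. a n x) \<longlonglongrightarrow> l" for x
  proof -
    have "\<forall>n. a n x \<le> K" using a_bd abs_le_D1 by blast
    then show ?thesis using incseq_convergent[OF inc[of x]] by metis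
  qed
  then obtain h where h: "\<And>x. (\<lambda>n. a n x) \<longlonglongrightarrow> h x" by metis
  have "mean h x = h x" for x
  proof (rule LIMSEQ_unique)
    show "(\<lambda>n. mean (a n) x) \<longlonglongrightarrow> mean h x"
      unfolding mean_def using h by (auto intro!: tendsto_intros)
    show "(\<lambda>n. mean (a n) x) \<longlonglongrightarrow> h x"
      using LIMSEQ_Suc[OF h[of x]] by (simp add: a_Suc)
  qed
  moreover have "\<bar>h x\<bar> \<le> K" for x
    using LIMSEQ_le_const2[OF tendsto_rabs[OF h[of x]], of K] a_bd by blast
  ultimately have 1: "h \<in> harmonic" by (auto simp: harmonic_def)
  have 2: "g \<le> h"
  proof (rule le_funI)
    show "g x \<le> h x" for x using incseq_le[OF inc[of x] h[of x], of 0] by (simp add: a_def)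
  qed
  have 3: "h \<le> f" if f: "mean f = f" "g \<le> f" for f
  proof -
    have "a n \<le> f" for n
    proof (induction n)
      case (Suc n)
      then show ?case using mean_mono[OF Suc] f(1) by (simp add: a_Suc)
    qed (use f in \<open>simp add: a_def\<close>)
    then have "h x \<le> f x" for x
      using LIMSEQ_le_const2[OF h[of x], of "f x"] by (simp add: le_fun_def)
    then show ?thesis by (simp add: le_fun_def)
  qed
  show ?thesis using that[OF 1 2 3 h[unfolded a_def]] .
qed

text \<open>The pointwise supremum is subharmonic, so its hull is the supremum.  It is least among all
  harmonic majorants, including unbounded ones; \<open>typewriter_subsequence\<close> compares it with such a series.\<close>

lemma harmonic_sup:
  assumes S: "S \<subseteq> harmonic" "S \<noteq> {}" and u: "u \<in> harmonic" "\<And>f. f \<in> S \<Longrightarrow> f \<le> u"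
  obtains s where "s \<in> harmonic" "\<And>f. f \<in> S \<Longrightarrow> f \<le> s"
    "\<And>v. mean v = v \<Longrightarrow> (\<And>f. f \<in> S \<Longrightarrow> f \<le> v) \<Longrightarrow> s \<le> v"
proof -
  define g where "g x = (SUP f\<in>S. f x)" for x
  obtain f0 where f0: "f0 \<in> S" using S by blast
  have bdd: "bdd_above ((\<lambda>f. f x) ` S)" for x using u(2) by (auto simp: bdd_above_def le_fun_def)
  have g_ub: "f x \<le> g x" if "f \<in> S" for f x
    unfolding g_def using bdd that by (rule cSUP_upper2) simp
  have g_least: "g x \<le> c" if "\<And>f. f \<in> S \<Longrightarrow> f x \<le> c" for x c
    unfolding g_def using S(2) that by (rule cSUP_least)
  have sub: "g \<le> mean g"
  proof (rule le_funI, rule g_least)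
    fix x f assume f: "f \<in> S"
    have "mean f x \<le> mean g x" using mean_mono[of f g] g_ub[OF f] by (simp add: le_fun_def)
    then show "f x \<le> mean g x" using harmonic_mean S f by fastforce
  qed
  obtain K K' where K: "\<And>x. \<bar>f0 x\<bar> \<le> K" "\<And>x. \<bar>u x\<bar> \<le> K'"
    using harmonic_bounded S f0 u(1) by (meson subsetD)
  have "\<bar>g x\<bar> \<le> max K K'" for x
  proof -
    have "g x \<le> u x" using u(2) by (intro g_least) (simp add: le_fun_def)
    then show ?thesis using g_ub[OF f0, of x] K(1)[of x] K(2)[of x] by linarith
  qed
  then obtain s where s: "s \<in> harmonic" "g \<le> s" "\<And>f. mean f = f \<Longrightarrow> g \<le> f \<Longrightarrow> s \<le> f"
    using harmonic_hull[OF sub] by metis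
  have "f \<le> s" if "f \<in> S" for f using g_ub[OF that] s(2) by (simp add: le_fun_def) (meson order_trans)
  moreover have "s \<le> v" if "mean v = v" "\<And>f. f \<in> S \<Longrightarrow> f \<le> v" for v
    using that g_least by (intro s(3)) (auto simp: le_fun_def)
  ultimately show ?thesis using that s(1) by blast
qed

lemma dedekind_complete_harmonic: "dedekind_complete HL"
proof -
  have lub: "\<exists>s. is_lub HL S s"
    if S: "S \<subseteq> harmonic" "S \<noteq> {}" and u: "u \<in> harmonic" "\<forall>f\<in>S. f \<le> u" for S u
  proof -
    obtain s where s: "s \<in> harmonic" "\<And>f. f \<in> S \<Longrightarrow> f \<le> s"
      "\<And>v. mean v = v \<Longrightarrow> (\<And>f. f \<in> S \<Longrightarrow> f \<le> v) \<Longrightarrow> s \<le> v"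
      using harmonic_sup[OF S u(1)] u(2) by metis
    have "is_lub HL S s"
      using s harmonic_mean by (auto simp: is_lub_def)
    then show ?thesis by blast
  qed
  have bound: "\<exists>u\<in>harmonic. f \<le> u \<and> g \<le> u" if f: "f \<in> harmonic" and g: "g \<in> harmonic" for f g
  proof -
    obtain K K' where K: "\<And>x. \<bar>f x\<bar> \<le> K" "\<And>x. \<bar>g x\<bar> \<le> K'"
      using harmonic_bounded[OF f] harmonic_bounded[OF g] by blast
    define u where "u x = (if x \<in> nodes then max K K' else 0)" for x
    have "mean u = u" using nodes_children by (auto simp: mean_def u_def fun_eq_iff)
    then have "u \<in> harmonic" by (auto simp: harmonic_def u_def intro!: exI[of _ "\<bar>max K K'\<bar>"])
    moreover have "f x \<le> u x \<and> g x \<le> u x" for x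
      using K(1)[of x] K(2)[of x] harmonic_outside[OF f, of x] harmonic_outside[OF g, of x] by (auto simp: u_def)
    ultimately show ?thesis by (auto simp: le_fun_def intro!: bexI[of _ u])
  qed
  have lub2: "\<exists>s. is_lub HL {f, g} s" if "f \<in> harmonic" "g \<in> harmonic" for f g
    using bound[OF that] lub[of "{f, g}"] that by auto
  have glb2: "\<exists>s. is_glb HL {f, g} s" if f: "f \<in> harmonic" and g: "g \<in> harmonic" for f g
  proof -
    obtain s where s: "is_lub HL {- f, - g} s"
      using lub2[OF subspace_neg[OF subspace_harmonic f] subspace_neg[OF subspace_harmonic g]] by blast
    have "is_glb HL {f, g} (- s)"
      unfolding is_glb_def
    proof (intro conjI ballI impI)
      show "- s \<in> vcarrier HL"
        using s subspace_neg[OF subspace_harmonic] by (auto simp: is_lub_def)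
    next
      fix a assume "a \<in> {f, g}"
      then have "- a \<le> s" using s by (auto simp: is_lub_def)
      then show "vle HL (- s) a" by (simp add: le_fun_def minus_le_iff)
    next
      fix a assume a: "a \<in> vcarrier HL" "\<forall>x\<in>{f, g}. vle HL a x"
      have "- f \<le> - a" "- g \<le> - a" using a(2) by (auto simp: le_fun_def)
      then have "s \<le> - a" using s a(1) subspace_neg[OF subspace_harmonic, of a] by (auto simp: is_lub_def)
      then show "vle HL a (- s)" by (simp add: le_fun_def le_minus_iff)
    qed
    then show ?thesis by blast
  qed
  have "vector_lattice HL"
    unfolding vector_lattice_def
    using subspace_harmonic lub2 glb2
    by (auto simp: le_fun_def fun_eq_iff intro: order_trans antisym)
  moreover have "archimedean HL"
    unfolding archimedean_def
  proof (intro ballI impI)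
    fix f g :: "real \<Rightarrow> real" assume le: "\<forall>n. vle HL (real n *\<^sub>R f) g"
    have "f x \<le> 0" for x
    proof (rule ccontr)
      assume "\<not> f x \<le> 0"
      then obtain n where "g x < real n * f x" using reals_Archimedean3[of "f x"] by auto
      moreover have "real n * f x \<le> g x" using le by (auto simp: le_fun_def)
      ultimately show False by simp
    qed
    then show "vle HL f 0" by (simp add: le_fun_def)
  qed
  ultimately show ?thesis
    unfolding dedekind_complete_def using lub by auto
qed

lemmas dc_HL = dc_vlatI[OF dedekind_complete_harmonic]
lemmas vlat_HL = dc_vlat.axioms(1)[OF dc_HL]

lemma abs_uminus_harmonic: "f \<in> harmonic \<Longrightarrow> 0 \<le> f \<Longrightarrow> vabs HL (- f) = f"
  using vlat.abs_minus[OF vlat_HL, of f] vlat.abs_of_nonneg[OF vlat_HL, of f] by simp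

lemma harmonic_step: "m \<in> harmonic \<Longrightarrow> k \<ge> 1 \<Longrightarrow> m (real k) = m (real (2 * k)) / 2 + m (real (2 * k + 1)) / 2"
  using fun_cong[OF harmonic_mean, of m "real k"] by (simp add: mean_def algebra_simps)

text \<open>A nonnegative value at a child is at most twice the value at its parent.  Hence evaluation at the root
  is strictly positive and controls every other value.\<close>

lemma harmonic_le_root:
  assumes m: "m \<in> harmonic" "0 \<le> m" and k: "k \<ge> 1"
  shows "m (real k) \<le> real k * m 1"
  using k
proof (induction k rule: less_induct)
  case (less k)
  have pos: "0 \<le> m x" for x using m(2) by (simp add: le_fun_def)
  show ?case
  proof (cases "k = 1")
    case False
    define p where "p = k div 2"
    have p: "p \<ge> 1" "p < k" "k = 2 * p \<or> k = 2 * p + 1" using False less.prems by (auto simp: p_def)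
    have "m (real k) \<le> 2 * m (real p)"
      using p(3) harmonic_step[OF m(1) p(1)] pos[of "real (2 * p)"] pos[of "real (2 * p + 1)"] by auto
    also have "\<dots> \<le> 2 * (real p * m 1)" using less.IH[OF p(2,1)] by simp
    also have "\<dots> \<le> real k * m 1" using p(3) pos[of 1] by (auto simp: algebra_simps)
    finally show ?thesis .
  qed simp
qed

lemma harmonic_zero_at_root:
  assumes m: "m \<in> harmonic" "0 \<le> m" "m 1 \<le> 0"
  shows "m = 0"
proof
  fix x show "m x = 0 x"
  proof (cases "x \<in> nodes")
    case True
    then obtain k where k: "k \<ge> 1" "x = real k" by (auto simp: nodes_def)
    have "m x \<le> real k * m 1" using harmonic_le_root[OF m(1,2) k(1)] k(2) by simp
    also have "\<dots> \<le> 0" using m(3) by (simp add: mult_nonneg_nonpos)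
    finally show ?thesis using m(2) by (simp add: le_fun_def antisym)
  qed (use harmonic_outside[OF m(1)] in simp)
qed

text \<open>By directedness the pointwise infimum is harmonic, hence equal to the infimum \<open>0\<close> of the lattice.\<close>

lemma down_to_0_harmonicD:
  assumes Y: "down_to_0 HL Y" and e: "0 < e"
  shows "\<exists>y\<in>Y. y x < e"
proof -
  have YH: "y \<in> harmonic" "0 \<le> y" if "y \<in> Y" for y
    using vlat.down_to_0_nonneg[OF vlat_HL Y that] by auto
  have ne: "Y \<noteq> {}" and dir: "\<And>y z. y \<in> Y \<Longrightarrow> z \<in> Y \<Longrightarrow> \<exists>w\<in>Y. w \<le> y \<and> w \<le> z"
    using Y by (auto simp: down_to_0_def)
  define g where "g x = (INF y\<in>Y. y x)" for x
  have bdd: "bdd_below ((\<lambda>y. y x) ` Y)" for x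
    using YH(2) by (auto simp: bdd_below_def le_fun_def)
  have g_lb: "g x \<le> y x" if "y \<in> Y" for x y
    unfolding g_def using bdd that by (rule cINF_lower)
  have g_greatest: "c \<le> g x" if "\<And>y. y \<in> Y \<Longrightarrow> c \<le> y x" for x c
    unfolding g_def using ne that by (rule cINF_greatest)
  have g_approx: "\<exists>y\<in>Y. y x < g x + d" if "d > 0" for x d
    using g_greatest[of "g x + d" x] that by (meson not_less less_add_same_cancel1)
  have g0: "0 \<le> g x" for x using YH(2) by (intro g_greatest) (simp add: le_fun_def)
  have "mean g x = g x" for x
  proof (rule antisym)
    show "mean g x \<le> g x"
    proof (rule g_greatest)
      fix y assume y: "y \<in> Y"
      have "mean g x \<le> mean y x" using mean_mono[of g y] g_lb[OF y] by (simp add: le_fun_def)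
      then show "mean g x \<le> y x" using harmonic_mean[OF YH(1)[OF y]] by simp
    qed
    show "g x \<le> mean g x"
    proof (cases "x \<in> nodes")
      case True
      show ?thesis
      proof (rule field_le_epsilon)
        fix d :: real assume d: "0 < d"
        obtain y z where y: "y \<in> Y" "y (2 * x) < g (2 * x) + d" and z: "z \<in> Y" "z (2 * x + 1) < g (2 * x + 1) + d"
          using g_approx[OF d] by meson
        obtain w where w: "w \<in> Y" "w \<le> y" "w \<le> z" using dir[OF y(1) z(1)] by blast
        have "w (2 * x) < g (2 * x) + d" "w (2 * x + 1) < g (2 * x + 1) + d"
          using w y(2) z(2) by (auto simp: le_fun_def intro: le_less_trans)
        moreover have "w x = w (2 * x) / 2 + w (2 * x + 1) / 2"
          using fun_cong[OF harmonic_mean[OF YH(1)[OF w(1)]], of x] True by (simp add: mean_def)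
        moreover have "mean g x = g (2 * x) / 2 + g (2 * x + 1) / 2" using True by (simp add: mean_def)
        ultimately show "g x \<le> mean g x + d" using g_lb[OF w(1), of x] by linarith
      qed
    next
      case False
      obtain y where y: "y \<in> Y" using ne by blast
      then show ?thesis using g_lb[OF y, of x] harmonic_outside[OF YH(1)[OF y] False] False by (simp add: mean_def)
    qed
  qed
  moreover have "\<exists>K. \<forall>x. \<bar>g x\<bar> \<le> K"
  proof -
    obtain y where y: "y \<in> Y" using ne by blast
    then obtain K where "\<And>x. \<bar>y x\<bar> \<le> K" using harmonic_bounded[OF YH(1)[OF y]] by blast
    then have "\<bar>g x\<bar> \<le> K" for x using g_lb[OF y, of x] g0[of x] by (smt (verit))
    then show ?thesis by blast
  qed
  ultimately have "g \<in> harmonic" by (auto simp: harmonic_def)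
  moreover have "\<forall>y\<in>Y. g \<le> y" using g_lb by (simp add: le_fun_def)
  ultimately have "g \<le> 0" using Y by (simp add: down_to_0_def is_glb_def)
  then have "g x + e \<le> e" by (simp add: le_fun_def)
  then show ?thesis using g_approx[OF e, of x] by (meson less_le_trans)
qed

lemma down_to_0_harmonicI:
  assumes Y: "Y \<subseteq> harmonic" "\<And>y. y \<in> Y \<Longrightarrow> 0 \<le> y"
    and dir: "\<And>y z. y \<in> Y \<Longrightarrow> z \<in> Y \<Longrightarrow> \<exists>w\<in>Y. w \<le> y \<and> w \<le> z"
    and root: "\<And>e. 0 < e \<Longrightarrow> \<exists>y\<in>Y. y 1 < e"
  shows "down_to_0 HL Y"
  unfolding down_to_0_def
proof (intro conjI)
  show "Y \<noteq> {}" using root[of 1] by auto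
  show "is_glb HL Y 0"
    unfolding is_glb_def
  proof (intro conjI ballI impI)
    show "0 \<in> vcarrier HL" using subspace_0[OF subspace_harmonic] by simp
    show "vle HL 0 y" if "y \<in> Y" for y using Y(2)[OF that] by simp
    fix R assume R: "R \<in> vcarrier HL" "\<forall>y\<in>Y. vle HL R y"
    let ?r = "vjoin HL R 0"
    have r: "?r \<in> harmonic" "0 \<le> ?r" "R \<le> ?r" "\<And>y. y \<in> Y \<Longrightarrow> ?r \<le> y"
      using vlat.join_in[OF vlat_HL, of R 0] vlat.join_ub1[OF vlat_HL, of R 0]
        vlat.join_ub2[OF vlat_HL, of R 0] vlat.join_least[OF vlat_HL, of R _ 0]
        R Y vlat.zero_in[OF vlat_HL] by auto
    have "?r 1 \<le> 0"
    proof (rule ccontr)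
      assume "\<not> ?r 1 \<le> 0"
      then obtain y where "y \<in> Y" "y 1 < ?r 1" using root[of "?r 1"] by auto
      then show False using r(4)[of y] by (simp add: le_fun_def) (meson not_le)
    qed
    then have "?r = 0" using harmonic_zero_at_root[OF r(1,2)] by simp
    then show "vle HL R 0" using r(3) by simp
  qed
qed (use Y dir in auto)

text \<open>Convergence in measure: the integral, evaluation at the root, is strictly positive and order
  continuous.\<close>

lemma ex_Hausdorff_uo_Lebesgue_harmonic: "\<exists>\<tau>. Hausdorff_uo_Lebesgue HL \<tau>"
proof (rule vlat.unbounded_topology[OF vlat_HL, of "(\<lambda>e. {m \<in> harmonic. 0 \<le> m \<and> m 1 < e}) ` {0<..}"])
  let ?W = "\<lambda>e::real. {m \<in> harmonic. 0 \<le> m \<and> m 1 < e}"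
  have W_in: "?W d \<in> ?W ` {0<..}" if "d > 0" for d by (rule imageI) (use that in simp)
  show "?W ` {0<..} \<noteq> {}" by auto
  show "x \<in> vcarrier HL \<and> vle HL 0 x" if "W \<in> ?W ` {0<..}" "x \<in> W" for W x
    using that by auto
  show "x \<in> W" if "W \<in> ?W ` {0<..}" "y \<in> W" "x \<in> vcarrier HL" "vle HL 0 x"
    "vle HL x y" for W x y
    using that by (auto simp: le_fun_def intro: le_less_trans)
  show "\<exists>Z\<in>?W ` {0<..}. Z \<subseteq> V \<inter> W" if VW: "V \<in> ?W ` {0<..}" "W \<in> ?W ` {0<..}" for V W
  proof -
    obtain d e where de: "d > 0" "e > 0" "V = ?W d" "W = ?W e" using VW by auto
    have "?W (min d e) \<subseteq> V \<inter> W" using de by auto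
    then show ?thesis by (rule bexI) (use de in \<open>intro W_in, simp\<close>)
  qed
  show "\<exists>V\<in>?W ` {0<..}. \<forall>x\<in>V. \<forall>y\<in>V. x + y \<in> W" if W: "W \<in> ?W ` {0<..}" for W
  proof -
    obtain e where e: "e > 0" "W = ?W e" using W by auto
    then have "\<forall>x\<in>?W (e/2). \<forall>y\<in>?W (e/2). x + y \<in> W"
      by (auto simp: le_fun_def subspace_add[OF subspace_harmonic])
    then show ?thesis by (rule bexI) (use e in \<open>intro W_in, simp\<close>)
  qed
  show "\<exists>e>0. e *\<^sub>R x \<in> W" if W: "W \<in> ?W ` {0<..}" and x: "x \<in> vcarrier HL" "vle HL 0 x" for W x
  proof -
    obtain d where d: "d > 0" "W = ?W d" using W by auto
    define e where "e = d / (x 1 + 1)"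
    have p: "0 \<le> x 1" using x(2) by (simp add: le_fun_def)
    then have "e > 0" "e * x 1 < d" using d(1) by (auto simp: e_def field_simps)
    then show ?thesis
      using d(2) x subspace_scale[OF subspace_harmonic] by (intro exI[of _ e]) (auto simp: le_fun_def)
  qed
  show "\<exists>W\<in>?W ` {0<..}. x \<notin> W" if x: "x \<in> vcarrier HL" "vle HL 0 x" "x \<noteq> 0" for x
  proof -
    have "x 1 > 0" using harmonic_zero_at_root[of x] x by force
    then show ?thesis by (intro bexI[OF _ W_in[of "x 1"]]) auto
  qed
  show "\<exists>y\<in>Y. y \<in> W" if W: "W \<in> ?W ` {0<..}" and Y: "down_to_0 HL Y" for W Y
  proof -
    obtain e where e: "e > 0" "W = ?W e" using W by auto
    obtain y where "y \<in> Y" "y 1 < e" using down_to_0_harmonicD[OF Y e(1)] by blast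
    then show ?thesis using vlat.down_to_0_nonneg[OF vlat_HL Y] e(2) by (intro bexI[of _ y]) auto
  qed
qed

section \<open>Harmonic functions carried by subtrees\<close>

definition child_closed :: "real set \<Rightarrow> bool" where
  "child_closed D \<longleftrightarrow> (\<forall>x\<in>D. 2 * x \<in> D \<and> 2 * x + 1 \<in> D)"

text \<open>The band projection onto the functions carried by the subtrees in \<open>D\<close>: the hull of \<open>m\<close> cut off
  outside \<open>D\<close>.  On a disjoint closed set all iterated means of the cut off function remain \<open>0\<close>.\<close>

lemma harmonic_restrict:
  assumes m: "m \<in> harmonic" "0 \<le> m" and D: "child_closed D"
  obtains y where "y \<in> harmonic" "0 \<le> y" "y \<le> m" "\<And>x. x \<in> D \<Longrightarrow> y x = m x"
    "\<And>D' x. child_closed D' \<Longrightarrow> D \<inter> D' = {} \<Longrightarrow> x \<in> D' \<Longrightarrow> y x = 0"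
    "\<And>f. mean f = f \<Longrightarrow> 0 \<le> f \<Longrightarrow> (\<And>x. x \<in> D \<Longrightarrow> m x \<le> f x) \<Longrightarrow> y \<le> f"
proof -
  have pos: "0 \<le> m x" for x using m(2) by (simp add: le_fun_def)
  define g where "g x = (if x \<in> D then m x else 0)" for x
  have g_pos: "0 \<le> g x" for x using pos by (simp add: g_def)
  have sub: "g \<le> mean g"
  proof (rule le_funI)
    fix x
    show "g x \<le> mean g x"
    proof (cases "x \<in> D")
      case True
      then have "2 * x \<in> D" "2 * x + 1 \<in> D" using D by (auto simp: child_closed_def)
      then have "mean g x = mean m x" by (simp add: mean_def g_def)
      then show ?thesis using True harmonic_mean[OF m(1)] by (simp add: g_def)
    qed (simp add: g_def mean_def pos)
  qed
  obtain K where K: "\<And>x. \<bar>m x\<bar> \<le> K" using harmonic_bounded[OF m(1)] by blast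
  have "\<bar>g x\<bar> \<le> K" for x using K[of x] by (auto simp: g_def)
  then obtain y where y: "y \<in> harmonic" "g \<le> y" "\<And>f. mean f = f \<Longrightarrow> g \<le> f \<Longrightarrow> y \<le> f"
    "\<And>x. (\<lambda>n. (mean ^^ n) g x) \<longlonglongrightarrow> y x" using harmonic_hull[OF sub] by metis
  have ym: "y \<le> m" using y(3)[OF harmonic_mean[OF m(1)]] pos by (simp add: g_def le_fun_def)
  show ?thesis
  proof
    show "y \<in> harmonic" "y \<le> m" by fact+
    show "0 \<le> y" using y(2) g_pos by (auto simp: le_fun_def intro: order_trans)
    show "y x = m x" if "x \<in> D" for x
      using le_funD[OF ym, of x] le_funD[OF y(2), of x] that by (simp add: g_def)
    show "y \<le> f" if "mean f = f" "0 \<le> f" "\<And>x. x \<in> D \<Longrightarrow> m x \<le> f x" for f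
      using that by (intro y(3)) (auto simp: g_def le_fun_def)
    show "y x = 0" if D': "child_closed D'" "D \<inter> D' = {}" "x \<in> D'" for D' x
    proof -
      have "(mean ^^ n) g z = 0" if "z \<in> D'" for n z
        using that
      proof (induction n arbitrary: z)
        case 0
        then show ?case using D' by (auto simp: g_def)
      next
        case (Suc n)
        then have "2 * z \<in> D'" "2 * z + 1 \<in> D'" using D'(1) by (auto simp: child_closed_def)
        then show ?case using Suc.IH by (simp add: mean_def)
      qed
      then have "(\<lambda>n. (mean ^^ n) g x) \<longlonglongrightarrow> 0" using D'(3) by simp
      then show ?thesis using y(4) LIMSEQ_unique by blast
    qed
  qed
qed

definition subtree :: "nat \<Rightarrow> real set" where
  "subtree k = real ` {i. \<exists>j. i div 2 ^ j = k}"

lemma root_in_subtree [simp]: "real k \<in> subtree k"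
  unfolding subtree_def by (auto intro!: imageI exI[of _ 0])

lemma child_closed_subtree: "child_closed (subtree k)"
  unfolding child_closed_def
proof
  fix x assume "x \<in> subtree k"
  then obtain i j where i: "x = real i" "i div 2 ^ j = k" by (auto simp: subtree_def)
  have "2 * i div 2 ^ Suc j = k" "(2 * i + 1) div 2 ^ Suc j = k"
    using i(2) by (simp_all add: div_mult2_eq)
  then have "real (2 * i) \<in> subtree k" "real (2 * i + 1) \<in> subtree k" unfolding subtree_def by blast+
  then show "2 * x \<in> subtree k \<and> 2 * x + 1 \<in> subtree k" using i(1) by (simp add: add.commute)
qed

lemma child_closed_Union: "(\<And>D. D \<in> \<D> \<Longrightarrow> child_closed D) \<Longrightarrow> child_closed (\<Union>\<D>)"
  by (fastforce simp: child_closed_def)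

text \<open>Two subtrees can only meet if one of the roots is an ancestor of the other.\<close>

lemma subtree_disjoint:
  assumes "\<And>d. k div 2 ^ d \<noteq> l" "\<And>d. l div 2 ^ d \<noteq> k"
  shows "subtree k \<inter> subtree l = {}"
proof -
  have no_common: False if "i div 2 ^ a = k" "i div 2 ^ b = l" for i a b
  proof (cases "a \<le> b")
    case True
    have "k div 2 ^ (b - a) = i div (2 ^ a * 2 ^ (b - a))" using that(1) by (simp add: div_mult2_eq)
    then have "k div 2 ^ (b - a) = l" using that(2) True by (simp flip: power_add)
    then show False using assms(1) by blast
  next
    case False
    have "l div 2 ^ (a - b) = i div (2 ^ b * 2 ^ (a - b))" using that(2) by (simp add: div_mult2_eq)
    then have "l div 2 ^ (a - b) = k" using that(1) False by (simp flip: power_add)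
    then show False using assms(2) by blast
  qed
  have False if x: "x \<in> subtree k" "x \<in> subtree l" for x
  proof -
    obtain i a i' b where i: "x = real i" "i div 2 ^ a = k" "x = real i'" "i' div 2 ^ b = l"
      using x by (auto simp: subtree_def)
    then have "i' = i" by simp
    then show False using no_common i by blast
  qed
  then show ?thesis by blast
qed

lemma subtree_disjoint_same_level:
  assumes "k \<in> {2 ^ n..<2 ^ Suc n}" "l \<in> {2 ^ n..<2 ^ Suc n}" "k \<noteq> l"
  shows "subtree k \<inter> subtree l = {}"
proof -
  have "a div 2 ^ d \<noteq> b" if "a \<in> {2 ^ n..<2 ^ Suc n}" "b \<in> {2 ^ n..<2 ^ Suc n}" "a \<noteq> b" for a b d :: nat
  proof (cases d)
    case (Suc e)
    have "a div 2 ^ d \<le> a div 2" using Suc by (simp add: div_mult2_eq)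
    also have "\<dots> < 2 ^ n" using that by auto
    finally show ?thesis using that by auto
  qed (use that in simp)
  then show ?thesis using assms by (intro subtree_disjoint) auto
qed

lemma sum_pairs: "(\<Sum>k\<in>{2 * a..<2 * b}. f k) = (\<Sum>k\<in>{a..<b}. f (2 * k) + f (2 * k + 1))" for f :: "nat \<Rightarrow> real"
proof (induction b)
  case (Suc b)
  then show ?case by (cases "a \<le> b") (auto simp: not_le)
qed simp

lemma level_mean:
  assumes m: "m \<in> harmonic"
  shows "m 1 = (\<Sum>k\<in>{2 ^ n..<2 ^ Suc n}. m (real k)) / 2 ^ n"
proof (induction n)
  case (Suc n)
  from sum_pairs[of "\<lambda>k. m (real k)" "2 ^ n" "2 ^ Suc n"]
  have "(\<Sum>k\<in>{2 ^ Suc n..<2 ^ Suc (Suc n)}. m (real k)) = (\<Sum>k\<in>{2 ^ n..<2 ^ Suc n}. m (real (2 * k)) + m (real (2 * k + 1)))"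
    by simp
  also have "\<dots> = (\<Sum>k\<in>{2 ^ n..<2 ^ Suc n}. 2 * m (real k))"
  proof (rule sum.cong[OF refl])
    fix k :: nat assume "k \<in> {2 ^ n..<2 ^ Suc n}"
    moreover have "(1::nat) \<le> 2 ^ n" by simp
    ultimately have "k \<ge> 1" by (metis atLeastLessThan_iff order_trans)
    then show "m (real (2 * k)) + m (real (2 * k + 1)) = 2 * m (real k)"
      using harmonic_step[OF m, of k] by linarith
  qed
  finally show ?case using Suc by (simp flip: sum_distrib_left)
qed (simp add: numeral_2_eq_2)

definition tree_unit :: "real \<Rightarrow> real" where
  "tree_unit x = (if x \<in> nodes then 1 else 0)"

lemma tree_unit_harmonic: "tree_unit \<in> harmonic" and tree_unit_nonneg: "0 \<le> tree_unit"
proof -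
  have "mean tree_unit = tree_unit" using nodes_children by (auto simp: mean_def tree_unit_def fun_eq_iff)
  then show "tree_unit \<in> harmonic" by (auto simp: harmonic_def tree_unit_def intro!: exI[of _ 1])
  show "0 \<le> tree_unit" by (simp add: le_fun_def tree_unit_def)
qed

text \<open>For a subtree \<open>S\<close> this is the projection of the constant function \<open>1\<close> onto \<open>S\<close>, with the properties from
  \<open>harmonic_restrict\<close>: its martingale value at \<open>x\<close> is the probability that the random path from \<open>x\<close> enters \<open>S\<close>.\<close>

definition is_indicator :: "real set \<Rightarrow> (real \<Rightarrow> real) \<Rightarrow> bool" where
  "is_indicator S f \<longleftrightarrow> f \<in> harmonic \<and> 0 \<le> f \<and> f \<le> tree_unit \<and> (\<forall>x\<in>S. f x = tree_unit x) \<and>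
     (\<forall>D. child_closed D \<and> S \<inter> D = {} \<longrightarrow> (\<forall>x\<in>D. f x = 0)) \<and>
     (\<forall>g. mean g = g \<and> 0 \<le> g \<and> (\<forall>x\<in>S. tree_unit x \<le> g x) \<longrightarrow> f \<le> g)"

lemma ex_indicator: "\<exists>f. is_indicator (subtree k) f"
  unfolding is_indicator_def
  by (rule harmonic_restrict[OF tree_unit_harmonic tree_unit_nonneg child_closed_subtree[of k]]) metis

definition indicator_tree :: "nat \<Rightarrow> real \<Rightarrow> real" where
  "indicator_tree k = (SOME f. is_indicator (subtree k) f)"

lemma indicator_tree:
  "indicator_tree k \<in> harmonic" "0 \<le> indicator_tree k" "indicator_tree k \<le> tree_unit"
  "child_closed D \<Longrightarrow> subtree k \<inter> D = {} \<Longrightarrow> x \<in> D \<Longrightarrow> indicator_tree k x = 0"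
  "mean g = g \<Longrightarrow> 0 \<le> g \<Longrightarrow> (\<And>x. x \<in> subtree k \<Longrightarrow> tree_unit x \<le> g x) \<Longrightarrow> indicator_tree k \<le> g"
  "x \<in> subtree k \<Longrightarrow> indicator_tree k x = tree_unit x"
  using someI_ex[OF ex_indicator[of k], folded indicator_tree_def, unfolded is_indicator_def] by blast+

text \<open>Among the \<open>2\<^sup>n\<close> nodes on the level of \<open>k\<close> only \<open>k\<close> contributes to the mean, which is therefore \<open>1 / 2\<^sup>n\<close>.\<close>

lemma indicator_tree_root_le:
  assumes k: "k \<ge> 1"
  shows "indicator_tree k 1 \<le> 2 / real k"
proof -
  obtain n where n: "2 ^ n \<le> k" "k < 2 ^ (n + 1)" using ex_power_ivl1[of 2 k] k by auto
  have "(\<Sum>l\<in>{2 ^ n..<2 ^ Suc n}. indicator_tree k (real l)) = (\<Sum>l\<in>{2 ^ n..<2 ^ Suc n}. if l = k then 1 else 0)"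
  proof (rule sum.cong[OF refl])
    fix l :: nat assume l: "l \<in> {2 ^ n..<2 ^ Suc n}"
    show "indicator_tree k (real l) = (if l = k then 1 else 0)"
    proof (cases "l = k")
      case True
      then show ?thesis using indicator_tree(6)[OF root_in_subtree] k by (simp add: tree_unit_def)
    next
      case False
      have "subtree k \<inter> subtree l = {}" using n l False by (intro subtree_disjoint_same_level[of _ n]) auto
      then show ?thesis using indicator_tree(4)[OF child_closed_subtree _ root_in_subtree] False by simp
    qed
  qed
  also have "\<dots> = 1" using n by simp
  finally have "indicator_tree k 1 = 1 / 2 ^ n" using level_mean[OF indicator_tree(1), of k n] by simp
  moreover have k2: "real k \<le> 2 * 2 ^ n" using n(2) by (metis of_nat_le_iff less_imp_le of_nat_numeral of_nat_power power_Suc Suc_eq_plus1)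
  moreover have "1 / 2 ^ n \<le> 2 / real k" using k k2 by (simp add: field_simps)
  ultimately show ?thesis by simp
qed

section \<open>Operators of rank one\<close>

definition rank_one :: "'a::real_vector vlat \<Rightarrow> ('a \<Rightarrow> real) \<Rightarrow> 'a \<Rightarrow> 'a \<Rightarrow> 'a" where
  "rank_one G \<phi> f = (\<lambda>x. if x \<in> vcarrier G then \<phi> x *\<^sub>R f else 0)"

context dc_vlat begin

lemma rank_one_in:
  assumes add: "\<And>x y. x \<in> C \<Longrightarrow> y \<in> C \<Longrightarrow> \<phi> (x + y) = \<phi> x + \<phi> y"
    and scale: "\<And>x c. x \<in> C \<Longrightarrow> \<phi> (c *\<^sub>R x) = c * \<phi> x"
    and bd: "\<And>b. b \<in> C \<Longrightarrow> 0 \<preceq> b \<Longrightarrow> \<exists>K. \<forall>x\<in>C. 0 \<preceq> x \<and> x \<preceq> b \<longrightarrow> \<bar>\<phi> x\<bar> \<le> K"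
    and f: "f \<in> C"
  shows "rank_one G \<phi> f \<in> opC"
proof (rule op_boundedI)
  fix b assume b: "b \<in> C" "0 \<preceq> b"
  obtain K where K: "\<And>x. x \<in> C \<Longrightarrow> 0 \<preceq> x \<Longrightarrow> x \<preceq> b \<Longrightarrow> \<bar>\<phi> x\<bar> \<le> K" using bd[OF b] by blast
  have "\<bar>\<phi> x *\<^sub>R f\<bar>\<^sub>G \<preceq> K *\<^sub>R \<bar>f\<bar>\<^sub>G" if x: "x \<in> C" "0 \<preceq> x" "x \<preceq> b" for x
    using le_trans[OF abs_scale_le[OF f, of "\<phi> x"] scale_left_mono[OF abs_nonneg[OF f] abs_in[OF f] K[OF x]]] f by simp
  then show "\<exists>d\<in>C. \<forall>x\<in>C. 0 \<preceq> x \<and> x \<preceq> b \<longrightarrow> \<bar>rank_one G \<phi> f x\<bar>\<^sub>G \<preceq> d"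
    using f by (intro bexI[of _ "K *\<^sub>R \<bar>f\<bar>\<^sub>G"]) (auto simp: rank_one_def)
qed (use f in \<open>auto simp: rank_one_def add scale scaleR_add_left\<close>)

text \<open>A positive functional turns order null nets of vectors into order null nets of operators, because
  \<open>y \<down> 0\<close> implies \<open>\<phi> \<otimes> y \<down> 0\<close>; this is the source of convergence in \<open>L\<close> for the typewriter sequence.\<close>

lemma rank_one_o_conv:
  assumes op: "\<And>f. f \<in> C \<Longrightarrow> rank_one G \<phi> f \<in> opC"
    and pos: "\<And>x. x \<in> C \<Longrightarrow> 0 \<preceq> x \<Longrightarrow> 0 \<le> \<phi> x"
    and f: "\<And>a. a \<in> Field r \<Longrightarrow> f a \<in> C" and o: "o_conv G r f 0"
  shows "o_conv L r (\<lambda>a. rank_one G \<phi> (f a)) 0"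
proof -
  let ?R = "rank_one G \<phi>"
  have mono: "vle L (?R y) (?R z)" if "y \<preceq> z" "y \<in> C" "z \<in> C" for y z
    using that op[of y] op[of z] pos by (simp add: op_le_iff rank_one_def scale_mono)
  obtain Y where Y: "down_to_0 G Y"
    "\<forall>y\<in>Y. \<exists>a\<in>Field r. \<forall>a'. (a, a') \<in> r \<longrightarrow> \<bar>0 - f a'\<bar>\<^sub>G \<preceq> y" using o by (rule o_convE_set)
  have YC: "y \<in> C" "0 \<preceq> y" if "y \<in> Y" for y using down_to_0_nonneg[OF Y(1) that] by auto
  have neg: "?R (- z) = - ?R z" for z
    by (auto simp: rank_one_def fun_eq_iff)
  have zero: "?R 0 = 0" by (auto simp: rank_one_def fun_eq_iff)
  have "down_to_0 L (?R ` Y)"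
    unfolding down_to_0_def
  proof (intro conjI ballI)
    show "?R ` Y \<subseteq> opC" using op YC by auto
    show "?R ` Y \<noteq> {}" using Y(1) by (auto simp: down_to_0_def)
    show "\<exists>R\<in>?R ` Y. vle L R S \<and> vle L R T"
      if ST: "S \<in> ?R ` Y" "T \<in> ?R ` Y" for S T
    proof -
      obtain y z where yz: "y \<in> Y" "z \<in> Y" "S = ?R y" "T = ?R z" using ST by blast
      then obtain w where "w \<in> Y" "w \<preceq> y" "w \<preceq> z" using Y(1) unfolding down_to_0_def by meson
      then show ?thesis using yz mono YC by blast
    qed
    show "is_glb L (?R ` Y) 0"
      unfolding is_glb_def
    proof (intro conjI ballI impI)
      show "vle L 0 T" if "T \<in> ?R ` Y" for T
        using that mono[of 0] YC by (auto simp: zero)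
      fix R assume R: "R \<in> opC" "\<forall>T\<in>?R ` Y. vle L R T"
      have "R x \<preceq> 0" if x: "x \<in> C" "0 \<preceq> x" for x
      proof -
        have Rx: "R x \<in> C" using R(1) x(1) by (rule op_in)
        have le: "R x \<preceq> \<phi> x *\<^sub>R y" if "y \<in> Y" for y
        proof -
          have "vle L R (?R y)" using R(2) that by blast
          then have "R x \<preceq> ?R y x" using op_le_iff[OF R(1) op[OF YC(1)[OF that]]] x by blast
          then show ?thesis using x by (simp add: rank_one_def)
        qed
        show ?thesis
        proof (cases "\<phi> x = 0")
          case True
          then show ?thesis using le Y(1) by (auto simp: down_to_0_def)
        next
          case False
          then have p: "\<phi> x > 0" using pos[OF x] by simp
          have "(1 / \<phi> x) *\<^sub>R R x \<preceq> y" if "y \<in> Y" for y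
            using scale_mono[OF le[OF that], of "1 / \<phi> x"] p Rx YC[OF that] by simp
          then have "(1 / \<phi> x) *\<^sub>R R x \<preceq> 0" using Y(1) Rx by (simp add: down_to_0_def is_glb_def)
          from scale_mono[OF this, of "\<phi> x"] show ?thesis using p Rx by simp
        qed
      qed
      then show "vle L R 0" using R(1) by (simp add: op_le_iff)
    qed simp
  qed
  then show ?thesis
  proof (rule vlat.o_convI_set[OF vlat_L])
    fix T assume "T \<in> ?R ` Y"
    then obtain y where y: "y \<in> Y" "T = ?R y" by blast
    then obtain a where a: "a \<in> Field r" "\<forall>a'. (a, a') \<in> r \<longrightarrow> \<bar>0 - f a'\<bar>\<^sub>G \<preceq> y" using Y(2) by blast
    have "vle L (vabs L (0 - ?R (f a'))) T" if aa: "(a, a') \<in> r" for a'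
    proof -
      have fC: "f a' \<in> C" using f FieldI2[OF aa] by blast
      have "\<bar>f a'\<bar>\<^sub>G \<preceq> y" using a(2) aa fC by auto
      then have "f a' \<preceq> y" "- f a' \<preceq> y"
        using le_trans[OF abs_ge[OF fC]] le_trans[OF abs_ge_minus[OF fC]] fC YC[OF y(1)] by simp_all
      then have "vle L (?R (f a')) T" "vle L (- ?R (f a')) T"
        using mono[of "f a'" y] mono[of "- f a'" y] fC YC[OF y(1)] y(2) by (auto simp: neg)
      then show ?thesis
        using op[OF fC] op[OF YC(1)[OF y(1)]] y(2) by (auto intro!: L_abs_least)
    qed
    then show "\<exists>a\<in>Field r. \<forall>a'. (a, a') \<in> r \<longrightarrow> vle L (vabs L (0 - ?R (f a'))) T"
      using a(1) by blast
  qed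
qed

end

section \<open>Sequences as nets\<close>

abbreviation seq_order :: "nat rel" where
  "seq_order \<equiv> {(a, b). a \<le> b}"

lemma Field_seq_order [simp]: "Field seq_order = UNIV"
  by (auto simp: Field_def)

lemma directed_seq_order: "directed seq_order"
  unfolding directed_def Field_seq_order
  by (auto simp: preorder_on_def refl_on_def trans_def) (meson max.cobounded1 max.cobounded2)

lemma net_filter_seq_order: "net_filter seq_order = sequentially"
  by (rule filter_eqI) (simp add: eventually_net_filter[OF directed_seq_order] eventually_sequentially)

text \<open>Topological convergence can be tested on subsequences, order convergence cannot.  This gives convergence in any
  uo-Lebesgue topology without describing its neighbourhoods.\<close>

lemma (in vlat) limitin_of_subsequences:
  assumes uoL: "uo_Lebesgue G \<tau>" and x: "\<And>n. x n \<in> C"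
    and sub: "\<And>A. infinite A \<Longrightarrow> \<exists>s::nat \<Rightarrow> nat. range s \<subseteq> A \<and> o_conv G seq_order (\<lambda>i. x (s i)) 0"
  shows "limitin \<tau> x 0 (net_filter seq_order)"
  unfolding limitin_def
proof (intro conjI allI impI)
  have "topspace \<tau> = C" using uoL by (simp add: uo_Lebesgue_def linear_topology_def)
  then show "0 \<in> topspace \<tau>" by simp
  fix U assume U: "openin \<tau> U \<and> 0 \<in> U"
  show "eventually (\<lambda>n. x n \<in> U) (net_filter seq_order)"
  proof (rule ccontr)
    assume "\<not> ?thesis"
    then have "infinite {n. x n \<notin> U}"
      by (auto simp: net_filter_seq_order eventually_sequentially infinite_nat_iff_unbounded_le)
    then obtain s where s: "range s \<subseteq> {n. x n \<notin> U}" "o_conv G seq_order (\<lambda>i. x (s i)) 0" using sub by blast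
    have "uo_conv G seq_order (\<lambda>i. x (s i)) 0"
      using s(2) x by (intro o_conv_imp_uo_conv) auto
    then have "limitin \<tau> (\<lambda>i. x (s i)) 0 (net_filter seq_order)"
      using x by (intro uo_Lebesgue_net[OF uoL directed_seq_order]) auto
    then have "eventually (\<lambda>i. x (s i) \<in> U) (net_filter seq_order)" using U by (auto simp: limitin_def)
    then obtain i where "x (s i) \<in> U" by (auto simp: net_filter_seq_order eventually_sequentially)
    then show False using s(1) by blast
  qed
qed

section \<open>Counterexamples\<close>

abbreviation HO where "HO \<equiv> L_ob HL"
abbreviation null where "null c T \<equiv> converges c HL seq_order T 0"

lemmas HO_le_iff = dc_vlat.op_le_iff[OF dc_HL, simplified]

lemma zero_op: "0 \<in> vcarrier HO"
  by (rule subspace_0[OF dc_vlat.subspace_op[OF dc_HL]])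

lemma rank_one_harmonic:
  assumes "\<And>x y. \<phi> (x + y) = \<phi> x + \<phi> y" "\<And>x c. \<phi> (c *\<^sub>R x) = c * \<phi> x"
    and "\<And>b. b \<in> harmonic \<Longrightarrow> 0 \<le> b \<Longrightarrow> \<exists>K. \<forall>x\<in>harmonic. 0 \<le> x \<and> x \<le> b \<longrightarrow> \<bar>\<phi> x\<bar> \<le> K"
    and "f \<in> harmonic"
  shows "rank_one HL \<phi> f \<in> vcarrier HO"
  using assms by (intro dc_vlat.rank_one_in[OF dc_HL]) auto

lemma rank_one_eval: "f \<in> harmonic \<Longrightarrow> rank_one HL (\<lambda>m. m x) f \<in> vcarrier HO"
proof (rule rank_one_harmonic)
  fix b :: "real \<Rightarrow> real"
  show "\<exists>K. \<forall>m\<in>harmonic. 0 \<le> m \<and> m \<le> b \<longrightarrow> \<bar>m x\<bar> \<le> K"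
    by (intro exI[of _ "b x"]) (simp add: le_fun_def)
qed auto

lemma rank_one_apply: "m \<in> harmonic \<Longrightarrow> rank_one HL \<phi> f m = \<phi> m *\<^sub>R f"
  by (simp add: rank_one_def)

lemma tau_hat_harmonic:
  shows "uo_Lebesgue HL (tau_hat HL)" "Hausdorff_space (tau_hat HL)" "topspace (tau_hat HL) = harmonic"
    "uo_Lebesgue HO (tau_hat HO)" "Hausdorff_space (tau_hat HO)" "topspace (tau_hat HO) = vcarrier HO"
  using tau_hat_Hausdorff_uo_Lebesgue[OF ex_Hausdorff_uo_Lebesgue_harmonic]
    tau_hat_Hausdorff_uo_Lebesgue[OF dc_vlat.Hausdorff_uo_Lebesgue_L[OF dc_HL
      tau_hat_Hausdorff_uo_Lebesgue[OF ex_Hausdorff_uo_Lebesgue_harmonic]]]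
  by (simp_all add: Hausdorff_uo_Lebesgue_def uo_Lebesgue_def linear_topology_def)

subsection \<open>Disjoint functionals: uo without pointwise convergence\<close>

text \<open>The right children of the nodes \<open>2\<^sup>n\<close> on the leftmost branch; their subtrees are pairwise disjoint.\<close>

definition spine :: "nat \<Rightarrow> nat" where
  "spine n = 2 * 2 ^ n + 1"

lemma spine_disjoint:
  assumes "n \<noteq> m"
  shows "subtree (spine n) \<inter> subtree (spine m) = {}"
proof -
  have "spine a div 2 ^ d \<noteq> spine b" if ab: "a \<noteq> b" for a b d
  proof (cases d)
    case 0
    then show ?thesis using ab by (simp add: spine_def)
  next
    case (Suc e)
    have "spine a div 2 ^ d = 2 ^ a div 2 ^ e" using Suc by (simp add: spine_def div_mult2_eq)
    also have "\<dots> \<noteq> spine b"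
    proof (cases "e \<le> a")
      case True
      then have eq: "(2::nat) ^ a div 2 ^ e = 2 ^ (a - e)" by (simp add: power_diff)
      have "spine b \<noteq> 1" "odd (spine b)" by (simp_all add: spine_def)
      show ?thesis
        unfolding eq
      proof
        assume h: "2 ^ (a - e) = spine b"
        then have "odd ((2::nat) ^ (a - e))" using \<open>odd (spine b)\<close> by simp
        then have "a - e = 0" by simp
        then show False using h \<open>spine b \<noteq> 1\<close> by simp
      qed
    next
      case False
      then have "(2::nat) ^ a < 2 ^ e" by simp
      then show ?thesis by (simp add: spine_def)
    qed
    finally show ?thesis .
  qed
  then show ?thesis using assms by (intro subtree_disjoint) auto
qed

lemma tree_unit_spine [simp]: "tree_unit (real (spine n)) = 1"
  by (simp only: tree_unit_def real_in_nodes) (simp add: spine_def)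

lemma tree_unit_1 [simp]: "tree_unit 1 = 1"
  by (simp add: tree_unit_def)

lemma tree_unit_neq_0: "tree_unit \<noteq> 0"
  using tree_unit_1 by (metis zero_fun_apply zero_neq_one)

text \<open>Disjointness of \<open>T n\<close> and \<open>T m\<close>: split \<open>x\<close> into its projection \<open>y\<close> onto the \<open>n\<close>-th subtree and the rest.
  Then \<open>T m\<close> kills \<open>y\<close> and \<open>T n\<close> kills \<open>x - y\<close>.\<close>

lemma uo_not_Stau:
  "\<exists>T. (\<forall>n. T n \<in> vcarrier HO) \<and> null Mode_uo T \<and> \<not> null Mode_Stau T"
proof -
  define T where "T n = rank_one HL (\<lambda>m. m (real (spine n))) tree_unit" for n
  have T: "T n \<in> vcarrier HO" for n unfolding T_def by (rule rank_one_eval[OF tree_unit_harmonic])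
  have T_app: "T n x = x (real (spine n)) *\<^sub>R tree_unit" if "x \<in> harmonic" for n x
    using that by (simp add: T_def rank_one_apply)
  have "uo_conv HO seq_order T 0"
  proof (rule vlat.disjoint_seq_uo_null[OF dc_vlat.vlat_L[OF dc_HL] dc_vlat.archimedean_L[OF dc_HL] T])
    show "vle HO 0 (T n)" for n
      using HO_le_iff[OF zero_op T] tree_unit_nonneg by (auto simp: T_app le_fun_def)
    fix n m R assume nm: "n \<noteq> m" and R: "R \<in> vcarrier HO" "vle HO R (T n)" "vle HO R (T m)"
    have "R x \<le> 0" if x: "x \<in> harmonic" "0 \<le> x" for x
    proof -
      obtain y where y: "y \<in> harmonic" "0 \<le> y" "y \<le> x" "\<And>z. z \<in> subtree (spine n) \<Longrightarrow> y z = x z"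
        "\<And>D' z. child_closed D' \<Longrightarrow> subtree (spine n) \<inter> D' = {} \<Longrightarrow> z \<in> D' \<Longrightarrow> y z = 0"
        using harmonic_restrict[OF x child_closed_subtree[of "spine n"]] by metis
      have z: "x - y \<in> harmonic" "0 \<le> x - y"
        using subspace_diff[OF subspace_harmonic x(1) y(1)] y(3) by (auto simp: le_fun_def)
      have "R y \<le> T m y" using R HO_le_iff[OF R(1) T] y by blast
      moreover have "T m y = 0"
        using y(5)[OF child_closed_subtree spine_disjoint[OF nm] root_in_subtree] T_app[OF y(1)] by simp
      moreover have "R (x - y) \<le> T n (x - y)" using R HO_le_iff[OF R(1) T] z by blast
      moreover have "T n (x - y) = 0" using y(4)[OF root_in_subtree] T_app[OF z(1)] by simp
      moreover have "R x = R y + R (x - y)"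
        using dc_vlat.op_add[OF dc_HL R(1), of y "x - y"] y(1) z(1) by simp
      ultimately show ?thesis by (simp add: le_fun_def add_nonpos_nonpos)
    qed
    then show "vle HO R 0" using HO_le_iff[OF R(1) zero_op] by simp
  qed
  moreover have "\<not> null Mode_Stau T"
  proof
    assume "null Mode_Stau T"
    then have "limitin (tau_hat HL) (\<lambda>n. T n tree_unit) 0 (net_filter seq_order)"
      using tree_unit_harmonic by (auto simp: tau_conv_def)
    then have "limitin (tau_hat HL) (\<lambda>n. tree_unit) 0 (net_filter seq_order)"
      using T_app[OF tree_unit_harmonic] by simp
    moreover have "limitin (tau_hat HL) (\<lambda>n. tree_unit) tree_unit (net_filter seq_order)"
      using tau_hat_harmonic(3) tree_unit_harmonic by simp
    ultimately have "tree_unit = 0"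
      using limitin_Hausdorff_unique[OF _ _ _ tau_hat_harmonic(2)] net_filter_nontrivial[OF directed_seq_order] by blast
    then show False using tree_unit_neq_0 by simp
  qed
  ultimately show ?thesis using T by (intro exI[of _ T]) simp
qed

subsection \<open>Unbounded disjoint sequences: SUO without SO\<close>

lemma scaled_indicator_tree:
  assumes "0 \<le> c"
  shows "0 \<le> c *\<^sub>R indicator_tree k" "c *\<^sub>R indicator_tree k \<in> harmonic"
  using indicator_tree(1,2)[of k] assms subspace_scale[OF subspace_harmonic] by (auto simp: le_fun_def)

text \<open>Subtracting a common lower bound \<open>r \<ge> 0\<close> from \<open>a f\<^sub>k\<close> does not change it on the subtree at \<open>k\<close>, where \<open>f\<^sub>l\<close> and thus
  \<open>r\<close> vanishes; by minimality of \<open>f\<^sub>k\<close> the result still dominates \<open>a f\<^sub>k\<close>.\<close>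

lemma indicator_disjoint:
  assumes disj: "subtree k \<inter> subtree l = {}" and a: "0 \<le> a"
    and R: "R \<in> harmonic" "R \<le> a *\<^sub>R indicator_tree k" "R \<le> b *\<^sub>R indicator_tree l" and b: "0 \<le> b"
  shows "R \<le> 0"
proof (cases "a = 0")
  case True
  then show ?thesis using R(2) by simp
next
  case False
  then have ap: "a > 0" using a by simp
  define r where "r = vjoin HL R 0"
  have zero: "0 \<in> harmonic" by (rule subspace_0[OF subspace_harmonic])
  have r: "r \<in> harmonic" "0 \<le> r" "R \<le> r" "r \<le> a *\<^sub>R indicator_tree k" "r \<le> b *\<^sub>R indicator_tree l"
    using vlat.join_in[OF vlat_HL, of R 0] vlat.join_ub1[OF vlat_HL, of R 0]
      vlat.join_ub2[OF vlat_HL, of R 0] vlat.join_least[OF vlat_HL, of R _ 0]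
      R scaled_indicator_tree a b zero by (auto simp: r_def)
  define g where "g = (1 / a) *\<^sub>R (a *\<^sub>R indicator_tree k - r)"
  have g: "g \<in> harmonic"
    unfolding g_def
    by (rule subspace_scale[OF subspace_harmonic subspace_diff[OF subspace_harmonic scaled_indicator_tree(2)[OF a] r(1)]])
  have g0: "0 \<le> g" using r(4) ap by (simp add: g_def le_fun_def)
  have "tree_unit x \<le> g x" if x: "x \<in> subtree k" for x
  proof -
    have "indicator_tree l x = 0"
      using indicator_tree(4)[OF child_closed_subtree] disj x by blast
    then have "r x = 0" using le_funD[OF r(5), of x] le_funD[OF r(2), of x] by simp
    then show ?thesis using indicator_tree(6)[OF x] ap by (simp add: g_def)
  qed
  then have "indicator_tree k \<le> g" using indicator_tree(5)[OF harmonic_mean[OF g] g0] by blast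
  then have "r x \<le> 0" for x
    using le_funD[of "indicator_tree k" g x] ap by (simp add: g_def right_diff_distrib)
      (metis divide_le_0_iff not_le)
  then show ?thesis using r(3) by (auto simp: le_fun_def intro: order_trans)
qed

lemma SUO_not_SO:
  "\<exists>T. (\<forall>n. T n \<in> vcarrier HO) \<and> null Mode_SUO T \<and> \<not> null Mode_SO T"
proof -
  define s where "s n = real n *\<^sub>R indicator_tree (spine n)" for n
  define T where "T n = rank_one HL (\<lambda>m. m 1) (s n)" for n
  have s: "s n \<in> harmonic" "0 \<le> s n" for n unfolding s_def by (auto intro: scaled_indicator_tree)
  have T: "T n \<in> vcarrier HO" for n unfolding T_def by (rule rank_one_eval[OF s(1)])
  have "uo_conv HL seq_order (\<lambda>n. T n x) 0" if x: "x \<in> harmonic" for x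
  proof -
    \<comment> \<open>\<open>x 1\<close> may be negative, but uo-convergence to \<open>0\<close> only depends on absolute values\<close>
    define t where "t n = (\<bar>x 1\<bar> * real n) *\<^sub>R indicator_tree (spine n)" for n
    have t: "t n \<in> harmonic" "0 \<le> t n" for n unfolding t_def by (auto intro: scaled_indicator_tree)
    have uo: "uo_conv HL seq_order t 0"
    proof (rule vlat.disjoint_seq_uo_null[OF vlat_HL dc_vlat.arch[OF dc_HL]])
      fix n m :: nat and R assume "n \<noteq> m" "R \<in> vcarrier HL" "vle HL R (t n)" "vle HL R (t m)"
      then show "vle HL R 0"
        using indicator_disjoint[OF spine_disjoint[of n m], of "\<bar>x 1\<bar> * real n" R "\<bar>x 1\<bar> * real m"]
        by (simp add: t_def)
    qed (use t in auto)
    have "T n x = t n \<or> T n x = - t n" for n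
      by (cases "x 1 \<ge> 0") (auto simp: T_def t_def s_def rank_one_apply[OF x])
    then have "vabs HL (T n x - 0) = vabs HL (t n - 0)" for n
      using vlat.abs_minus[OF vlat_HL, of "t n"] t by (metis diff_zero vcarrier_harmonic)
    then show ?thesis using uo by (simp add: uo_conv_def)
  qed
  moreover have "\<not> null Mode_SO T"
  proof
    assume "null Mode_SO T"
    then have "o_conv HL seq_order (\<lambda>n. T n tree_unit) 0" using tree_unit_harmonic by auto
    then have "o_conv HL seq_order s 0" using tree_unit_harmonic by (simp add: T_def rank_one_apply)
    then obtain Y where Y: "down_to_0 HL Y"
      "\<forall>y\<in>Y. \<exists>a\<in>Field seq_order. \<forall>a'. (a, a') \<in> seq_order \<longrightarrow> vle HL (vabs HL (0 - s a')) y"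
      by (rule vlat.o_convE_set[OF vlat_HL])
    then obtain y where y: "y \<in> Y" by (auto simp: down_to_0_def)
    then obtain a where a: "\<And>n. a \<le> n \<Longrightarrow> vabs HL (0 - s n) \<le> y" using Y(2) by auto
    obtain K where K: "\<And>x. \<bar>y x\<bar> \<le> K"
      using vlat.down_to_0_nonneg[OF vlat_HL Y(1) y] harmonic_bounded by auto
    obtain n where n: "K < real n" "a \<le> n"
      using reals_Archimedean2[of "max K (real a)"] by (auto intro: less_imp_le)
    have "s n \<le> y"
      using a[OF n(2)] abs_uminus_harmonic[OF s] by simp
    then have "s n (real (spine n)) \<le> K" using K[of "real (spine n)"] by (auto simp: le_fun_def intro: order_trans abs_le_D1)
    then show False using n(1) indicator_tree(6)[OF root_in_subtree[of "spine n"]] by (simp add: s_def)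
  qed
  ultimately show ?thesis using T by (intro exI[of _ T]) simp
qed

subsection \<open>The typewriter sequence: topological without uo-convergence\<close>

text \<open>The nodes in heap order run through the levels from left to right, so the indicators sweep over the
  Cantor space once per level.  The shift makes the sequence start at the root \<open>1\<close>.\<close>

definition typewriter :: "nat \<Rightarrow> real \<Rightarrow> real" where
  "typewriter n = indicator_tree (Suc n)"

text \<open>A function dominating a full level of indicators has mean at least \<open>1\<close>, but the dominating
  functions have means tending to \<open>0\<close>.\<close>

lemma typewriter_not_o_conv: "\<not> o_conv HL seq_order typewriter 0"
proof
  assume "o_conv HL seq_order typewriter 0"
  then obtain Y where Y: "down_to_0 HL Y"
    "\<forall>y\<in>Y. \<exists>a\<in>Field seq_order. \<forall>a'. (a, a') \<in> seq_order \<longrightarrow> vle HL (vabs HL (0 - typewriter a')) y"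
    by (rule vlat.o_convE_set[OF vlat_HL])
  obtain y where y: "y \<in> Y" "y 1 < 1" using down_to_0_harmonicD[OF Y(1), of 1 1] by auto
  have yH: "y \<in> harmonic" using vlat.down_to_0_nonneg[OF vlat_HL Y(1) y(1)] by simp
  obtain a where a: "\<And>n. a \<le> n \<Longrightarrow> vabs HL (0 - typewriter n) \<le> y" using Y(2) y(1) by auto
  have le: "indicator_tree k \<le> y" if "k > a" for k
    using a[of "k - 1"] that abs_uminus_harmonic[OF indicator_tree(1,2)[of k]]
    by (simp add: typewriter_def)
  have "(\<Sum>k\<in>{2 ^ Suc a..<2 ^ Suc (Suc a)::nat}. 1) \<le> (\<Sum>k\<in>{2 ^ Suc a..<2 ^ Suc (Suc a)}. y (real k))"
  proof (rule sum_mono)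
    fix k :: nat assume k: "k \<in> {2 ^ Suc a..<2 ^ Suc (Suc a)}"
    have "a < 2 ^ Suc a" by (rule less_trans[OF less_exp]) simp
    then have "a < k" using k by auto
    moreover have "indicator_tree k (real k) = 1"
      using indicator_tree(6)[OF root_in_subtree[of k]] \<open>a < k\<close> by (simp add: tree_unit_def)
    ultimately show "1 \<le> y (real k)" using le by (metis le_funD)
  qed
  then have "1 \<le> (\<Sum>k\<in>{2 ^ Suc a..<2 ^ Suc (Suc a)}. y (real k)) / 2 ^ Suc a" by simp
  then show False using level_mean[OF yH, of "Suc a"] y(2) by simp
qed

text \<open>The tail suprema \<open>y m\<close> are dominated by the tail sums \<open>G m\<close>, which are harmonic, possibly unbounded, and
  at most \<open>2 / 2\<^sup>m\<close> at the root.\<close>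

lemma typewriter_subsequence:
  assumes s: "\<And>i. typewriter (s i) 1 \<le> (1 / 2) ^ i"
  shows "o_conv HL seq_order (\<lambda>i. typewriter (s i)) 0"
proof -
  define f where "f i = typewriter (s i)" for i
  have f: "f i \<in> harmonic" "0 \<le> f i" "f i \<le> tree_unit" for i
    using indicator_tree by (auto simp: f_def typewriter_def)
  have f_bd: "f i (real k) \<le> real k * (1 / 2) ^ i" if "k \<ge> 1" for i k
    using harmonic_le_root[OF f(1,2) that, of i] s[of i] mult_left_mono[OF s[of i], of "real k"]
    by (simp add: f_def)
  have geom: "summable (\<lambda>i. c * (1 / 2 :: real) ^ i)" for c
    by (intro summable_mult summable_geometric) simp
  have sm: "summable (\<lambda>i. f i x)" for x
  proof (cases "x \<in> nodes")
    case True
    then obtain k where k: "k \<ge> 1" "x = real k" by (auto simp: nodes_def)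
    show ?thesis
      using f_bd[OF k(1)] f(2) k(2) by (intro summable_comparison_test'[OF geom[of "real k"], of 0]) (simp add: le_fun_def)
  next
    case False
    then show ?thesis using harmonic_outside[OF f(1)] by simp
  qed
  define G where "G m x = (\<Sum>i. f (i + m) x)" for m x
  have sm': "summable (\<lambda>i. f (i + m) x)" for m x using sm by (rule summable_ignore_initial_segment)
  have G_mean: "mean (G m) = G m" for m
  proof
    fix x show "mean (G m) x = G m x"
    proof (cases "x \<in> nodes")
      case True
      have "G m x = (\<Sum>i. f (i + m) (2 * x) / 2 + f (i + m) (2 * x + 1) / 2)"
        unfolding G_def using fun_cong[OF harmonic_mean[OF f(1)], of _ x] True by (simp add: mean_def)
      also have "\<dots> = (\<Sum>i. f (i + m) (2 * x) / 2) + (\<Sum>i. f (i + m) (2 * x + 1) / 2)"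
        by (intro suminf_add[symmetric] summable_divide sm')
      also have "\<dots> = mean (G m) x" using True by (simp add: mean_def G_def suminf_divide sm')
      finally show ?thesis by simp
    next
      case False
      then show ?thesis using harmonic_outside[OF f(1) False] by (simp add: mean_def G_def)
    qed
  qed
  have f_le_G: "f i \<le> G m" if "i \<ge> m" for i m
  proof (rule le_funI)
    fix x
    have "(\<Sum>j\<in>{i - m}. f (j + m) x) \<le> G m x"
      unfolding G_def using f(2) by (intro sum_le_suminf sm') (auto simp: le_fun_def)
    then show "f i x \<le> G m x" using that by simp
  qed
  have G_root: "G m 1 \<le> 2 * (1 / 2) ^ m" for m
  proof -
    have "G m 1 \<le> (\<Sum>i. (1 / 2) ^ m * (1 / 2) ^ i)"
      unfolding G_def
    proof (rule suminf_le)
      show "f (i + m) 1 \<le> (1 / 2) ^ m * (1 / 2) ^ i" for i using s[of "i + m"] by (simp add: f_def power_add mult.commute)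
    qed (use sm' geom in auto)
    also have "\<dots> = (1 / 2) ^ m * (\<Sum>i. (1 / 2) ^ i)" by (intro suminf_mult summable_geometric) simp
    also have "\<dots> = 2 * (1 / 2) ^ m" by (simp add: suminf_geometric)
    finally show ?thesis .
  qed
  have "\<exists>y. y \<in> harmonic \<and> (\<forall>i\<ge>m. f i \<le> y) \<and> (\<forall>v. mean v = v \<and> (\<forall>i\<ge>m. f i \<le> v) \<longrightarrow> y \<le> v)" for m
  proof -
    have S: "f ` {m..} \<subseteq> harmonic" "f ` {m..} \<noteq> {}" "\<And>g. g \<in> f ` {m..} \<Longrightarrow> g \<le> tree_unit"
      using f by auto
    obtain y where "y \<in> harmonic" "\<And>g. g \<in> f ` {m..} \<Longrightarrow> g \<le> y"
      "\<And>v. mean v = v \<Longrightarrow> (\<And>g. g \<in> f ` {m..} \<Longrightarrow> g \<le> v) \<Longrightarrow> y \<le> v"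
      using harmonic_sup[OF S(1,2) tree_unit_harmonic S(3)] by metis
    then show ?thesis by (intro exI[of _ y]) auto
  qed
  then obtain y where y: "\<And>m. y m \<in> harmonic" "\<And>m i. m \<le> i \<Longrightarrow> f i \<le> y m"
    "\<And>m v. mean v = v \<Longrightarrow> (\<forall>i\<ge>m. f i \<le> v) \<Longrightarrow> y m \<le> v" by metis
  have y_mono: "y n \<le> y m" if "m \<le> n" for m n
    using that y(2) by (intro y(3) harmonic_mean y(1)) (meson order_trans)
  have y_root: "y m 1 \<le> 2 * (1 / 2) ^ m" for m
    using le_funD[OF y(3)[OF G_mean], of m m 1] f_le_G G_root[of m] by force
  have "down_to_0 HL (range y)"
  proof (rule down_to_0_harmonicI)
    show "range y \<subseteq> harmonic" using y(1) by blast
    show "0 \<le> z" if "z \<in> range y" for z using that order_trans[OF f(2) y(2)[OF order_refl]] by auto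
    show "\<exists>w\<in>range y. w \<le> u \<and> w \<le> v" if "u \<in> range y" "v \<in> range y" for u v
      using that y_mono by (auto intro: exI[of _ "max _ _"]) (meson max.cobounded1 max.cobounded2)
    show "\<exists>z\<in>range y. z 1 < e" if e: "0 < e" for e
    proof -
      obtain m where "(1 / 2) ^ m < e / 2" using real_arch_pow_inv[of "e / 2" "1 / 2"] e by auto
      then have "y m 1 < e" using y_root[of m] by simp
      then show ?thesis by blast
    qed
  qed
  then have "o_conv HL seq_order f 0"
  proof (rule vlat.o_convI_set[OF vlat_HL])
    fix z assume "z \<in> range y"
    then obtain m where m: "z = y m" by blast
    have "vabs HL (0 - f i) \<le> z" if "m \<le> i" for i
      using y(2)[OF that] m abs_uminus_harmonic[OF f(1,2)[of i]] by simp
    then show "\<exists>a\<in>Field seq_order. \<forall>a'. (a, a') \<in> seq_order \<longrightarrow> vle HL (vabs HL (0 - f a')) z"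
      by auto
  qed
  then show ?thesis by (simp add: f_def[abs_def])
qed

lemma ex_small_typewriter:
  assumes "infinite A"
  shows "\<exists>s::nat \<Rightarrow> nat. range s \<subseteq> A \<and> (\<forall>i. typewriter (s i) 1 \<le> (1 / 2) ^ i)"
proof -
  have "\<exists>n\<in>A. typewriter n 1 \<le> (1 / 2) ^ i" for i
  proof -
    obtain n where n: "n \<in> A" "n \<ge> 2 ^ Suc i"
      using assms unfolding infinite_nat_iff_unbounded_le by blast
    have "typewriter n 1 \<le> 2 / real (Suc n)" unfolding typewriter_def by (rule indicator_tree_root_le) simp
    also have "\<dots> \<le> 2 / 2 ^ Suc i"
    proof (intro divide_left_mono)
      show "2 ^ Suc i \<le> real (Suc n)" using n(2) by (metis of_nat_le_iff of_nat_numeral of_nat_power le_SucI)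
    qed auto
    also have "\<dots> = (1 / 2) ^ i" by (simp add: power_one_over)
    finally show ?thesis using n(1) by blast
  qed
  then show ?thesis by (metis image_subsetI)
qed

text \<open>All operators lie between \<open>0\<close> and \<open>\<psi> \<otimes> 1\<close> and map \<open>1\<close> to the typewriter sequence.  So uo-convergence of the
  operators, or of their values at \<open>1\<close>, would make that sequence order null.\<close>

lemma typewriter_operators:
  defines "T \<equiv> \<lambda>n. rank_one HL (\<lambda>m. m 1) (typewriter n)"
  shows "\<And>n. T n \<in> vcarrier HO"
    and "null Mode_tau T" "\<not> null Mode_uo T"
    and "null Mode_Stau T" "\<not> null Mode_SUO T"
proof -
  have f: "typewriter n \<in> harmonic" "0 \<le> typewriter n" "typewriter n \<le> tree_unit" for n
    using indicator_tree by (auto simp: typewriter_def)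
  have op: "rank_one HL (\<lambda>m. m 1) g \<in> vcarrier HO" if "g \<in> harmonic" for g using rank_one_eval[OF that] .
  show T: "T n \<in> vcarrier HO" for n unfolding T_def by (rule op[OF f(1)])
  have T_app: "T n x = x 1 *\<^sub>R typewriter n" if "x \<in> harmonic" for n x
    using that by (simp add: T_def rank_one_apply)
  have T_unit: "T n tree_unit = typewriter n" for n using T_app[OF tree_unit_harmonic] by simp
  have sub: "\<exists>s::nat \<Rightarrow> nat. range s \<subseteq> A \<and> o_conv HO seq_order (\<lambda>i. T (s i)) 0" if A: "infinite A" for A
  proof -
    obtain s :: "nat \<Rightarrow> nat" where s: "range s \<subseteq> A" "\<And>i. typewriter (s i) 1 \<le> (1 / 2) ^ i"
      using ex_small_typewriter[OF A] by blast
    have "o_conv HO seq_order (\<lambda>i. T (s i)) 0"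
      unfolding T_def
      by (rule dc_vlat.rank_one_o_conv[OF dc_HL _ _ _ typewriter_subsequence[OF s(2)]])
        (use op f in \<open>auto simp: le_fun_def\<close>)
    then show ?thesis using s(1) by blast
  qed
  show "null Mode_tau T"
    using vlat.limitin_of_subsequences[OF dc_vlat.vlat_L[OF dc_HL] tau_hat_harmonic(4) T sub]
    by (simp add: tau_conv_def)
  show "null Mode_Stau T"
    unfolding converges.simps tau_conv_def
  proof
    fix x assume "x \<in> vcarrier HL"
    then have x: "x \<in> harmonic" by simp
    have Tx: "T n x \<in> vcarrier HL" for n using dc_vlat.op_in[OF dc_HL T] x by simp
    have "\<exists>s::nat \<Rightarrow> nat. range s \<subseteq> A \<and> o_conv HL seq_order (\<lambda>i. T (s i) x) 0" if A: "infinite A" for A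
    proof -
      obtain s :: "nat \<Rightarrow> nat" where s: "range s \<subseteq> A" "o_conv HO seq_order (\<lambda>i. T (s i)) 0" using sub[OF A] by blast
      have "o_conv HL seq_order (\<lambda>i. T (s i) x) (0 x)"
        using x T by (intro dc_vlat.o_conv_imp_pointwise[OF dc_HL s(2) _ zero_op]) auto
      then show ?thesis using s(1) by auto
    qed
    from vlat.limitin_of_subsequences[OF vlat_HL tau_hat_harmonic(1) Tx this]
    show "limitin (tau_hat HL) (\<lambda>n. T n x) (0 x) (net_filter seq_order)" by simp
  qed
  show "\<not> null Mode_SUO T"
  proof
    assume "null Mode_SUO T"
    then have "uo_conv HL seq_order typewriter 0" using tree_unit_harmonic by (auto simp: T_unit)
    then have "o_conv HL seq_order typewriter 0"
      using f tree_unit_harmonic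
      by (intro vlat.uo_conv_bounded_imp_o_conv[OF vlat_HL, of seq_order typewriter tree_unit]) auto
    then show False using typewriter_not_o_conv by simp
  qed
  show "\<not> null Mode_uo T"
  proof
    assume uo: "null Mode_uo T"
    let ?U = "rank_one HL (\<lambda>m. m 1) tree_unit"
    have "vle HO 0 (T n) \<and> vle HO (T n) ?U" for n
      unfolding HO_le_iff[OF zero_op T] HO_le_iff[OF T op[OF tree_unit_harmonic]]
      using f[of n] by (auto simp: T_app rank_one_apply le_fun_def intro!: mult_left_mono)
    then have "o_conv HO seq_order T 0"
      using uo T op[OF tree_unit_harmonic]
      by (intro vlat.uo_conv_bounded_imp_o_conv[OF dc_vlat.vlat_L[OF dc_HL], of seq_order T ?U]) auto
    then have "o_conv HL seq_order (\<lambda>n. T n tree_unit) (0 tree_unit)"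
      using T tree_unit_harmonic by (intro dc_vlat.o_conv_imp_pointwise[OF dc_HL _ _ zero_op]) auto
    then show False using typewriter_not_o_conv by (simp add: T_unit)
  qed
qed

subsection \<open>Rademacher functionals: pointwise without topological convergence\<close>

definition rademacher :: "nat \<Rightarrow> (real \<Rightarrow> real) \<Rightarrow> real" where
  "rademacher n m = (\<Sum>k\<in>{2 ^ n..<2 ^ Suc n}. (- 1) ^ k * m (real k)) / 2 ^ n"

text \<open>Bessel's inequality in martingale form: the energy \<open>V n\<close>, the mean of \<open>m\<^sup>2\<close> over level \<open>n\<close>, is increasing and
  bounded, and by the Cauchy--Schwarz inequality its increment is at least the square of the next
  Rademacher coefficient.\<close>

lemma rademacher_null:
  assumes m: "m \<in> harmonic"
  shows "(\<lambda>n. rademacher n m) \<longlonglongrightarrow> 0"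
proof -
  define V where "V n = (\<Sum>k\<in>{2 ^ n..<2 ^ Suc n}. (m (real k))\<^sup>2) / 2 ^ n" for n
  obtain K where K: "\<And>x. \<bar>m x\<bar> \<le> K" using harmonic_bounded[OF m] by blast
  have V_bd: "V n \<le> K\<^sup>2" for n
  proof -
    have "(\<Sum>k\<in>{2 ^ n..<2 ^ Suc n}. (m (real k))\<^sup>2) \<le> (\<Sum>k\<in>{2 ^ n..<2 ^ Suc n::nat}. K\<^sup>2)"
      using K by (intro sum_mono) (simp add: abs_le_square_iff[symmetric] abs_le_iff order_trans[OF _ abs_ge_self])
    then show ?thesis by (simp add: V_def field_simps)
  qed
  have step: "(rademacher (Suc n) m)\<^sup>2 \<le> V (Suc n) - V n" for n
  proof -
    let ?I = "{2 ^ n..<2 ^ Suc n::nat}"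
    define a where "a k = m (real (2 * k))" for k
    define b where "b k = m (real (2 * k + 1))" for k
    have mk: "m (real k) = (a k + b k) / 2" if "k \<in> ?I" for k
    proof -
      have "(1::nat) \<le> 2 ^ n" by simp
      then have "k \<ge> 1" using that by (metis atLeastLessThan_iff order_trans)
      then show ?thesis using harmonic_step[OF m, of k] by (simp add: a_def b_def add_divide_distrib)
    qed
    have pairs: "(\<Sum>k\<in>{2 ^ Suc n..<2 ^ Suc (Suc n)}. f k) = (\<Sum>k\<in>?I. f (2 * k) + f (2 * k + 1))" for f :: "nat \<Rightarrow> real"
      using sum_pairs[of f "2 ^ n" "2 ^ Suc n"] by simp
    have "V (Suc n) - V n = (\<Sum>k\<in>?I. (a k)\<^sup>2 + (b k)\<^sup>2) / 2 ^ Suc n - (\<Sum>k\<in>?I. ((a k + b k) / 2)\<^sup>2) / 2 ^ n"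
    proof -
      have "(\<Sum>k\<in>?I. (m (real k))\<^sup>2) = (\<Sum>k\<in>?I. ((a k + b k) / 2)\<^sup>2)"
        by (rule sum.cong[OF refl]) (simp only: mk)
      then show ?thesis unfolding V_def pairs by (simp only: a_def b_def)
    qed
    also have "\<dots> = (\<Sum>k\<in>?I. ((a k)\<^sup>2 + (b k)\<^sup>2) / 2 - ((a k + b k) / 2)\<^sup>2) / 2 ^ n"
      by (simp add: sum_subtractf diff_divide_distrib flip: sum_divide_distrib)
    also have "\<dots> = (\<Sum>k\<in>?I. ((a k - b k) / 2)\<^sup>2) / 2 ^ n"
    proof -
      have "(u\<^sup>2 + v\<^sup>2) / 2 - ((u + v) / 2)\<^sup>2 = ((u - v) / 2)\<^sup>2" for u v :: real
        by (simp add: power2_eq_square field_simps)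
      then show ?thesis by simp
    qed
    finally have V: "V (Suc n) - V n = (\<Sum>k\<in>?I. ((a k - b k) / 2)\<^sup>2) / 2 ^ n" .
    have "rademacher (Suc n) m = (\<Sum>k\<in>?I. a k - b k) / 2 ^ Suc n"
      unfolding rademacher_def pairs by (simp add: a_def b_def)
    also have "\<dots> = (\<Sum>k\<in>?I. (a k - b k) / 2) / 2 ^ n"
      by (simp flip: sum_divide_distrib)
    finally have R: "rademacher (Suc n) m = (\<Sum>k\<in>?I. (a k - b k) / 2) / 2 ^ n" .
    have "(\<Sum>k\<in>?I. (a k - b k) / 2)\<^sup>2 \<le> (\<Sum>k\<in>?I. ((a k - b k) / 2)\<^sup>2) * 2 ^ n"
      using sum_squared_le_sum_of_squares[of "\<lambda>k. (a k - b k) / 2" ?I] by simp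
    then show ?thesis unfolding V R by (simp add: power_divide power2_eq_square[of "2 ^ n"] field_simps)
  qed
  have inc: "incseq V"
    using step by (intro incseq_SucI) (smt (verit) zero_le_power2)
  obtain l where l: "V \<longlonglongrightarrow> l" using incseq_convergent[OF inc, of "K\<^sup>2"] V_bd by metis
  have "(\<lambda>n. V (Suc n) - V n) \<longlonglongrightarrow> 0"
    using tendsto_diff[OF LIMSEQ_Suc[OF l] l] by simp
  then have "(\<lambda>n. (rademacher (Suc n) m)\<^sup>2) \<longlonglongrightarrow> 0"
    by (rule tendsto_sandwich[OF _ _ tendsto_const, rotated 2]) (auto intro: always_eventually step)
  then have "(\<lambda>n. rademacher (Suc n) m) \<longlonglongrightarrow> 0"
    using tendsto_real_sqrt[of "\<lambda>n. (rademacher (Suc n) m)\<^sup>2" 0] by (simp add: tendsto_rabs_zero_iff)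
  then show ?thesis by (rule LIMSEQ_imp_Suc)
qed

lemma scaled_unit_o_null:
  assumes c: "c \<longlonglongrightarrow> 0"
  shows "o_conv HL seq_order (\<lambda>n. c n *\<^sub>R tree_unit) 0"
proof -
  let ?Y = "(\<lambda>d::real. d *\<^sub>R tree_unit) ` {0<..}"
  have su: "d *\<^sub>R tree_unit \<in> harmonic" for d using subspace_scale[OF subspace_harmonic tree_unit_harmonic] .
  have um: "d *\<^sub>R tree_unit \<le> e *\<^sub>R tree_unit" if "d \<le> e" for d e
    using that by (simp add: le_fun_def tree_unit_def)
  have "down_to_0 HL ?Y"
  proof (rule down_to_0_harmonicI)
    show "?Y \<subseteq> harmonic" using su by blast
    show "0 \<le> y" if "y \<in> ?Y" for y using that tree_unit_nonneg by (auto simp: le_fun_def)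
    show "\<exists>w\<in>?Y. w \<le> y \<and> w \<le> z" if yz: "y \<in> ?Y" "z \<in> ?Y" for y z
    proof -
      obtain d e where de: "d > 0" "e > 0" "y = d *\<^sub>R tree_unit" "z = e *\<^sub>R tree_unit" using yz by auto
      have "min d e *\<^sub>R tree_unit \<in> ?Y" using de by (intro imageI) simp
      then show ?thesis using um[of "min d e" d] um[of "min d e" e] de by (metis min.cobounded1 min.cobounded2)
    qed
    show "\<exists>y\<in>?Y. y 1 < e" if "0 < e" for e
    proof -
      have "(e / 2) *\<^sub>R tree_unit \<in> ?Y" using that by (intro imageI) simp
      moreover have "((e / 2) *\<^sub>R tree_unit) 1 < e" using that by simp
      ultimately show ?thesis by blast
    qed
  qed
  then show ?thesis
  proof (rule vlat.o_convI_set[OF vlat_HL])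
    fix y assume "y \<in> ?Y"
    then obtain d where d: "d > 0" "y = d *\<^sub>R tree_unit" by auto
    obtain N where N: "\<And>n. n \<ge> N \<Longrightarrow> \<bar>c n\<bar> < d" using LIMSEQ_D[OF c d(1)] by auto
    have "vle HL (vabs HL (0 - c n *\<^sub>R tree_unit)) y" if "N \<le> n" for n
    proof (rule vlat.abs_least[OF vlat_HL])
      show "vle HL (0 - c n *\<^sub>R tree_unit) y" using um[of "- c n" d] N[OF that] d(2) by simp
      show "vle HL (- (0 - c n *\<^sub>R tree_unit)) y" using um[of "c n" d] N[OF that] d(2) by simp
    qed (use su d(2) subspace_neg[OF subspace_harmonic] in auto)
    then show "\<exists>a\<in>Field seq_order. \<forall>a'. (a, a') \<in> seq_order \<longrightarrow> vle HL (vabs HL (0 - c a' *\<^sub>R tree_unit)) y"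
      by auto
  qed
qed

text \<open>The signs of level \<open>n\<close> are constant on the subtrees of that level.  Projecting \<open>x\<close> onto the even and the odd
  ones and applying the upper bound \<open>A\<close> of \<open>\<plusminus>T\<close> with the matching sign recovers the full mean \<open>x 1\<close>.\<close>

lemma abs_rademacher_ge:
  assumes A: "A \<in> vcarrier HO" "vle HO (rank_one HL (rademacher n) tree_unit) A"
      "vle HO (- rank_one HL (rademacher n) tree_unit) A"
    and op: "rank_one HL (rademacher n) tree_unit \<in> vcarrier HO"
  shows "vle HO (rank_one HL (\<lambda>m. m 1) tree_unit) A"
proof -
  let ?I = "{2 ^ n..<2 ^ Suc n::nat}" and ?T = "rank_one HL (rademacher n) tree_unit"
  define D where "D P = \<Union>(subtree ` {k \<in> ?I. P k})" for P
  have neg: "- ?T \<in> vcarrier HO" using subspace_neg[OF dc_vlat.subspace_op[OF dc_HL] op] .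
  have closed: "child_closed (D P)" for P unfolding D_def by (rule child_closed_Union) (auto intro: child_closed_subtree)
  have disj: "D even \<inter> D odd = {}"
  proof -
    have "subtree k \<inter> subtree l = {}" if "k \<in> ?I" "even k" "l \<in> ?I" "odd l" for k l
      using that by (intro subtree_disjoint_same_level[of _ n]) auto
    then show ?thesis unfolding D_def by blast
  qed
  have "(x 1) *\<^sub>R tree_unit \<le> A x" if x: "x \<in> harmonic" "0 \<le> x" for x
  proof -
    obtain y where y: "y \<in> harmonic" "0 \<le> y" "y \<le> x" "\<And>z. z \<in> D even \<Longrightarrow> y z = x z"
      "\<And>D' z. child_closed D' \<Longrightarrow> D even \<inter> D' = {} \<Longrightarrow> z \<in> D' \<Longrightarrow> y z = 0"
      using harmonic_restrict[OF x closed[of even]] by metis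
    have z: "x - y \<in> harmonic" "0 \<le> x - y"
      using subspace_diff[OF subspace_harmonic x(1) y(1)] y(3) by (auto simp: le_fun_def)
    have term_eq: "(- 1) ^ k * y (real k) - (- 1) ^ k * (x - y) (real k) = x (real k)" if k: "k \<in> ?I" for k
    proof (cases "even k")
      case True
      then have "y (real k) = x (real k)" using k by (intro y(4)) (auto simp: D_def intro: root_in_subtree)
      then show ?thesis using True by simp
    next
      case False
      then have "y (real k) = 0" using k by (intro y(5)[OF closed[of odd] disj]) (auto simp: D_def intro: root_in_subtree)
      then show ?thesis using False by simp
    qed
    have "rademacher n y - rademacher n (x - y) =
        (\<Sum>k\<in>?I. (- 1) ^ k * y (real k) - (- 1) ^ k * (x - y) (real k)) / 2 ^ n"
      by (simp add: rademacher_def sum_subtractf diff_divide_distrib)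
    also have "\<dots> = x 1" using term_eq level_mean[OF x(1), of n] by simp
    finally have eq: "rademacher n y - rademacher n (x - y) = x 1" .
    have "?T y \<le> A y" using A HO_le_iff[OF op A(1)] y by blast
    moreover have "(- ?T) (x - y) \<le> A (x - y)" using A HO_le_iff[OF neg A(1)] z by blast
    moreover have "A x = A y + A (x - y)"
      using dc_vlat.op_add[OF dc_HL A(1), of y "x - y"] y(1) z(1) by simp
    ultimately have "?T y + (- ?T) (x - y) \<le> A x" by (simp add: le_fun_def) (metis add_mono diff_conv_add_uminus)
    moreover have "?T y + (- ?T) (x - y) = (x 1) *\<^sub>R tree_unit"
      using y(1) z(1) eq by (simp add: rank_one_apply flip: scaleR_diff_left)
    ultimately show ?thesis by simp
  qed
  then show ?thesis
    using HO_le_iff[OF rank_one_eval[OF tree_unit_harmonic] A(1)] by (simp add: rank_one_apply)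
qed

text \<open>Solid neighbourhoods of \<open>0\<close> containing \<open>T n\<close> contain \<open>\<psi> \<otimes> 1\<close>, by \<open>abs_rademacher_ge\<close>; so the Hausdorff property
  excludes topological convergence to \<open>0\<close>.\<close>

lemma SO_not_tau:
  "\<exists>T. (\<forall>n. T n \<in> vcarrier HO) \<and> null Mode_SO T \<and> \<not> null Mode_tau T"
proof -
  define T where "T n = rank_one HL (rademacher n) tree_unit" for n
  have T: "T n \<in> vcarrier HO" for n
    unfolding T_def
  proof (rule rank_one_harmonic[OF _ _ _ tree_unit_harmonic])
    show "rademacher n (x + y) = rademacher n x + rademacher n y" for x y
      by (simp add: rademacher_def distrib_left sum.distrib add_divide_distrib)
    show "rademacher n (c *\<^sub>R x) = c * rademacher n x" for c x
      by (simp add: rademacher_def sum_distrib_left algebra_simps)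
    fix b :: "real \<Rightarrow> real" assume b: "b \<in> harmonic" "0 \<le> b"
    have "\<bar>rademacher n x\<bar> \<le> b 1" if x: "x \<in> harmonic" "0 \<le> x" "x \<le> b" for x
    proof -
      have "\<bar>\<Sum>k\<in>{2 ^ n..<2 ^ Suc n}. (- 1) ^ k * x (real k)\<bar> \<le> (\<Sum>k\<in>{2 ^ n..<2 ^ Suc n}. x (real k))"
        using x(2) by (intro order_trans[OF sum_abs] sum_mono) (simp add: abs_mult power_abs le_fun_def)
      then have "\<bar>rademacher n x\<bar> \<le> x 1"
        unfolding rademacher_def level_mean[OF x(1), of n] by (simp add: divide_right_mono)
      then show ?thesis using x(3) by (auto simp: le_fun_def intro: order_trans)
    qed
    then show "\<exists>K. \<forall>x\<in>harmonic. 0 \<le> x \<and> x \<le> b \<longrightarrow> \<bar>rademacher n x\<bar> \<le> K" by blast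
  qed
  have "null Mode_SO T"
    using scaled_unit_o_null[OF rademacher_null] by (simp add: T_def rank_one_apply)
  moreover have "\<not> null Mode_tau T"
  proof
    assume "null Mode_tau T"
    then have lim: "limitin (tau_hat HO) T 0 (net_filter seq_order)" by (simp add: tau_conv_def)
    let ?P = "rank_one HL (\<lambda>m. m 1) tree_unit"
    have P: "?P \<in> vcarrier HO" by (rule rank_one_eval[OF tree_unit_harmonic])
    have P0: "vle HO 0 ?P"
      using HO_le_iff[OF zero_op P] tree_unit_nonneg by (auto simp: rank_one_apply le_fun_def)
    have "?P tree_unit \<noteq> 0 tree_unit" using tree_unit_neq_0 by (simp add: rank_one_apply tree_unit_harmonic)
    then have "?P \<noteq> 0" by metis
    then obtain U V where UV: "openin (tau_hat HO) U" "0 \<in> U" "?P \<in> V" "disjnt U V"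
      using tau_hat_harmonic(5,6) P zero_op unfolding Hausdorff_space_def by metis
    obtain W S where W: "openin (tau_hat HO) W" "0 \<in> W" "W \<subseteq> S" "solid HO S" "S \<subseteq> U"
      using tau_hat_harmonic(4) UV(1,2) unfolding uo_Lebesgue_def locally_solid_def by meson
    have "eventually (\<lambda>n. T n \<in> W) (net_filter seq_order)" using lim W(1,2) by (auto simp: limitin_def)
    then obtain n where n: "T n \<in> S" using W(3) by (auto simp: net_filter_seq_order eventually_sequentially)
    have "vle HO ?P (vabs HO (T n))"
    proof (rule abs_rademacher_ge)
      show "vabs HO (T n) \<in> vcarrier HO" "vle HO (rank_one HL (rademacher n) tree_unit) (vabs HO (T n))"
        "vle HO (- rank_one HL (rademacher n) tree_unit) (vabs HO (T n))"
        "rank_one HL (rademacher n) tree_unit \<in> vcarrier HO"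
        using T[of n] dc_vlat.L_abs_in[OF dc_HL T[of n]] dc_vlat.L_abs_ge[OF dc_HL T[of n]]
          dc_vlat.L_abs_ge_minus[OF dc_HL T[of n]] by (simp_all add: T_def)
    qed
    moreover have "vabs HO ?P = ?P" using dc_vlat.L_abs_of_nonneg[OF dc_HL P0 P] .
    ultimately have "?P \<in> S" using W(4) P n unfolding solid_def by metis
    then show False using W(5) UV by (auto simp: disjnt_def)
  qed
  ultimately show ?thesis using T by (intro exI[of _ T]) simp
qed

section \<open>The classification\<close>

text \<open>A sequence that separates \<open>p\<close> from \<open>q\<close> also separates every mode weaker than \<open>p\<close> from every mode
  stronger than \<open>q\<close>.\<close>

lemma not_implies_mode:
  assumes "\<exists>T. (\<forall>n. T n \<in> vcarrier HO) \<and> null p T \<and> \<not> null q T"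
    and valid: "(p, c1) \<in> valid_pairs" "(c2, q) \<in> valid_pairs"
  shows "\<not> implies_mode TYPE(real \<Rightarrow> real) TYPE(nat) c1 c2"
proof
  assume c12: "implies_mode TYPE(real \<Rightarrow> real) TYPE(nat) c1 c2"
  obtain T where T: "\<forall>n. T n \<in> vcarrier HO" and pq: "null p T" "\<not> null q T" using assms(1) by blast
  have use: "null d T" if "implies_mode TYPE(real \<Rightarrow> real) TYPE(nat) c d" "null c T" for c d
    using that(1)[unfolded implies_mode_def, rule_format, of HL seq_order T 0] that(2)
      dedekind_complete_harmonic ex_Hausdorff_uo_Lebesgue_harmonic directed_seq_order T zero_op by blast
  have "null q T"
    using use[OF valid_implies[OF valid(2)] use[OF c12 use[OF valid_implies[OF valid(1)] pq(1)]]] .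
  then show False using pq(2) by blast
qed

lemma invalid_not_implies:
  assumes "(c1, c2) \<notin> valid_pairs"
  shows "\<not> implies_mode TYPE(real \<Rightarrow> real) TYPE(nat) c1 c2"
proof -
  have "\<exists>T. (\<forall>n. T n \<in> vcarrier HO) \<and> null Mode_tau T \<and> \<not> null Mode_uo T"
    "\<exists>T. (\<forall>n. T n \<in> vcarrier HO) \<and> null Mode_Stau T \<and> \<not> null Mode_SUO T"
    by (intro exI[of _ "\<lambda>n. rank_one HL (\<lambda>m. m 1) (typewriter n)"] conjI allI typewriter_operators)+
  note ce = this[THEN not_implies_mode] not_implies_mode[OF uo_not_Stau]
    not_implies_mode[OF SO_not_tau] not_implies_mode[OF SUO_not_SO]
  consider "(Mode_uo, c1) \<in> valid_pairs" "(c2, Mode_Stau) \<in> valid_pairs"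
    | "(Mode_SO, c1) \<in> valid_pairs" "(c2, Mode_tau) \<in> valid_pairs"
    | "(Mode_SUO, c1) \<in> valid_pairs" "(c2, Mode_SO) \<in> valid_pairs"
    | "(Mode_tau, c1) \<in> valid_pairs" "(c2, Mode_uo) \<in> valid_pairs"
    | "(Mode_Stau, c1) \<in> valid_pairs" "(c2, Mode_SUO) \<in> valid_pairs"
    using assms by (cases c1; cases c2; simp add: valid_pairs_def)
  then show ?thesis using ce by cases blast+
qed

theorem mainTheorem1:
  fixes c1 c2 :: conv_mode
  shows "((c1, c2) \<in> valid_pairs \<longrightarrow>
            implies_mode TYPE('a::real_vector) TYPE('i) c1 c2) \<and>
         ((c1, c2) \<notin> valid_pairs \<longrightarrow>
            \<not> implies_mode TYPE(real \<Rightarrow> real) TYPE(nat) c1 c2)"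
  using valid_implies invalid_not_implies by blast

end
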